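(* Suppose $A$ and $B$ are (not necessarily symmetric) real $d\times d$ matrices such that $A\mathbf{1} = A^T\mathbf{1}= a\mathbf{1}$ and $B\mathbf{1} =B^T\mathbf{1} =b\mathbf{1}$, where $\mathbf{1}$ is the all-ones vector. Let $\det(xI-AA^T)=(x-a^2)p(x)$ and $\det(xI-BB^T)=(x-b^2)q(x)$. Then \begin{align*} \mathbb{E}_{P,S}\, \det\left(xI-\begin{bmatrix}0 & A\\ A^T & 0\end{bmatrix}-(P\oplus S)\begin{bmatrix}0 & B\\ B^T & 0\end{bmatrix}(P\oplus S)^T\right) & = \mathbb{S} \left((x-(a+b)^2)p(x)\boxplus\!\boxplus q(x)\right)\\ & = (x^{2}-(a+b)^2)\, \mathbb{S} \left(p(x)\boxplus\!\boxplus_{d-1} q(x)\right), \end{align*} where $P$ and $S$ are independent uniformly random $d\times d$ permutation matrices and $P\oplus S=\begin{bmatrix}P&0\\0&S\end{bmatrix}$.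
   Context: For a polynomial $r$, $(\mathbb{S} r)(x):=r(x^2)$. For degree-$n$ real-rooted polynomials with nonnegative roots $p(x)=\det(xI-CC^T)$ and $q(x)=\det(xI-DD^T)$ ($C,D$ arbitrary $n\times n$ matrices), the asymmetric additive convolution is $p\boxplus\!\boxplus_n q(x)=\mathbb{E}_{Q,R}\det\left(xI-(C+QDR^T)(C+QDR^T)^T\right)$, where $Q,R$ are independent Haar-random elements of the orthogonal group $O(n)$; this depends only on $p$ and $q$. Here $p$ and $q$ have degree $d-1$, so the convolution is taken with $n=d-1$. *)

theory Defs
  imports "HOL-Probability.Probability" "HOL-Combinatorics.Permutations"
    "Jordan_Normal_Form.Char_Poly"
begin

text \<open>
  Matrices carry their dimension as a natural number, because the statement relates size
  \<open>d\<close> to size \<open>d - 1\<close>, and \<open>d - 1 = 0\<close> is allowed.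
  For a square matrix \<open>M\<close>, \<^term>\<open>char_poly M\<close> is \<open>det (x I - M)\<close>, as a polynomial in \<open>x\<close>.
  Expectations of random polynomials are taken pointwise in \<open>x\<close>, which for polynomials of
  bounded degree is the same as coefficientwise.
\<close>

definition orth_group :: "nat \<Rightarrow> real mat set" where
  "orth_group n = {Q \<in> carrier_mat n n. Q\<^sup>T * Q = 1\<^sub>m n}"

text \<open>
  The Borel sigma-algebra of \<open>O(n)\<close> as a subspace of the \<open>n \<times> n\<close> matrices. The matrix type
  has no topology; the Borel sets of a finite-dimensional real space are generated by the
  coordinate maps.
\<close>

definition orth_borel :: "nat \<Rightarrow> real mat measure" where
  "orth_borel n = sigma (orth_group n)
     {(\<lambda>Q. Q $$ (i, j)) -` E \<inter> orth_group n | i j E. i < n \<and> j < n \<and> E \<in> sets borel}"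

definition is_haar_orth :: "nat \<Rightarrow> real mat measure \<Rightarrow> bool" where
  "is_haar_orth n M \<longleftrightarrow> prob_space M \<and> sets M = sets (orth_borel n) \<and>
     (\<forall>U \<in> orth_group n. distr M M (\<lambda>Q. U * Q) = M)"

text \<open>
  The Haar probability measure of a compact group exists and is unique, so nothing depends
  on the choice made here.
\<close>

definition haar_orth :: "nat \<Rightarrow> real mat measure" where
  "haar_orth n = (SOME M. is_haar_orth n M)"

text \<open>
  The asymmetric additive convolution of \<open>p\<close> and \<open>q\<close>. The definite description expresses that
  the expected polynomial depends only on \<open>p\<close> and \<open>q\<close>, not on \<open>C\<close> and \<open>D\<close>. The product measure
  makes \<open>Q\<close> and \<open>R\<close> independent.
\<close>

definition asym_add_conv :: "nat \<Rightarrow> real poly \<Rightarrow> real poly \<Rightarrow> real poly" where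
  "asym_add_conv n p q = (THE r. \<exists>C \<in> carrier_mat n n. \<exists>D \<in> carrier_mat n n.
     p = char_poly (C * C\<^sup>T) \<and> q = char_poly (D * D\<^sup>T) \<and>
     (\<forall>x. poly r x =
        (\<integral>(Q, R). poly (char_poly ((C + Q * D * R\<^sup>T) * (C + Q * D * R\<^sup>T)\<^sup>T)) x
           \<partial>(haar_orth n \<Otimes>\<^sub>M haar_orth n))))"

definition sq_subst :: "real poly \<Rightarrow> real poly" where
  "sq_subst r = pcompose r [:0, 0, 1:]"

definition perm_mats :: "nat \<Rightarrow> real mat set" where
  "perm_mats d = {mat d d (\<lambda>(i, j). if i = \<sigma> j then 1 else 0) | \<sigma>. \<sigma> permutes {..<d}}"

definition ones_vec :: "nat \<Rightarrow> real vec" where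
  "ones_vec d = vec d (\<lambda>_. 1)"

definition bipartite_mat :: "nat \<Rightarrow> real mat \<Rightarrow> real mat" where
  "bipartite_mat d A = four_block_mat (0\<^sub>m d d) A A\<^sup>T (0\<^sub>m d d)"

definition direct_sum_mat :: "nat \<Rightarrow> real mat \<Rightarrow> real mat \<Rightarrow> real mat" where
  "direct_sum_mat d P S = four_block_mat P (0\<^sub>m d d) (0\<^sub>m d d) S"

end

theory Submission
  imports Defs
begin

text \<open>
  Both expectations are compared with a third one, in which \<open>Q\<close> and \<open>R\<close> are replaced by signed
  permutation matrices \<open>U\<close> and \<open>V\<close> of size \<open>n = d - 1\<close>. Write \<open>det (x I - M M\<^sup>T)\<close> for
  \<open>M = C + U D V\<^sup>T\<close> as the determinant of a \<open>2n \<times> 2n\<close> block matrix. Averaging over the signs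
  removes from its Leibniz expansion every term that is not a product of complementary principal
  minors for \<open>C\<close> and \<open>D\<close>; averaging over the permutations then decouples the two factors, and what
  remains is determined by the characteristic polynomials of \<open>C C\<^sup>T\<close> and \<open>D D\<^sup>T\<close>. As these do not
  change when \<open>D\<close> is replaced by \<open>Q D R\<^sup>T\<close>, invariance of Haar measure identifies the Haar
  expectation with the average over signed permutations.

  For permutation matrices, consider \<open>L (X) = \<Sum>\<^sub>P det (x I - (A + P X) (A + P X)\<^sup>T)\<close>. If \<open>R\<close> is the
  rotation by \<open>\<theta>\<close> about \<open>(1, 1, 1)\<close> in three coordinates, then \<open>L (R X)\<close> is a trigonometric
  polynomial in \<open>\<theta>\<close> of degree at most 2. It has period \<open>2 \<pi> / 3\<close>, because that rotation is a cyclic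
  permutation, so it is constant. Differentiating at \<open>\<theta> = 0\<close> and taking linear combinations, \<open>L\<close> is
  stationary in the direction of every skew matrix that annihilates the all-ones vector. Hence \<open>L\<close>
  is constant along paths of reflections in vectors orthogonal to the all-ones vector. Such a path
  starts at a transposition, so \<open>L\<close> is invariant under all these reflections, and therefore under the
  signed permutation matrices with respect to an orthonormal basis of the complement of the all-ones
  vector.
\<close>

section \<open>Averages over signed permutation matrices\<close>

text \<open>Signed permutations mediate because they act on both sides: being orthogonal, they act
  on Haar measure by translation; being generated by reflections, they fall under the invariance
  proved for permutation sums. Either expectation can therefore be averaged over them without
  change, after which the integrand, or the summand for fixed \<open>P\<close> and \<open>S\<close>,
  is constant. The obstacle is that the permutation matrices of size \<open>d\<close> act on the
  complement of the all-ones vector through a group that is in general too small to contain them.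
  Invariance under larger transformations is thus a property of the summed determinants and not of
  the group: a rotation enters each determinant with degree at most 2, and the cyclic group of order
  3 averages all frequencies up to 2 exactly as the full circle does. This is why rotations of
  exactly three coordinates appear. On the other side, \<open>haar_orth\<close> is a choice and
  \<open>asym_add_conv\<close> a definite description, so an invariant measure has to be
  constructed, and the expected polynomial has to be shown independent of \<open>C\<close> and
  \<open>D\<close>; the latter is the same decoupling over signed permutations.\<close>

definition mask_mat :: "nat \<Rightarrow> nat set \<Rightarrow> real mat \<Rightarrow> real mat \<Rightarrow> real mat" where
  "mask_mat m S A B = mat m m (\<lambda>(i, j). if i \<in> S \<and> j \<in> S then B $$ (i, j)
     else if i \<notin> S \<and> j \<notin> S then A $$ (i, j) else 0)"

text \<open>A sign vector is encoded by the set of its negative positions, so that a sum over all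
  sign vectors is a sum over a power set and can be recognised as an expanded product.\<close>

definition sign_flip :: "nat set \<Rightarrow> nat \<Rightarrow> real" where
  "sign_flip T i = (if i \<in> T then - 1 else 1)"

lemma sign_flip_square [simp]: "sign_flip T i * sign_flip T i = 1"
  by (simp add: sign_flip_def)

lemma permutes_less: "p permutes {0..<m} \<Longrightarrow> i < m \<Longrightarrow> p i < (m :: nat)"
  using permutes_in_image[of p "{0..<m}" i] by simp

lemma mask_mat_carrier [simp]: "mask_mat m S A B \<in> carrier_mat m m"
  by (simp add: mask_mat_def)

text \<open>Both sides are -1 to the power of the size of the intersection. Exchanging the two sets
  turns a sum over sign vectors \<open>T\<close> into the expansion of a product over single
  indices.\<close>

lemma prod_sign_flip:
  assumes "finite S" "finite T"
  shows "(\<Prod>i\<in>S. sign_flip T i) = (\<Prod>i\<in>T. sign_flip S i)"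
proof -
  have "(\<Prod>i\<in>S. sign_flip T i) = (\<Prod>i\<in>S \<inter> T. - 1)"
    unfolding sign_flip_def by (rule prod.mono_neutral_cong_right) (use assms in auto)
  also have "\<dots> = (\<Prod>i\<in>T. sign_flip S i)"
    unfolding sign_flip_def by (rule prod.mono_neutral_cong_left) (use assms in auto)
  finally show ?thesis .
qed

text \<open>Orthogonality of the characters of the group of sign vectors: the sum factors over the
  indices, and an index that lies in exactly one of the two sets contributes the factor -1 +
  1.\<close>

lemma sum_sign_flip_orthogonal:
  assumes "finite M" "S \<subseteq> M" "S' \<subseteq> M"
  shows "(\<Sum>T\<in>Pow M. (\<Prod>i\<in>S. sign_flip T i) * (\<Prod>i\<in>S'. sign_flip T i)) =
    (if S = S' then 2 ^ card M else 0)"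
proof -
  have fin: "finite S" "finite S'" using assms finite_subset by auto
  have "(\<Sum>T\<in>Pow M. (\<Prod>i\<in>S. sign_flip T i) * (\<Prod>i\<in>S'. sign_flip T i)) =
      (\<Sum>T\<in>Pow M. (\<Prod>i\<in>T. sign_flip S i * sign_flip S' i) * (\<Prod>i\<in>M - T. 1))"
  proof (rule sum.cong)
    fix T assume "T \<in> Pow M"
    then have "finite T" using assms finite_subset by auto
    then show "(\<Prod>i\<in>S. sign_flip T i) * (\<Prod>i\<in>S'. sign_flip T i) =
        (\<Prod>i\<in>T. sign_flip S i * sign_flip S' i) * (\<Prod>i\<in>M - T. 1)"
      using fin by (simp add: prod_sign_flip prod.distrib)
  qed simp
  also have "\<dots> = (\<Prod>i\<in>M. sign_flip S i * sign_flip S' i + 1)"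
    using assms(1) by (rule prod_add[symmetric])
  also have "\<dots> = (if S = S' then 2 ^ card M else 0)"
  proof (cases "S = S'")
    case False
    then obtain a where "a \<in> M" "a \<in> S \<longleftrightarrow> a \<notin> S'" using assms by blast
    then have "sign_flip S a * sign_flip S' a + 1 = 0" by (auto simp: sign_flip_def)
    then show ?thesis using False \<open>a \<in> M\<close> assms(1) by (auto intro!: prod_zero)
  qed simp
  finally show ?thesis .
qed

text \<open>A Leibniz term of \<open>p\<close> splits according to the set \<open>S\<close> of rows
  taken from \<open>B\<close>. Its sign is the product of the characters of \<open>S\<close> and of
  the image of \<open>S\<close> under \<open>p\<close>, so only terms in which \<open>p\<close>
  preserves \<open>S\<close> survive the average. These are the Leibniz terms of the masked
  matrices.\<close>

lemma sum_sign_flip_det: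
  fixes A B :: "real mat"
  shows "(\<Sum>T\<in>Pow {..<m}. det (mat m m (\<lambda>(i, j). A $$ (i, j) + sign_flip T i * sign_flip T j * B $$ (i, j)))) =
    2 ^ m * (\<Sum>S\<in>Pow {..<m}. det (mask_mat m S A B))"
proof -
  let ?P = "{p. p permutes {0..<m}}"
  let ?a = "\<lambda>p S. (\<Prod>i\<in>S. B $$ (i, p i)) * (\<Prod>i\<in>{..<m} - S. A $$ (i, p i))"
  have fin: "finite ?P" by (simp add: finite_permutations)
  have L: "det (mat m m (\<lambda>(i, j). A $$ (i, j) + sign_flip T i * sign_flip T j * B $$ (i, j))) =
     (\<Sum>p\<in>?P. of_int (sign p) * (\<Sum>S\<in>Pow {..<m}.
         ?a p S * ((\<Prod>i\<in>S. sign_flip T i) * (\<Prod>i\<in>p ` S. sign_flip T i))))" for T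
  proof -
    have "det (mat m m (\<lambda>(i, j). A $$ (i, j) + sign_flip T i * sign_flip T j * B $$ (i, j))) =
      (\<Sum>p\<in>?P. of_int (sign p) *
        (\<Prod>i\<in>{..<m}. sign_flip T i * sign_flip T (p i) * B $$ (i, p i) + A $$ (i, p i)))"
      by (subst det_def'[of _ m], simp, intro sum.cong refl arg_cong2[where f = "(*)"] prod.cong)
        (auto simp: atLeast0LessThan intro: permutes_less)
    also have "\<dots> = (\<Sum>p\<in>?P. of_int (sign p) * (\<Sum>S\<in>Pow {..<m}.
         ?a p S * ((\<Prod>i\<in>S. sign_flip T i) * (\<Prod>i\<in>p ` S. sign_flip T i))))"
    proof (rule sum.cong[OF refl])
      fix p assume p: "p \<in> ?P"
      then have inj: "inj_on p S" for S by (auto intro: permutes_inj_on)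
      show "of_int (sign p) * (\<Prod>i\<in>{..<m}. sign_flip T i * sign_flip T (p i) * B $$ (i, p i) + A $$ (i, p i)) =
         of_int (sign p) * (\<Sum>S\<in>Pow {..<m}.
         ?a p S * ((\<Prod>i\<in>S. sign_flip T i) * (\<Prod>i\<in>p ` S. sign_flip T i)))"
        by (subst prod_add) (auto simp: prod.distrib prod.reindex[OF inj] algebra_simps)
    qed
    finally show ?thesis .
  qed
  have R: "det (mask_mat m S A B) = (\<Sum>p\<in>?P. of_int (sign p) * (if S = p ` S then ?a p S else 0))"
    if S: "S \<in> Pow {..<m}" for S
  proof -
    have "(\<Prod>i = 0..<m. mask_mat m S A B $$ (i, p i)) = (if S = p ` S then ?a p S else 0)"
      if p: "p permutes {0..<m}" for p
    proof -
      have pi: "p i < m" if "i < m" for i using p that by (simp add: permutes_less)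
      show ?thesis
      proof (cases "S = p ` S")
        case True
        then have iff: "p i \<in> S \<longleftrightarrow> i \<in> S" for i
          using p by (metis image_iff permutes_inj injD)
        have "(\<Prod>i = 0..<m. mask_mat m S A B $$ (i, p i)) =
          (\<Prod>i\<in>S \<union> ({..<m} - S). if i \<in> S then B $$ (i, p i) else A $$ (i, p i))"
          using S by (intro prod.cong) (auto simp: mask_mat_def pi iff)
        also have "\<dots> = ?a p S"
          using S finite_subset[of S "{..<m}"]
          by (subst prod.union_disjoint) (auto intro!: arg_cong2[where f = "(*)"] prod.cong)
        finally show ?thesis using True by simp
      next
        case False
        \<comment> \<open>A permutation that maps the finite set \<open>S\<close> into itself maps
          it onto itself. Otherwise some row crosses between \<open>S\<close> and its complement,
          where the masked matrix vanishes.\<close>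
        have "\<exists>i<m. \<not> (p i \<in> S \<longleftrightarrow> i \<in> S)"
        proof (rule ccontr)
          assume "\<not> ?thesis"
          then have "p ` S \<subseteq> S" using S by auto
          moreover have "card (p ` S) = card S"
            using p by (intro card_image permutes_inj_on)
          ultimately have "p ` S = S"
            using S finite_subset[of S "{..<m}"] by (intro card_subset_eq) auto
          then show False using False by simp
        qed
        then obtain i where "i < m" "\<not> (p i \<in> S \<longleftrightarrow> i \<in> S)" by blast
        then have "mask_mat m S A B $$ (i, p i) = 0" by (auto simp: mask_mat_def pi)
        then show ?thesis using False \<open>i < m\<close> by (auto intro!: prod_zero)
      qed
    qed
    then show ?thesis
      by (subst det_def'[of _ m]) (auto intro!: sum.cong)
  qed
  have "(\<Sum>T\<in>Pow {..<m}. det (mat m m (\<lambda>(i, j). A $$ (i, j) + sign_flip T i * sign_flip T j * B $$ (i, j)))) =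
     (\<Sum>p\<in>?P. \<Sum>T\<in>Pow {..<m}. of_int (sign p) * (\<Sum>S\<in>Pow {..<m}.
         ?a p S * ((\<Prod>i\<in>S. sign_flip T i) * (\<Prod>i\<in>p ` S. sign_flip T i))))"
    unfolding L by (rule sum.swap)
  also have "\<dots> = (\<Sum>p\<in>?P. of_int (sign p) * (\<Sum>S\<in>Pow {..<m}. ?a p S *
       (\<Sum>T\<in>Pow {..<m}. (\<Prod>i\<in>S. sign_flip T i) * (\<Prod>i\<in>p ` S. sign_flip T i))))"
    unfolding sum_distrib_left by (intro sum.cong refl sum.swap)
  also have "\<dots> = (\<Sum>p\<in>?P. of_int (sign p) * (\<Sum>S\<in>Pow {..<m}. ?a p S *
       (if S = p ` S then 2 ^ m else 0)))"
  proof (intro sum.cong refl arg_cong2[where f = "(*)"])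
    fix p S assume "p \<in> ?P" "S \<in> Pow {..<m}"
    then have "p ` S \<subseteq> {..<m}" by (auto simp: permutes_less)
    then show "(\<Sum>T\<in>Pow {..<m}. (\<Prod>i\<in>S. sign_flip T i) * (\<Prod>i\<in>p ` S. sign_flip T i)) =
      (if S = p ` S then 2 ^ m else 0)"
      using \<open>S \<in> Pow {..<m}\<close> by (subst sum_sign_flip_orthogonal) auto
  qed
  also have "\<dots> = (\<Sum>p\<in>?P. \<Sum>S\<in>Pow {..<m}. 2 ^ m * (of_int (sign p) * (if S = p ` S then ?a p S else 0)))"
    unfolding sum_distrib_left by (intro sum.cong refl) auto
  also have "\<dots> = (\<Sum>S\<in>Pow {..<m}. \<Sum>p\<in>?P. 2 ^ m * (of_int (sign p) * (if S = p ` S then ?a p S else 0)))"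
    by (rule sum.swap)
  also have "\<dots> = 2 ^ m * (\<Sum>S\<in>Pow {..<m}. det (mask_mat m S A B))"
    unfolding sum_distrib_left using R by (intro sum.cong refl) (simp add: sum_distrib_left)
  finally show ?thesis .
qed

text \<open>Each factor carries one of the two diagonal blocks and an identity in place of the
  other. Taking determinants separates \<open>A\<close> from \<open>B\<close> without reordering
  rows and columns into block form.\<close>

lemma mask_mat_factor:
  "mask_mat m S A B = mask_mat m S A (1\<^sub>m m) * mask_mat m S (1\<^sub>m m) B"
proof (rule eq_matI)
  fix i j assume "i < dim_row (mask_mat m S A (1\<^sub>m m) * mask_mat m S (1\<^sub>m m) B)"
    "j < dim_col (mask_mat m S A (1\<^sub>m m) * mask_mat m S (1\<^sub>m m) B)"
  then have ij: "i < m" "j < m" by (auto simp: mask_mat_def)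
  have "(mask_mat m S A (1\<^sub>m m) * mask_mat m S (1\<^sub>m m) B) $$ (i, j) =
     (\<Sum>k<m. mask_mat m S A (1\<^sub>m m) $$ (i, k) * mask_mat m S (1\<^sub>m m) B $$ (k, j))"
    using ij by (simp add: mask_mat_def scalar_prod_def atLeast0LessThan)
  also have "\<dots> = (\<Sum>k<m. if k = (if i \<in> S then i else j) then mask_mat m S A B $$ (i, j) else 0)"
    using ij by (intro sum.cong refl) (auto simp: mask_mat_def)
  also have "\<dots> = mask_mat m S A B $$ (i, j)"
    using ij by simp
  finally show "mask_mat m S A B $$ (i, j) =
     (mask_mat m S A (1\<^sub>m m) * mask_mat m S (1\<^sub>m m) B) $$ (i, j)" by simp
qed (auto simp: mask_mat_def)

lemma det_mask_mat:
  "det (mask_mat m S A B) = det (mask_mat m S A (1\<^sub>m m)) * det (mask_mat m S (1\<^sub>m m) B)"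
  unfolding mask_mat_factor[of m S A B] by (rule det_mult[OF mask_mat_carrier mask_mat_carrier])

lemma det_mask_mat_diag:
  assumes S: "S \<subseteq> {..<m}"
  shows "det (mask_mat m S (mat m m (\<lambda>(i, j). if i = j then f i else 0)) (1\<^sub>m m)) = (\<Prod>i\<in>{..<m} - S. f i)"
    and "det (mask_mat m S (1\<^sub>m m) (mat m m (\<lambda>(i, j). if i = j then f i else 0))) = (\<Prod>i\<in>S. f i)"
proof -
  have *: "det (mat m m (\<lambda>(i, j). if i = j then g i else 0)) = (\<Prod>i<m. g i)" for g :: "nat \<Rightarrow> real"
    by (subst det_upper_triangular[of _ m])
      (auto simp: diag_mat_def atLeast0LessThan prod.list_conv_set_nth intro!: prod.cong)
  have "mask_mat m S (mat m m (\<lambda>(i, j). if i = j then f i else 0)) (1\<^sub>m m) =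
      mat m m (\<lambda>(i, j). if i = j then (if i \<in> S then 1 else f i) else 0)"
    by (rule eq_matI) (auto simp: mask_mat_def)
  then have "det (mask_mat m S (mat m m (\<lambda>(i, j). if i = j then f i else 0)) (1\<^sub>m m)) =
      (\<Prod>i<m. if i \<in> S then 1 else f i)" by (simp add: *)
  also have "\<dots> = (\<Prod>i\<in>{..<m} - S. f i)"
    by (rule prod.mono_neutral_cong_right) auto
  finally show "det (mask_mat m S (mat m m (\<lambda>(i, j). if i = j then f i else 0)) (1\<^sub>m m)) =
    (\<Prod>i\<in>{..<m} - S. f i)" .
  have "mask_mat m S (1\<^sub>m m) (mat m m (\<lambda>(i, j). if i = j then f i else 0)) =
      mat m m (\<lambda>(i, j). if i = j then (if i \<in> S then f i else 1) else 0)"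
    by (rule eq_matI) (auto simp: mask_mat_def)
  then have "det (mask_mat m S (1\<^sub>m m) (mat m m (\<lambda>(i, j). if i = j then f i else 0))) =
      (\<Prod>i<m. if i \<in> S then f i else 1)" by (simp add: *)
  also have "\<dots> = (\<Prod>i\<in>S. f i)"
    using S by (intro prod.mono_neutral_cong_right) auto
  finally show "det (mask_mat m S (1\<^sub>m m) (mat m m (\<lambda>(i, j). if i = j then f i else 0))) =
    (\<Prod>i\<in>S. f i)" .
qed

text \<open>The sign of the permutation enters once for the rows and once for the columns.\<close>

lemma det_permute_both:
  assumes "A \<in> carrier_mat m m" "p permutes {0..<m}"
  shows "det (mat m m (\<lambda>(i, j). A $$ (p i, p j))) = det (A :: real mat)"
proof -
  let ?B = "mat m m (\<lambda>(i, j). A $$ (p i, j))"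
  have pl: "p i < m" if "i < m" for i using assms(2) that by (simp add: permutes_less)
  have "mat m m (\<lambda>(i, j). A $$ (p i, p j)) = (mat m m (\<lambda>(i, j). ?B\<^sup>T $$ (p i, j)))\<^sup>T"
    by (rule eq_matI) (auto simp: pl)
  then have "det (mat m m (\<lambda>(i, j). A $$ (p i, p j))) = det (mat m m (\<lambda>(i, j). ?B\<^sup>T $$ (p i, j)))"
    by (simp add: det_transpose[of _ m])
  also have "\<dots> = of_int (sign p) * det (?B\<^sup>T)"
    by (rule det_permute_rows[OF _ assms(2)]) simp
  also have "\<dots> = of_int (sign p) * (of_int (sign p) * det A)"
    using det_permute_rows[OF assms] by (simp add: det_transpose[of _ m])
  finally show ?thesis by (simp add: sign_def)
qed

text \<open>Comparison of coefficients for a polynomial in two variables, done in one variable at a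
  time so that univariate polynomials suffice.\<close>

lemma sum_powers_eq_zero_imp:
  fixes h :: "'b \<Rightarrow> real"
  assumes X: "finite X" and zero: "\<And>s t. (\<Sum>S\<in>X. s ^ a S * t ^ b S * h S) = 0"
  shows "(\<Sum>S | S \<in> X \<and> a S = k \<and> b S = l. h S) = 0"
proof -
  have coeff_zero: "(\<Sum>S | S \<in> Y \<and> c S = k. g S) = 0"
    if "finite Y" "\<And>s. (\<Sum>S\<in>Y. s ^ c S * g S) = 0" for Y :: "'b set" and c :: "'b \<Rightarrow> nat" and g :: "'b \<Rightarrow> real" and k
  proof -
    have "poly (\<Sum>S\<in>Y. monom (g S) (c S)) s = 0" for s :: real
      using that(2)[of s] by (simp add: poly_sum poly_monom mult.commute)
    then have "(\<Sum>S\<in>Y. monom (g S) (c S)) = 0"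
      using poly_all_0_iff_0 by blast
    then have "(\<Sum>S\<in>Y. coeff (monom (g S) (c S)) k) = 0"
      by (metis coeff_sum coeff_0)
    then have "(\<Sum>S\<in>Y. if c S = k then g S else 0) = 0"
      by (simp add: coeff_monom)
    then show ?thesis
      using that(1) by (simp add: sum.If_cases Int_def)
  qed
  have "(\<Sum>S | S \<in> X \<and> a S = k. t ^ b S * h S) = 0" for t
    using coeff_zero[OF X, of a "\<lambda>S. t ^ b S * h S" k] zero[of _ t] by (simp add: mult.assoc)
  then have "(\<Sum>S | S \<in> {S \<in> X. a S = k} \<and> b S = l. h S) = 0"
    using X by (intro coeff_zero[where c = b and g = h]) auto
  then show ?thesis by (simp add: conj_assoc)
qed

lemma ex_permutes_image:
  assumes "finite X" "A \<subseteq> X" "B \<subseteq> X" "card A = card B"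
  obtains p where "p permutes X" "p ` A = B"
proof -
  have fin: "finite A" "finite B" using assms finite_subset by auto
  obtain f where f: "bij_betw f A B" using finite_same_card_bij[OF fin assms(4)] by blast
  have "card (X - A) = card (X - B)" using assms fin by (simp add: card_Diff_subset)
  then obtain g where g: "bij_betw g (X - A) (X - B)"
    using finite_same_card_bij[of "X - A" "X - B"] assms(1) by auto
  define p where "p x = (if x \<in> A then f x else if x \<in> X then g x else x)" for x
  have "bij_betw p A B" using f by (rule bij_betw_cong[THEN iffD1, rotated]) (auto simp: p_def)
  moreover have "bij_betw p (X - A) (X - B)"
    using g by (rule bij_betw_cong[THEN iffD1, rotated]) (auto simp: p_def)
  ultimately have "bij_betw p (A \<union> (X - A)) (B \<union> (X - B))"
    by (rule bij_betw_combine) auto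
  then have "bij_betw p X X" using assms by (simp add: Un_absorb1)
  then have "p permutes X" by (rule bij_imp_permutes) (use assms in \<open>auto simp: p_def\<close>)
  moreover have "p ` A = B" using \<open>bij_betw p A B\<close> by (simp add: bij_betw_def)
  ultimately show ?thesis by (rule that)
qed


section \<open>Bordered matrices and signed block permutations\<close>

text \<open>The determinant depends on \<open>M * M\<^sup>T\<close>, whereas the matrix itself is
  affine in \<open>M\<close>, so adding matrices amounts to adding off-diagonal blocks. The two
  diagonal parameters are kept apart because they will count the indices of the two halves
  separately.\<close>

definition block_pencil :: "nat \<Rightarrow> real \<Rightarrow> real \<Rightarrow> real mat \<Rightarrow> real mat" where
  "block_pencil n s t M = four_block_mat (s \<cdot>\<^sub>m 1\<^sub>m n) M M\<^sup>T (t \<cdot>\<^sub>m 1\<^sub>m n)"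

lemma block_pencil_carrier [simp]: "M \<in> carrier_mat n n \<Longrightarrow> block_pencil n s t M \<in> carrier_mat (n + n) (n + n)"
  by (simp add: block_pencil_def)

lemma poly_char_poly:
  assumes "A \<in> carrier_mat n n"
  shows "poly (char_poly A) x = det (x \<cdot>\<^sub>m 1\<^sub>m n - (A :: real mat))"
proof -
  have "- char_matrix A x = x \<cdot>\<^sub>m 1\<^sub>m n - A"
    using assms by (intro eq_matI) (auto simp: char_matrix_def)
  then show ?thesis using char_poly_matrix[OF assms, of x] by simp
qed

lemma det_block_pencil:
  assumes M: "M \<in> carrier_mat n n"
  shows "det (block_pencil n s t M) = poly (char_poly (M * M\<^sup>T)) (s * t)"
proof -
  have "det (block_pencil n s t M) = det ((s \<cdot>\<^sub>m 1\<^sub>m n) * (t \<cdot>\<^sub>m 1\<^sub>m n) - M * M\<^sup>T)"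
    unfolding block_pencil_def by (rule det_four_block_mat) (use M in auto)
  also have "(s \<cdot>\<^sub>m 1\<^sub>m n) * (t \<cdot>\<^sub>m 1\<^sub>m n) = (s * t) \<cdot>\<^sub>m (1\<^sub>m n :: real mat)"
    by (rule eq_matI) auto
  also have "det ((s * t) \<cdot>\<^sub>m 1\<^sub>m n - M * M\<^sup>T) = poly (char_poly (M * M\<^sup>T)) (s * t)"
    using M by (subst poly_char_poly[of _ n]) auto
  finally show ?thesis .
qed

lemma index_block_pencil:
  assumes "M \<in> carrier_mat n n" "i < n + n" "j < n + n"
  shows "block_pencil n s t M $$ (i, j) =
    (if i < n then if j < n then (if i = j then s else 0) else M $$ (i, j - n)
     else if j < n then M $$ (j, i - n) else (if i = j then t else 0))"
  using assms by (auto simp: block_pencil_def)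

text \<open>
  A pair of permutations of \<open>{..<n}\<close>, one for the rows and one for the columns, is encoded as a single
  permutation of \<open>{..<2n}\<close> that preserves both halves. Likewise one subset of \<open>{..<2n}\<close> encodes the
  signs of the rows and of the columns.
\<close>

definition block_perms :: "nat \<Rightarrow> (nat \<Rightarrow> nat) set" where
  "block_perms n = {\<rho>. \<rho> permutes {..<n + n} \<and> \<rho> ` {..<n} = {..<n}}"

text \<open>The entry of row \<open>i\<close> stands in column \<open>\<sigma> i\<close>, the
  transpose of the usual convention for permutation matrices: left multiplication reads row
  \<open>\<sigma> i\<close>, and products compose the permutations in reverse order.\<close>

definition signed_perm_mat :: "nat \<Rightarrow> (nat \<Rightarrow> nat) \<Rightarrow> (nat \<Rightarrow> real) \<Rightarrow> real mat" where
  "signed_perm_mat n \<sigma> e = mat n n (\<lambda>(i, j). if j = \<sigma> i then e i else 0)"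

definition row_signed_perm :: "nat \<Rightarrow> (nat \<Rightarrow> nat) \<Rightarrow> nat set \<Rightarrow> real mat" where
  "row_signed_perm n \<rho> T = signed_perm_mat n \<rho> (sign_flip T)"

definition col_signed_perm :: "nat \<Rightarrow> (nat \<Rightarrow> nat) \<Rightarrow> nat set \<Rightarrow> real mat" where
  "col_signed_perm n \<rho> T = signed_perm_mat n (\<lambda>j. \<rho> (n + j) - n) (\<lambda>j. sign_flip T (n + j))"

lemma signed_perm_mat_carrier [simp]: "signed_perm_mat n \<sigma> e \<in> carrier_mat n n"
  by (simp add: signed_perm_mat_def)

lemma row_signed_perm_carrier [simp]: "row_signed_perm n \<rho> T \<in> carrier_mat n n"
  and col_signed_perm_carrier [simp]: "col_signed_perm n \<rho> T \<in> carrier_mat n n"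
  by (simp_all add: row_signed_perm_def col_signed_perm_def)

lemma index_signed_perm_mult:
  assumes "D \<in> carrier_mat n m" "i < n" "j < m" "\<sigma> i < n"
  shows "(signed_perm_mat n \<sigma> e * D) $$ (i, j) = e i * D $$ (\<sigma> i, j)"
proof -
  have "(signed_perm_mat n \<sigma> e * D) $$ (i, j) = (\<Sum>k<n. (if k = \<sigma> i then e i else 0) * D $$ (k, j))"
    using assms by (simp add: signed_perm_mat_def scalar_prod_def atLeast0LessThan)
  also have "\<dots> = (\<Sum>k<n. if k = \<sigma> i then e i * D $$ (\<sigma> i, j) else 0)"
    by (intro sum.cong) auto
  finally show ?thesis using assms by simp
qed

lemma index_mult_signed_perm_transpose:
  assumes "D \<in> carrier_mat m n" "i < m" "j < n" "\<sigma> j < n"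
  shows "(D * (signed_perm_mat n \<sigma> e)\<^sup>T) $$ (i, j) = e j * D $$ (i, \<sigma> j)"
proof -
  have "(D * (signed_perm_mat n \<sigma> e)\<^sup>T) $$ (i, j) = (\<Sum>k<n. D $$ (i, k) * (if k = \<sigma> j then e j else 0))"
    using assms by (simp add: signed_perm_mat_def scalar_prod_def atLeast0LessThan)
  also have "\<dots> = (\<Sum>k<n. if k = \<sigma> j then e j * D $$ (i, \<sigma> j) else 0)"
    by (intro sum.cong) auto
  finally show ?thesis using assms by simp
qed

lemma block_perms_less:
  assumes "\<rho> \<in> block_perms n"
  shows "i < n \<Longrightarrow> \<rho> i < n" and "n \<le> i \<Longrightarrow> n \<le> \<rho> i" and "i < n + n \<Longrightarrow> \<rho> i < n + n"
proof -
  have p: "\<rho> permutes {..<n + n}" and im: "\<rho> ` {..<n} = {..<n}"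
    using assms by (auto simp: block_perms_def)
  show "i < n \<Longrightarrow> \<rho> i < n" using im by auto
  show "i < n + n \<Longrightarrow> \<rho> i < n + n" using p permutes_in_image by fastforce
  show "n \<le> \<rho> i" if "n \<le> i"
  proof (rule ccontr)
    assume "\<not> n \<le> \<rho> i"
    then have "\<rho> i \<in> \<rho> ` {..<n}" using im by simp
    then have "i \<in> {..<n}" using permutes_inj[OF p] by (auto dest: injD)
    then show False using that by simp
  qed
qed

definition signed_perm_sum :: "nat \<Rightarrow> real \<Rightarrow> real mat \<Rightarrow> real mat \<Rightarrow> real" where
  "signed_perm_sum n x C D = (\<Sum>\<rho>\<in>block_perms n. \<Sum>T\<in>Pow {..<n + n}.
     let M = C + row_signed_perm n \<rho> T * D * (col_signed_perm n \<rho> T)\<^sup>T in poly (char_poly (M * M\<^sup>T)) x)"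

text \<open>The row and the column multiplier act together as one conjugation by a signed
  permutation of the doubled index set. The diagonal \<open>x\<close>, 1 is left with
  \<open>C\<close>, so only the off-diagonal blocks of \<open>D\<close> are conjugated.\<close>

lemma block_pencil_signed_perm:
  assumes C: "C \<in> carrier_mat n n" and D: "D \<in> carrier_mat n n" and \<rho>: "\<rho> \<in> block_perms n"
  shows "block_pencil n x 1 (C + row_signed_perm n \<rho> T * D * (col_signed_perm n \<rho> T)\<^sup>T) =
    mat (n + n) (n + n) (\<lambda>(i, j). block_pencil n x 1 C $$ (i, j) + sign_flip T i * sign_flip T j *
      mat (n + n) (n + n) (\<lambda>(i, j). block_pencil n 0 0 D $$ (\<rho> i, \<rho> j)) $$ (i, j))"
    (is "block_pencil n x 1 ?M = ?R")
proof (rule eq_matI)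
  have M: "?M \<in> carrier_mat n n" using C D
    by (intro add_carrier_mat mult_carrier_mat[of _ n n]) auto
  note l = block_perms_less[OF \<rho>]
  have square_index: "?M $$ (i, j) = C $$ (i, j) + sign_flip T i * sign_flip T (n + j) * D $$ (\<rho> i, \<rho> (n + j) - n)"
    if "i < n" "j < n" for i j
  proof -
    have r: "\<rho> (n + j) - n < n" "\<rho> i < n" using l[of "n + j"] l[of i] that by auto
    have "(row_signed_perm n \<rho> T * D * (col_signed_perm n \<rho> T)\<^sup>T) $$ (i, j) =
      sign_flip T (n + j) * (row_signed_perm n \<rho> T * D) $$ (i, \<rho> (n + j) - n)"
      unfolding col_signed_perm_def
      by (rule index_mult_signed_perm_transpose) (use that D r in \<open>auto intro!: mult_carrier_mat[of _ n n]\<close>)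
    also have "(row_signed_perm n \<rho> T * D) $$ (i, \<rho> (n + j) - n) = sign_flip T i * D $$ (\<rho> i, \<rho> (n + j) - n)"
      unfolding row_signed_perm_def by (rule index_signed_perm_mult[OF D]) (use that r in auto)
    finally show ?thesis
      using that C D by (subst index_add_mat) (auto simp: algebra_simps row_signed_perm_def col_signed_perm_def signed_perm_mat_def)
  qed
  have inj: "\<rho> i = \<rho> j \<longleftrightarrow> i = j" for i j
    using \<rho> permutes_inj[of \<rho> "{..<n + n}"] by (auto simp: block_perms_def dest: injD)
  fix i j assume "i < dim_row ?R" "j < dim_col ?R"
  then have ij: "i < n + n" "j < n + n" by auto
  have *: "\<rho> i < n \<longleftrightarrow> i < n" "\<rho> j < n \<longleftrightarrow> j < n"
    using l(1,2)[of i] l(1,2)[of j] by (meson not_le)+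
  have R: "?R $$ (i, j) = block_pencil n x 1 C $$ (i, j) + sign_flip T i * sign_flip T j * block_pencil n 0 0 D $$ (\<rho> i, \<rho> j)"
    using ij by simp
  show "block_pencil n x 1 ?M $$ (i, j) = ?R $$ (i, j)"
    unfolding R index_block_pencil[OF M ij] index_block_pencil[OF C ij] index_block_pencil[OF D l(3)[OF ij(1)] l(3)[OF ij(2)]] *
    using ij square_index[of i "j - n"] square_index[of j "i - n"] by (simp add: inj mult.commute not_less)
qed (use C D in \<open>auto simp: block_pencil_def row_signed_perm_def col_signed_perm_def signed_perm_mat_def\<close>)

section \<open>Principal minors and their generating functions\<close>

text \<open>With an identity outside \<open>S\<close>, the mask has as determinant the principal
  minor on \<open>S\<close> of the bordered matrix of \<open>D\<close>. In the same way
  \<open>row_minor\<close> is the principal minor of the pencil of \<open>C\<close> on the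
  complement of \<open>S\<close>.\<close>

definition col_minor :: "nat \<Rightarrow> real mat \<Rightarrow> nat set \<Rightarrow> real" where
  "col_minor n D S = det (mask_mat (n + n) S (1\<^sub>m (n + n)) (block_pencil n 0 0 D))"

definition row_minor :: "nat \<Rightarrow> real \<Rightarrow> real mat \<Rightarrow> nat set \<Rightarrow> real" where
  "row_minor n x C S = det (mask_mat (n + n) S (block_pencil n x 1 C) (1\<^sub>m (n + n)))"

text \<open>The signs leave products of complementary principal minors. A simultaneous permutation
  of rows and columns then only moves the index set of the minor of \<open>D\<close>.\<close>

lemma signed_perm_sum_minors:
  assumes C: "C \<in> carrier_mat n n" and D: "D \<in> carrier_mat n n"
  shows "signed_perm_sum n x C D =
    2 ^ (n + n) * (\<Sum>S\<in>Pow {..<n + n}. row_minor n x C S * (\<Sum>\<rho>\<in>block_perms n. col_minor n D (\<rho> ` S)))"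
proof -
  let ?B = "\<lambda>\<rho>. mat (n + n) (n + n) (\<lambda>(i, j). block_pencil n 0 0 D $$ (\<rho> i, \<rho> j))"
  have minor: "det (mask_mat (n + n) S (1\<^sub>m (n + n)) (?B \<rho>)) = col_minor n D (\<rho> ` S)"
    if \<rho>: "\<rho> \<in> block_perms n" for \<rho> S
  proof -
    have p: "\<rho> permutes {0..<n + n}" using \<rho> by (simp add: block_perms_def atLeast0LessThan)
    have inj: "\<rho> i = \<rho> j \<longleftrightarrow> i = j" for i j using permutes_inj[OF p] by (auto dest: injD)
    have "mask_mat (n + n) S (1\<^sub>m (n + n)) (?B \<rho>) =
      mat (n + n) (n + n) (\<lambda>(i, j). mask_mat (n + n) (\<rho> ` S) (1\<^sub>m (n + n)) (block_pencil n 0 0 D) $$ (\<rho> i, \<rho> j))"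
    proof (rule eq_matI, goal_cases)
      case (1 i j)
      then have ij: "i < n + n" "j < n + n" by (auto simp: mask_mat_def)
      have mem: "\<rho> k \<in> \<rho> ` S \<longleftrightarrow> k \<in> S" for k
        using permutes_inj[OF p] by (rule inj_image_mem_iff)
      show ?case
        using ij block_perms_less(3)[OF \<rho> ij(1)] block_perms_less(3)[OF \<rho> ij(2)]
        by (simp add: mask_mat_def mem inj)
    qed (simp_all add: mask_mat_def)
    then show ?thesis unfolding col_minor_def by (simp add: det_permute_both[OF mask_mat_carrier p])
  qed
  have "signed_perm_sum n x C D = (\<Sum>\<rho>\<in>block_perms n. \<Sum>T\<in>Pow {..<n + n}.
    det (mat (n + n) (n + n) (\<lambda>(i, j). block_pencil n x 1 C $$ (i, j) + sign_flip T i * sign_flip T j * ?B \<rho> $$ (i, j))))"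
    unfolding signed_perm_sum_def
  proof (intro sum.cong refl)
    fix \<rho> T assume \<rho>: "\<rho> \<in> block_perms n"
    let ?M = "C + row_signed_perm n \<rho> T * D * (col_signed_perm n \<rho> T)\<^sup>T"
    have M: "?M \<in> carrier_mat n n" using C D
      by (intro add_carrier_mat mult_carrier_mat[of _ n n]) auto
    show "(let M = ?M in poly (char_poly (M * M\<^sup>T)) x) =
      det (mat (n + n) (n + n) (\<lambda>(i, j). block_pencil n x 1 C $$ (i, j) + sign_flip T i * sign_flip T j * ?B \<rho> $$ (i, j)))"
      using det_block_pencil[OF M, of x 1] by (simp add: block_pencil_signed_perm[OF C D \<rho>] Let_def)
  qed
  also have "\<dots> = (\<Sum>\<rho>\<in>block_perms n. 2 ^ (n + n) * (\<Sum>S\<in>Pow {..<n + n}. row_minor n x C S * col_minor n D (\<rho> ` S)))"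
    unfolding sum_sign_flip_det
    by (intro sum.cong refl arg_cong2[where f = "(*)"]) (subst det_mask_mat, simp add: minor row_minor_def)
  also have "\<dots> = 2 ^ (n + n) * (\<Sum>S\<in>Pow {..<n + n}. row_minor n x C S * (\<Sum>\<rho>\<in>block_perms n. col_minor n D (\<rho> ` S)))"
    unfolding sum_distrib_left by (rule sum.swap)
  finally show ?thesis .
qed

abbreviation left_card :: "nat \<Rightarrow> nat set \<Rightarrow> nat" where
  "left_card n S \<equiv> card (S \<inter> {..<n})"

abbreviation right_card :: "nat \<Rightarrow> nat set \<Rightarrow> nat" where
  "right_card n S \<equiv> card (S \<inter> {n..<n + n})"

lemma prod_block_diag:
  assumes "S \<subseteq> {..<n + n}"
  shows "(\<Prod>i\<in>S. if i < n then s else t) = s ^ left_card n S * (t :: real) ^ right_card n S"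
proof -
  have "finite S" using assms finite_subset by auto
  then have "(\<Prod>i\<in>S. if i < n then s else t) =
      (\<Prod>i\<in>S \<inter> {i. i < n}. s) * (\<Prod>i\<in>S \<inter> - {i. i < n}. t)"
    by (subst prod.If_cases) auto
  moreover have "S \<inter> {i. i < n} = S \<inter> {..<n}" "S \<inter> - {i. i < n} = S \<inter> {n..<n + n}"
    using assms by auto
  ultimately show ?thesis by simp
qed

lemma mult_diag_mat:
  fixes M :: "'a :: comm_ring_1 mat"
  assumes "M \<in> carrier_mat d d" "i < d" "j < d"
  shows "(mat d d (\<lambda>(i, j). if i = j then f i else 0) * M) $$ (i, j) = f i * M $$ (i, j)"
    and "(M * mat d d (\<lambda>(i, j). if i = j then f i else 0)) $$ (i, j) = f j * M $$ (i, j)"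
proof -
  have "(\<Sum>k = 0..<d. (if i = k then f i else 0) * M $$ (k, j)) =
      (\<Sum>k = 0..<d. if k = i then f i * M $$ (i, j) else 0)"
    by (intro sum.cong) auto
  then show "(mat d d (\<lambda>(i, j). if i = j then f i else 0) * M) $$ (i, j) = f i * M $$ (i, j)"
    using assms by (simp add: scalar_prod_def)
  have "(\<Sum>k = 0..<d. M $$ (i, k) * (if k = j then f k else 0)) =
      (\<Sum>k = 0..<d. if k = j then f j * M $$ (i, j) else 0)"
    by (intro sum.cong) auto
  then show "(M * mat d d (\<lambda>(i, j). if i = j then f i else 0)) $$ (i, j) = f j * M $$ (i, j)"
    using assms by (simp add: scalar_prod_def)
qed

text \<open>Conjugation by signs leaves a diagonal matrix unchanged, so all determinants in the
  average over signs coincide, and the average becomes the expansion of a single determinant in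
  principal minors.\<close>

lemma sum_sign_flip_det_diag:
  assumes B: "B \<in> carrier_mat m m"
  shows "det (mat m m (\<lambda>(i, j). if i = j then f i else 0) + B) =
      (\<Sum>S\<in>Pow {..<m}. (\<Prod>i\<in>{..<m} - S. f i) * det (mask_mat m S (1\<^sub>m m) B))"
    and "det (B + mat m m (\<lambda>(i, j). if i = j then f i else 0)) =
      (\<Sum>S\<in>Pow {..<m}. (\<Prod>i\<in>S. f i) * det (mask_mat m S B (1\<^sub>m m)))"
proof -
  let ?F = "mat m m (\<lambda>(i, j). if i = j then f i else 0)"
  have eps: "det (mat m m (\<lambda>(i, j). ?F $$ (i, j) + sign_flip T i * sign_flip T j * B $$ (i, j))) = det (?F + B)" for T
  proof -
    let ?E = "mat m m (\<lambda>(i, j). if i = j then sign_flip T i else 0)"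
    note E = mult_diag_mat[of _ m _ _ "sign_flip T"]
    have "mat m m (\<lambda>(i, j). ?F $$ (i, j) + sign_flip T i * sign_flip T j * B $$ (i, j)) = ?E * ((?F + B) * ?E)"
    proof (rule eq_matI)
      fix i j assume "i < dim_row (?E * ((?F + B) * ?E))" "j < dim_col (?E * ((?F + B) * ?E))"
      then have ij: "i < m" "j < m" by auto
      have FB: "?F + B \<in> carrier_mat m m" using B by auto
      have FBE: "(?F + B) * ?E \<in> carrier_mat m m" by (rule mult_carrier_mat[OF FB]) simp
      have "(?E * ((?F + B) * ?E)) $$ (i, j) = sign_flip T i * (sign_flip T j * (?F + B) $$ (i, j))"
        unfolding E(1)[OF FBE ij] E(2)[OF FB ij] ..
      then show "mat m m (\<lambda>(i, j). ?F $$ (i, j) + sign_flip T i * sign_flip T j * B $$ (i, j)) $$ (i, j) =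
        (?E * ((?F + B) * ?E)) $$ (i, j)"
        using ij B by (auto simp: algebra_simps sign_flip_def)
    qed (use B in auto)
    moreover have "det (?E * ((?F + B) * ?E)) = det ?E * (det (?F + B) * det ?E)"
      using B by (subst det_mult[of _ m]; (subst det_mult[of _ m])?) (auto intro!: mult_carrier_mat[of _ m m])
    moreover have "det ?E = (\<Prod>i<m. sign_flip T i)"
    proof -
      have "mask_mat m {} ?E (1\<^sub>m m) = ?E" by (rule eq_matI) (auto simp: mask_mat_def)
      then show ?thesis using det_mask_mat_diag(1)[of "{}" m "sign_flip T"] by simp
    qed
    moreover have "(\<Prod>i<m. sign_flip T i) * (\<Prod>i<m. sign_flip T i) = 1"
      by (simp flip: prod.distrib)
    ultimately show ?thesis by (simp add: mult.left_commute mult.commute)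
  qed
  have "2 ^ m * det (?F + B) = (\<Sum>T\<in>Pow {..<m}. det (mat m m (\<lambda>(i, j). ?F $$ (i, j) + sign_flip T i * sign_flip T j * B $$ (i, j))))"
    unfolding eps by (simp add: card_Pow)
  also have "\<dots> = 2 ^ m * (\<Sum>S\<in>Pow {..<m}. det (mask_mat m S ?F B))" by (rule sum_sign_flip_det)
  finally have "det (?F + B) = (\<Sum>S\<in>Pow {..<m}. det (mask_mat m S ?F B))" by simp
  also have "\<dots> = (\<Sum>S\<in>Pow {..<m}. (\<Prod>i\<in>{..<m} - S. f i) * det (mask_mat m S (1\<^sub>m m) B))"
    by (intro sum.cong refl) (subst det_mask_mat, subst det_mask_mat_diag, auto)
  finally show "det (?F + B) = \<dots>" .
  have "mat m m (\<lambda>(i, j). B $$ (i, j) + sign_flip T i * sign_flip T j * ?F $$ (i, j)) = B + ?F" for T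
    using B by (intro eq_matI) auto
  then have "2 ^ m * det (B + ?F) = (\<Sum>T\<in>Pow {..<m}. det (mat m m (\<lambda>(i, j). B $$ (i, j) + sign_flip T i * sign_flip T j * ?F $$ (i, j))))"
    by (simp add: card_Pow)
  also have "\<dots> = 2 ^ m * (\<Sum>S\<in>Pow {..<m}. det (mask_mat m S B ?F))" by (rule sum_sign_flip_det)
  finally have "det (B + ?F) = (\<Sum>S\<in>Pow {..<m}. det (mask_mat m S B ?F))" by simp
  also have "\<dots> = (\<Sum>S\<in>Pow {..<m}. (\<Prod>i\<in>S. f i) * det (mask_mat m S B (1\<^sub>m m)))"
    by (intro sum.cong refl) (subst det_mask_mat, subst det_mask_mat_diag(2), auto)
  finally show "det (B + ?F) = \<dots>" .
qed

text \<open>The exponents count the indices outside \<open>S\<close> in each half, so a coefficient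
  in \<open>s\<close> and \<open>t\<close> is a sum of minors over all sets with given sizes in both
  halves. The right-hand side sees \<open>D\<close> only through a characteristic
  polynomial.\<close>

lemma col_minor_generating:
  assumes D: "D \<in> carrier_mat n n"
  shows "(\<Sum>S\<in>Pow {..<n + n}. s ^ left_card n ({..<n + n} - S) * t ^ right_card n ({..<n + n} - S) * col_minor n D S) =
    poly (char_poly (D * D\<^sup>T)) (s * t)"
proof -
  have "mat (n + n) (n + n) (\<lambda>(i, j). if i = j then (if i < n then s else t) else 0) + block_pencil n 0 0 D = block_pencil n s t D"
    using D by (intro eq_matI) (auto simp: index_block_pencil, (auto simp: block_pencil_def)?)
  then have "poly (char_poly (D * D\<^sup>T)) (s * t) = (\<Sum>S\<in>Pow {..<n + n}.
      (\<Prod>i\<in>{..<n + n} - S. if i < n then s else t) * col_minor n D S)"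
    using sum_sign_flip_det_diag(1)[of "block_pencil n 0 0 D" "n + n" "\<lambda>i. if i < n then s else t"] D
    by (simp add: det_block_pencil col_minor_def)
  then show ?thesis by (simp add: prod_block_diag)
qed

text \<open>Adding \<open>s\<close> and \<open>t\<close> on the diagonal yields again a pencil, now
  with parameters \<open>x + s\<close> and \<open>1 + t\<close>.\<close>

lemma row_minor_generating:
  assumes C: "C \<in> carrier_mat n n"
  shows "(\<Sum>S\<in>Pow {..<n + n}. s ^ left_card n S * t ^ right_card n S * row_minor n x C S) =
    poly (char_poly (C * C\<^sup>T)) ((x + s) * (1 + t))"
proof -
  have "block_pencil n x 1 C + mat (n + n) (n + n) (\<lambda>(i, j). if i = j then (if i < n then s else t) else 0) = block_pencil n (x + s) (1 + t) C"
    using C by (intro eq_matI) (auto simp: index_block_pencil, (auto simp: block_pencil_def)?)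
  then have "poly (char_poly (C * C\<^sup>T)) ((x + s) * (1 + t)) = (\<Sum>S\<in>Pow {..<n + n}.
      (\<Prod>i\<in>S. if i < n then s else t) * row_minor n x C S)"
    using sum_sign_flip_det_diag(2)[of "block_pencil n x 1 C" "n + n" "\<lambda>i. if i < n then s else t"] C
    by (simp add: det_block_pencil row_minor_def)
  then show ?thesis by (simp add: prod_block_diag)
qed

section \<open>Orbits of index sets under block permutations\<close>

text \<open>This is the orbit of \<open>S\<close> under \<open>block_perms n\<close>, described by
  the two cardinalities because these are the exponents in the generating functions.\<close>

definition same_type :: "nat \<Rightarrow> nat set \<Rightarrow> nat set set" where
  "same_type n S = {S' \<in> Pow {..<n + n}. left_card n S' = left_card n S \<and> right_card n S' = right_card n S}"

lemma sum_same_type_col_minor: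
  assumes D: "D \<in> carrier_mat n n" and D': "D' \<in> carrier_mat n n"
    and eq: "char_poly (D * D\<^sup>T) = char_poly (D' * D'\<^sup>T)" and S: "S \<subseteq> {..<n + n}"
  shows "sum (col_minor n D) (same_type n S) = sum (col_minor n D') (same_type n S)"
proof -
  have cl: "left_card n ({..<n + n} - S') = n - left_card n S'"
    and cr: "right_card n ({..<n + n} - S') = n - right_card n S'" if "S' \<subseteq> {..<n + n}" for S'
  proof -
    have "({..<n + n} - S') \<inter> {..<n} = {..<n} - (S' \<inter> {..<n})" by auto
    then show "left_card n ({..<n + n} - S') = n - left_card n S'" by (simp add: card_Diff_subset)
    have "({..<n + n} - S') \<inter> {n..<n + n} = {n..<n + n} - (S' \<inter> {n..<n + n})" by auto
    then show "right_card n ({..<n + n} - S') = n - right_card n S'" by (simp add: card_Diff_subset)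
  qed
  \<comment> \<open>Subtraction of natural numbers is truncated; up to \<open>n\<close> the sizes of
    the complement still determine the sizes of the set.\<close>
  have le: "left_card n S' \<le> n" "right_card n S' \<le> n" for S'
    using card_mono[of "{..<n}" "S' \<inter> {..<n}"] card_mono[of "{n..<n + n}" "S' \<inter> {n..<n + n}"] by auto
  have ty: "same_type n S = {S' \<in> Pow {..<n + n}. left_card n ({..<n + n} - S') = n - left_card n S \<and>
      right_card n ({..<n + n} - S') = n - right_card n S}"
  proof -
    have "n - left_card n S' = n - left_card n S \<longleftrightarrow> left_card n S' = left_card n S"
      "n - right_card n S' = n - right_card n S \<longleftrightarrow> right_card n S' = right_card n S" for S'
      using le[of S'] le[of S] by linarith+
    then show ?thesis unfolding same_type_def by (auto simp: cl cr)
  qed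
  have "(\<Sum>S' \<in> same_type n S. col_minor n D S' - col_minor n D' S') = 0"
    unfolding ty
    by (rule sum_powers_eq_zero_imp)
      (simp_all add: right_diff_distrib sum_subtractf col_minor_generating D D' eq)
  then show ?thesis by (simp add: sum_subtractf)
qed

lemma sum_same_type_row_minor:
  assumes C: "C \<in> carrier_mat n n" and C': "C' \<in> carrier_mat n n"
    and eq: "char_poly (C * C\<^sup>T) = char_poly (C' * C'\<^sup>T)"
  shows "sum (row_minor n x C) (same_type n S) = sum (row_minor n x C') (same_type n S)"
proof -
  have "(\<Sum>S' \<in> same_type n S. row_minor n x C S' - row_minor n x C' S') = 0"
    unfolding same_type_def
    by (rule sum_powers_eq_zero_imp)
      (simp_all add: right_diff_distrib sum_subtractf row_minor_generating C C' eq)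
  then show ?thesis by (simp add: sum_subtractf)
qed

lemma finite_block_perms [simp]: "finite (block_perms n)"
  unfolding block_perms_def by (rule finite_subset[OF _ finite_permutations[of "{..<n + n}"]]) auto

lemma block_perms_comp:
  assumes "\<rho> \<in> block_perms n" "\<pi> \<in> block_perms n"
  shows "\<rho> \<circ> \<pi> \<in> block_perms n"
proof -
  have "(\<rho> \<circ> \<pi>) ` {..<n} = {..<n}"
    using assms unfolding block_perms_def image_comp[symmetric] by simp
  then show ?thesis using assms by (simp add: block_perms_def permutes_compose)
qed

lemma block_perms_inv:
  assumes "\<rho> \<in> block_perms n"
  shows "inv_into UNIV \<rho> \<in> block_perms n"
proof -
  have p: "\<rho> permutes {..<n + n}" "\<rho> ` {..<n} = {..<n}" using assms by (auto simp: block_perms_def)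
  have "inv_into UNIV \<rho> ` {..<n} = inv_into UNIV \<rho> ` \<rho> ` {..<n}" by (simp add: p)
  also have "\<dots> = {..<n}" using permutes_inj[OF p(1)] by (simp add: image_comp)
  finally show ?thesis using p by (simp add: block_perms_def permutes_inv)
qed

lemma block_perms_image_same_type:
  assumes \<rho>: "\<rho> \<in> block_perms n" and S: "S \<subseteq> {..<n + n}"
  shows "\<rho> ` S \<in> same_type n S"
proof -
  have inj: "inj \<rho>" using \<rho> permutes_inj by (auto simp: block_perms_def)
  note l = block_perms_less[OF \<rho>]
  have lt: "\<rho> i < n \<longleftrightarrow> i < n" for i using l(1,2)[of i] by (meson not_le)
  have "\<rho> ` S \<inter> {..<n} = \<rho> ` (S \<inter> {..<n})" using lt by auto
  moreover have "\<rho> ` S \<inter> {n..<n + n} = \<rho> ` (S \<inter> {n..<n + n})"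
  proof -
    have "\<rho> i \<in> {n..<n + n} \<longleftrightarrow> i \<in> {n..<n + n}" if "i \<in> S" for i
      using lt[of i] l(3)[of i] that S by (auto simp flip: not_less)
    then show ?thesis by blast
  qed
  moreover have "\<rho> ` S \<subseteq> {..<n + n}" using S l(3) by auto
  ultimately show ?thesis
    unfolding same_type_def using inj by (auto simp: card_image inj_on_subset)
qed

text \<open>The two halves are treated independently: one permutation for each half, being the
  identity on the other, and then their composition.\<close>

lemma block_perms_transitive:
  assumes S: "S \<subseteq> {..<n + n}" and S': "S' \<in> same_type n S"
  obtains \<rho> where "\<rho> \<in> block_perms n" "\<rho> ` S = S'"
proof -
  have S'2: "S' \<subseteq> {..<n + n}" and c: "left_card n S' = left_card n S" "right_card n S' = right_card n S"
    using S' by (auto simp: same_type_def)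
  obtain p where p: "p permutes {..<n}" "p ` (S \<inter> {..<n}) = S' \<inter> {..<n}"
    using ex_permutes_image[of "{..<n}" "S \<inter> {..<n}" "S' \<inter> {..<n}"] c by auto
  obtain q where q: "q permutes {n..<n + n}" "q ` (S \<inter> {n..<n + n}) = S' \<inter> {n..<n + n}"
    using ex_permutes_image[of "{n..<n + n}" "S \<inter> {n..<n + n}" "S' \<inter> {n..<n + n}"] c by auto
  have qid: "q i = i" if "i < n" for i using q(1) that by (auto simp: permutes_def)
  have pid: "p i = i" if "n \<le> i" for i using p(1) that by (auto simp: permutes_def)
  have qn: "n \<le> q i" if "i \<in> {n..<n + n}" for i
    using permutes_in_image[OF q(1), of i] that by auto
  have "p permutes {..<n + n}" using p(1) by (rule permutes_subset) auto
  moreover have "q permutes {..<n + n}" using q(1) by (rule permutes_subset) auto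
  ultimately have "p \<circ> q permutes {..<n + n}" by (rule permutes_compose[rotated])
  moreover have "(p \<circ> q) ` {..<n} = {..<n}"
    using permutes_image[OF p(1)] by (subst image_comp[symmetric]) (simp add: qid)
  ultimately have \<rho>: "p \<circ> q \<in> block_perms n" by (simp add: block_perms_def)
  have "S = (S \<inter> {..<n}) \<union> (S \<inter> {n..<n + n})" using S by auto
  then have "(p \<circ> q) ` S = (p \<circ> q) ` (S \<inter> {..<n}) \<union> (p \<circ> q) ` (S \<inter> {n..<n + n})"
    by (metis image_Un)
  also have "(p \<circ> q) ` (S \<inter> {..<n}) = p ` (S \<inter> {..<n})" by (rule image_cong) (auto simp: qid)
  also have "(p \<circ> q) ` (S \<inter> {n..<n + n}) = q ` (S \<inter> {n..<n + n})"
    by (rule image_cong) (auto simp: pid qn)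
  also have "p ` (S \<inter> {..<n}) \<union> q ` (S \<inter> {n..<n + n}) = S'" using p q S'2 by auto
  finally show ?thesis using \<rho> that by blast
qed

lemma sum_block_perms_same_type:
  assumes S: "S \<subseteq> {..<n + n}" and S': "S' \<in> same_type n S"
  shows "(\<Sum>\<rho>\<in>block_perms n. f (\<rho> ` S')) = (\<Sum>\<rho>\<in>block_perms n. f (\<rho> ` S))"
proof -
  obtain \<pi> where \<pi>: "\<pi> \<in> block_perms n" "\<pi> ` S = S'" using block_perms_transitive[OF S S'] .
  then have bij: "\<pi> permutes {..<n + n}" by (simp add: block_perms_def)
  have "(\<Sum>\<rho>\<in>block_perms n. f (\<rho> ` S)) = (\<Sum>\<rho>\<in>block_perms n. f ((\<rho> \<circ> \<pi>) ` S))"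
    using permutes_inv_o[OF bij]
    by (intro sum.reindex_bij_witness[of _ "\<lambda>\<rho>. \<rho> \<circ> \<pi>" "\<lambda>\<rho>. \<rho> \<circ> inv_into UNIV \<pi>"])
      (auto simp: block_perms_comp block_perms_inv \<pi> comp_assoc)
  also have "\<dots> = (\<Sum>\<rho>\<in>block_perms n. f (\<rho> ` S'))"
    unfolding image_comp[symmetric] \<pi>(2) ..
  finally show ?thesis by simp
qed

text \<open>Double counting: the sum over \<open>block_perms n\<close> has the same value at every
  point of the orbit, and each block permutation merely rearranges the orbit. No stabilizers have to
  be counted.\<close>

lemma sum_block_perms_average:
  fixes f :: "nat set \<Rightarrow> real"
  assumes S: "S \<subseteq> {..<n + n}"
  shows "real (card (same_type n S)) * (\<Sum>\<rho>\<in>block_perms n. f (\<rho> ` S)) =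
    real (card (block_perms n)) * sum f (same_type n S)"
proof -
  have "real (card (same_type n S)) * (\<Sum>\<rho>\<in>block_perms n. f (\<rho> ` S)) =
    (\<Sum>S'\<in>same_type n S. \<Sum>\<rho>\<in>block_perms n. f (\<rho> ` S'))"
    by (simp add: sum_block_perms_same_type[OF S])
  also have "\<dots> = (\<Sum>\<rho>\<in>block_perms n. \<Sum>S'\<in>same_type n S. f (\<rho> ` S'))" by (rule sum.swap)
  also have "\<dots> = (\<Sum>\<rho>\<in>block_perms n. sum f (same_type n S))"
  proof (rule sum.cong[OF refl])
    fix \<rho> assume \<rho>: "\<rho> \<in> block_perms n"
    have im: "\<pi> ` S' \<in> same_type n S" if "\<pi> \<in> block_perms n" "S' \<in> same_type n S" for \<pi> S'
      using block_perms_image_same_type[OF that(1), of S'] that(2) by (auto simp: same_type_def)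
    have p: "\<rho> permutes {..<n + n}" using \<rho> by (simp add: block_perms_def)
    show "(\<Sum>S'\<in>same_type n S. f (\<rho> ` S')) = sum f (same_type n S)"
      using permutes_inv_o[OF p]
      by (intro sum.reindex_bij_witness[of _ "\<lambda>S. inv_into UNIV \<rho> ` S" "\<lambda>S. \<rho> ` S"])
        (auto simp: im \<rho> block_perms_inv image_comp)
  qed
  also have "\<dots> = real (card (block_perms n)) * sum f (same_type n S)" by simp
  finally show ?thesis .
qed

lemma finite_same_type [simp]: "finite (same_type n S)"
  by (simp add: same_type_def)

text \<open>The decoupling. Averaged over block permutations, the minor of \<open>D\<close> is
  constant on orbits, so only orbit sums of the minors of \<open>C\<close> matter; the orbit sums on
  either side are determined by the characteristic polynomials.\<close>

lemma signed_perm_sum_cong: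
  assumes C: "C \<in> carrier_mat n n" and C': "C' \<in> carrier_mat n n"
    and D: "D \<in> carrier_mat n n" and D': "D' \<in> carrier_mat n n"
    and eqC: "char_poly (C * C\<^sup>T) = char_poly (C' * C'\<^sup>T)"
    and eqD: "char_poly (D * D\<^sup>T) = char_poly (D' * D'\<^sup>T)"
  shows "signed_perm_sum n x C D = signed_perm_sum n x C' D'"
proof -
  let ?w = "\<lambda>S. \<Sum>\<rho>\<in>block_perms n. col_minor n D (\<rho> ` S)"
  let ?w' = "\<lambda>S. \<Sum>\<rho>\<in>block_perms n. col_minor n D' (\<rho> ` S)"
  have w: "?w S = ?w' S" if S: "S \<subseteq> {..<n + n}" for S
  proof -
    have "S \<in> same_type n S" using S by (simp add: same_type_def)
    then have "card (same_type n S) \<noteq> 0" by auto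
    moreover have "real (card (same_type n S)) * ?w S = real (card (same_type n S)) * ?w' S"
      unfolding sum_block_perms_average[OF S] sum_same_type_col_minor[OF D D' eqD S] ..
    ultimately show ?thesis by simp
  qed
  let ?ty = "\<lambda>S. (left_card n S, right_card n S)"
  \<comment> \<open>The power set is split into orbits along the pair of cardinalities. On each
    orbit the weight is constant and the differences of minors add up to zero.\<close>
  have "(\<Sum>S\<in>Pow {..<n + n}. (row_minor n x C S - row_minor n x C' S) * ?w S) =
      (\<Sum>y\<in>?ty ` Pow {..<n + n}. \<Sum>S | S \<in> Pow {..<n + n} \<and> ?ty S = y. (row_minor n x C S - row_minor n x C' S) * ?w S)"
    by (rule sum.image_gen) simp
  also have "\<dots> = 0"
  proof (rule sum.neutral, safe)
    fix S0 assume S0: "S0 \<subseteq> {..<n + n}"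
    have "{S. S \<in> Pow {..<n + n} \<and> ?ty S = ?ty S0} = same_type n S0" by (auto simp: same_type_def)
    moreover have "(\<Sum>S\<in>same_type n S0. (row_minor n x C S - row_minor n x C' S) * ?w S) =
      (\<Sum>S\<in>same_type n S0. (row_minor n x C S - row_minor n x C' S) * ?w S0)"
      using S0 by (intro sum.cong refl) (simp add: sum_block_perms_same_type)
    moreover have "\<dots> = 0"
      by (simp add: sum_distrib_right[symmetric] sum_subtractf sum_same_type_row_minor[OF C C' eqC])
    ultimately show "(\<Sum>S | S \<in> Pow {..<n + n} \<and> ?ty S = ?ty S0. (row_minor n x C S - row_minor n x C' S) * ?w S) = 0"
      by simp
  qed
  finally have "(\<Sum>S\<in>Pow {..<n + n}. row_minor n x C S * ?w S) = (\<Sum>S\<in>Pow {..<n + n}. row_minor n x C' S * ?w S)"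
    by (simp add: left_diff_distrib sum_subtractf)
  also have "\<dots> = (\<Sum>S\<in>Pow {..<n + n}. row_minor n x C' S * ?w' S)"
    using w by (intro sum.cong refl) auto
  finally show ?thesis by (simp add: signed_perm_sum_minors C C' D D')
qed

section \<open>Haar measure on the orthogonal group\<close>

abbreviation square_index :: "nat \<Rightarrow> (nat \<times> nat) set" where
  "square_index n \<equiv> {..<n} \<times> {..<n}"

text \<open>Matrices are represented by functions on index pairs, on which the finite product of
  Lebesgue measures lives.\<close>

definition lebesgue_mat :: "nat \<Rightarrow> (nat \<times> nat \<Rightarrow> real) measure" where
  "lebesgue_mat n = (\<Pi>\<^sub>M p\<in>square_index n. lborel)"

text \<open>Used with \<open>s\<close> equal to 1 and -1, that is, for translations and for point
  reflections.\<close>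

definition mat_affine :: "nat \<Rightarrow> real \<Rightarrow> (nat \<times> nat \<Rightarrow> real) \<Rightarrow> (nat \<times> nat \<Rightarrow> real) \<Rightarrow> nat \<times> nat \<Rightarrow> real" where
  "mat_affine n s c x = (\<lambda>p\<in>square_index n. c p + s * x p)"

definition mat_act :: "nat \<Rightarrow> real mat \<Rightarrow> (nat \<times> nat \<Rightarrow> real) \<Rightarrow> nat \<times> nat \<Rightarrow> real" where
  "mat_act n U x = (\<lambda>p\<in>square_index n. \<Sum>k<n. U $$ (fst p, k) * x (k, snd p))"

interpretation leb: product_sigma_finite "\<lambda>_ :: nat \<times> nat. lborel :: real measure"
  by standard

lemma sigma_finite_lebesgue_mat: "sigma_finite_measure (lebesgue_mat n)"
  unfolding lebesgue_mat_def by (rule leb.sigma_finite) simp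

lemma space_lebesgue_mat: "space (lebesgue_mat n) = (\<Pi>\<^sub>E p\<in>square_index n. UNIV)"
  by (simp add: lebesgue_mat_def space_PiM)

lemma measurable_lebesgue_mat_component [measurable (raw)]:
  assumes "p \<in> square_index n" "f \<in> measurable M (lebesgue_mat n)"
  shows "(\<lambda>w. f w p) \<in> borel_measurable M"
proof -
  have "(\<lambda>x. x p) \<in> measurable (lebesgue_mat n) lborel"
    unfolding lebesgue_mat_def using assms(1) by (rule measurable_component_singleton)
  from measurable_compose[OF assms(2) this] show ?thesis by simp
qed

lemma measurable_lebesgue_matI:
  assumes "\<And>p. p \<in> square_index n \<Longrightarrow> (\<lambda>w. f w p) \<in> borel_measurable M"
  shows "(\<lambda>w. \<lambda>p\<in>square_index n. f w p) \<in> measurable M (lebesgue_mat n)"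
  unfolding lebesgue_mat_def using assms by (intro measurable_restrict) simp

lemma measurable_mat_affine:
  assumes [measurable]: "f \<in> measurable M (lebesgue_mat n)" "g \<in> measurable M (lebesgue_mat n)"
  shows "(\<lambda>w. mat_affine n s (f w) (g w)) \<in> measurable M (lebesgue_mat n)"
  unfolding mat_affine_def by (rule measurable_lebesgue_matI) measurable

lemma measurable_mat_act:
  assumes [measurable]: "f \<in> measurable M (lebesgue_mat n)"
  shows "(\<lambda>w. mat_act n U (f w)) \<in> measurable M (lebesgue_mat n)"
  unfolding mat_act_def
proof (rule measurable_lebesgue_matI)
  fix p assume p: "p \<in> square_index n"
  have "(\<lambda>w. f w (k, snd p)) \<in> borel_measurable M" if "k < n" for k
    using p that by (intro measurable_lebesgue_mat_component[OF _ assms]) auto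
  then show "(\<lambda>w. \<Sum>k<n. U $$ (fst p, k) * f w (k, snd p)) \<in> borel_measurable M"
    by (intro borel_measurable_sum borel_measurable_times) auto
qed

lemma distr_mat_affine:
  assumes c: "c \<in> space (lebesgue_mat n)" and s: "\<bar>s\<bar> = 1"
  shows "distr (lebesgue_mat n) (lebesgue_mat n) (mat_affine n s c) = lebesgue_mat n"
proof -
  have meas: "mat_affine n s c \<in> measurable (lebesgue_mat n) (lebesgue_mat n)"
    using c by (intro measurable_mat_affine measurable_const measurable_ident_sets[OF refl])
  have "distr (lebesgue_mat n) (lebesgue_mat n) (mat_affine n s c) = (\<Pi>\<^sub>M p\<in>square_index n. lborel)"
  proof (rule leb.PiM_eqI)
    fix A :: "nat \<times> nat \<Rightarrow> real set" assume A: "\<And>p. p \<in> square_index n \<Longrightarrow> A p \<in> sets lborel"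
    let ?A = "\<lambda>p. (\<lambda>t. c p + s * t) -` A p"
    have "Pi\<^sub>E (square_index n) A \<in> sets (lebesgue_mat n)"
      unfolding lebesgue_mat_def using A by (intro sets_PiM_I_finite) auto
    then have "emeasure (distr (lebesgue_mat n) (lebesgue_mat n) (mat_affine n s c)) (Pi\<^sub>E (square_index n) A) =
        emeasure (lebesgue_mat n) (mat_affine n s c -` Pi\<^sub>E (square_index n) A \<inter> space (lebesgue_mat n))"
      by (rule emeasure_distr[OF meas])
    also have "mat_affine n s c -` Pi\<^sub>E (square_index n) A \<inter> space (lebesgue_mat n) = Pi\<^sub>E (square_index n) ?A"
      by (auto simp: mat_affine_def space_lebesgue_mat PiE_def Pi_def extensional_def)
    also have "emeasure (lebesgue_mat n) (Pi\<^sub>E (square_index n) ?A) = (\<Prod>p\<in>square_index n. emeasure lborel (?A p))"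
      unfolding lebesgue_mat_def
    proof (rule leb.emeasure_PiM)
      fix p assume "p \<in> square_index n"
      then have "A p \<in> sets borel" using A by auto
      moreover have "(\<lambda>t. c p + s * t) \<in> borel_measurable borel" by measurable
      ultimately have "?A p \<inter> space borel \<in> sets borel" by (rule measurable_sets[rotated])
      then show "?A p \<in> sets lborel" by simp
    qed simp
    also have "\<dots> = (\<Prod>p\<in>square_index n. emeasure lborel (A p))"
    proof (rule prod.cong[OF refl])
      fix p assume p: "p \<in> square_index n"
      have "(lborel :: real measure) = density (distr lborel borel (\<lambda>t. c p + s * t)) (\<lambda>_. ennreal \<bar>s\<bar>)"
        using s by (intro lborel_real_affine) auto
      also have "\<dots> = distr lborel borel (\<lambda>t. c p + s * t)"
        by (simp add: s density_1)
      finally have "emeasure lborel (A p) = emeasure (distr lborel borel (\<lambda>t. c p + s * t)) (A p)"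
        by simp
      also have "\<dots> = emeasure lborel (?A p)"
        using A[OF p] by (subst emeasure_distr) auto
      finally show "emeasure lborel (?A p) = emeasure lborel (A p)" by simp
    qed
    finally show "emeasure (distr (lebesgue_mat n) (lebesgue_mat n) (mat_affine n s c)) (Pi\<^sub>E (square_index n) A) =
       (\<Prod>p\<in>square_index n. emeasure lborel (A p))" .
  qed (simp_all add: lebesgue_mat_def)
  then show ?thesis by (simp add: lebesgue_mat_def)
qed

lemma nn_integral_mat_affine:
  assumes "c \<in> space (lebesgue_mat n)" "\<bar>s\<bar> = 1" "f \<in> borel_measurable (lebesgue_mat n)"
  shows "(\<integral>\<^sup>+ x. f (mat_affine n s c x) \<partial>lebesgue_mat n) = (\<integral>\<^sup>+ x. f x \<partial>lebesgue_mat n)"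
proof -
  have meas: "mat_affine n s c \<in> measurable (lebesgue_mat n) (lebesgue_mat n)"
    using assms(1) by (intro measurable_mat_affine measurable_const measurable_ident_sets[OF refl])
  have "(\<integral>\<^sup>+ x. f x \<partial>distr (lebesgue_mat n) (lebesgue_mat n) (mat_affine n s c)) = (\<integral>\<^sup>+ x. f (mat_affine n s c x) \<partial>lebesgue_mat n)"
    using assms(3) by (intro nn_integral_distr[OF meas]) simp
  then show ?thesis by (simp add: distr_mat_affine[OF assms(1,2)])
qed

lemma orth_group_columns:
  assumes "U \<in> orth_group n" "k < n" "l < n"
  shows "(\<Sum>i<n. U $$ (i, k) * U $$ (i, l)) = (if k = l then 1 else 0)"
proof -
  have U: "U \<in> carrier_mat n n" "U\<^sup>T * U = 1\<^sub>m n" using assms(1) by (auto simp: orth_group_def)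
  have "(U\<^sup>T * U) $$ (k, l) = (\<Sum>i<n. U $$ (i, k) * U $$ (i, l))"
    using U(1) assms by (simp add: scalar_prod_def atLeast0LessThan)
  then show ?thesis using U assms by simp
qed

lemma orth_group_transpose:
  assumes "U \<in> orth_group n"
  shows "U\<^sup>T \<in> orth_group n"
proof -
  have U: "U \<in> carrier_mat n n" "U\<^sup>T * U = 1\<^sub>m n" using assms by (auto simp: orth_group_def)
  have Ut: "U\<^sup>T \<in> carrier_mat n n" using U(1) by simp
  have "U * U\<^sup>T = 1\<^sub>m n" by (rule mat_mult_left_right_inverse[OF Ut U(1) U(2)])
  then show ?thesis unfolding orth_group_def using Ut by simp
qed

lemma orth_group_mult:
  assumes "U \<in> orth_group n" "V \<in> orth_group n"
  shows "U * V \<in> orth_group n"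
proof -
  have U: "U \<in> carrier_mat n n" "U\<^sup>T * U = 1\<^sub>m n" and V: "V \<in> carrier_mat n n" "V\<^sup>T * V = 1\<^sub>m n"
    using assms by (auto simp: orth_group_def)
  have "(U * V)\<^sup>T * (U * V) = V\<^sup>T * (U\<^sup>T * U * V)"
    using U(1) V(1) by (simp add: transpose_mult[of _ n n _ n] assoc_mult_mat[of _ n n _ n _ n] mult_carrier_mat[of _ n n])
  then show ?thesis using U V by (simp add: orth_group_def)
qed

lemma orth_group_inner:
  assumes U: "U \<in> orth_group n"
  shows "(\<Sum>i<n. (\<Sum>k<n. U $$ (i, k) * f k) * (\<Sum>l<n. U $$ (i, l) * g l)) = (\<Sum>k<n. f k * g k)"
proof -
  have "(\<Sum>i<n. (\<Sum>k<n. U $$ (i, k) * f k) * (\<Sum>l<n. U $$ (i, l) * g l)) =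
     (\<Sum>i<n. \<Sum>k<n. \<Sum>l<n. (f k * g l) * (U $$ (i, k) * U $$ (i, l)))"
    unfolding sum_product by (intro sum.cong refl) (simp add: ac_simps)
  also have "\<dots> = (\<Sum>k<n. \<Sum>l<n. \<Sum>i<n. (f k * g l) * (U $$ (i, k) * U $$ (i, l)))"
    by (subst sum.swap) (intro sum.cong refl sum.swap)
  also have "\<dots> = (\<Sum>k<n. \<Sum>l<n. if l = k then f k * g k else 0)"
    unfolding sum_distrib_left[symmetric] by (intro sum.cong refl) (auto simp: orth_group_columns[OF U])
  also have "\<dots> = (\<Sum>k<n. f k * g k)" by simp
  finally show ?thesis .
qed

lemma mat_act_transpose:
  assumes U: "U \<in> orth_group n" and x: "x \<in> space (lebesgue_mat n)"
  shows "mat_act n U (mat_act n U\<^sup>T x) = x"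
proof
  fix p
  have Ut: "U\<^sup>T \<in> orth_group n" and Uc: "U \<in> carrier_mat n n"
    using orth_group_transpose[OF U] U by (auto simp: orth_group_def)
  show "mat_act n U (mat_act n U\<^sup>T x) p = x p"
  proof (cases "p \<in> square_index n")
    case True
    then obtain i j where p: "p = (i, j)" "i < n" "j < n" by auto
    have "mat_act n U (mat_act n U\<^sup>T x) p = (\<Sum>k<n. U $$ (i, k) * (\<Sum>l<n. U $$ (l, k) * x (l, j)))"
      using p Uc by (simp add: mat_act_def)
    also have "\<dots> = (\<Sum>l<n. (\<Sum>k<n. U\<^sup>T $$ (k, i) * U\<^sup>T $$ (k, l)) * x (l, j))"
      unfolding sum_distrib_left sum_distrib_right
      by (subst sum.swap) (use p Uc in \<open>auto intro!: sum.cong simp: ac_simps\<close>)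
    also have "\<dots> = (\<Sum>l<n. if l = i then x (i, j) else 0)"
      using p by (intro sum.cong refl) (auto simp: orth_group_columns[OF Ut])
    finally show ?thesis using p by simp
  next
    case False
    then have "x p = undefined" using x unfolding space_lebesgue_mat by (rule PiE_arb[rotated])
    then show ?thesis using False by (auto simp: mat_act_def)
  qed
qed

lemma mat_act_affine:
  "mat_act n U (mat_affine n s c x) = mat_affine n s (mat_act n U c) (mat_act n U x)"
  by (auto simp: mat_act_def mat_affine_def fun_eq_iff sum.distrib[symmetric] sum_distrib_left intro!: sum.cong)
    (simp add: algebra_simps)

section \<open>An invariant set of finite positive volume\<close>

text \<open>A product of balls, one for each column, since left multiplication by an orthogonal
  matrix preserves the column norms. The bound 4 is generous; it has to admit all matrices of
  \<open>mat_box\<close>.\<close>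

definition mat_ball :: "nat \<Rightarrow> (nat \<times> nat \<Rightarrow> real) set" where
  "mat_ball n = {x \<in> space (lebesgue_mat n). \<forall>j<n. (\<Sum>i<n. (x (i, j))\<^sup>2) \<le> 4}"

text \<open>A neighbourhood of the identity. For its half width \<open>e\<close> the sum
  \<open>real n * e + e\<close> is 1/2, so its matrices are strictly diagonally dominant by rows. It
  certifies positive volume, both for the ball and for the matrices in it with independent
  columns.\<close>

definition mat_box :: "nat \<Rightarrow> (nat \<times> nat \<Rightarrow> real) set" where
  "mat_box n = (\<Pi>\<^sub>E p\<in>square_index n. {(if fst p = snd p then 1 else 0) - 1 / (2 * (real n + 1)) ..
      (if fst p = snd p then 1 else 0) + 1 / (2 * (real n + 1))})"

lemma sets_mat_ball [measurable]: "mat_ball n \<in> sets (lebesgue_mat n)"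
proof -
  have "{x \<in> space (lebesgue_mat n). \<forall>j\<in>{..<n}. (\<Sum>i<n. (x (i, j))\<^sup>2) \<le> 4} \<in> sets (lebesgue_mat n)"
  proof (rule sets.sets_Collect_finite_All)
    fix j assume "j \<in> {..<n}"
    then have "(\<lambda>x. \<Sum>i<n. (x (i, j))\<^sup>2) \<in> borel_measurable (lebesgue_mat n)"
      by (intro borel_measurable_sum borel_measurable_power measurable_lebesgue_mat_component) auto
    then show "{x \<in> space (lebesgue_mat n). (\<Sum>i<n. (x (i, j))\<^sup>2) \<le> 4} \<in> sets (lebesgue_mat n)" by measurable
  qed simp
  then show ?thesis unfolding mat_ball_def by (simp add: Ball_def)
qed

lemma mat_act_mat_ball:
  assumes U: "U \<in> orth_group n" and x: "x \<in> space (lebesgue_mat n)"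
  shows "mat_act n U x \<in> mat_ball n \<longleftrightarrow> x \<in> mat_ball n"
proof -
  have "(\<Sum>i<n. (mat_act n U x (i, j))\<^sup>2) = (\<Sum>i<n. (x (i, j))\<^sup>2)" if "j < n" for j
    using orth_group_inner[OF U, of "\<lambda>k. x (k, j)" "\<lambda>k. x (k, j)"] that
    by (simp add: mat_act_def power2_eq_square)
  moreover have "mat_act n U x \<in> space (lebesgue_mat n)" by (simp add: mat_act_def space_lebesgue_mat)
  ultimately show ?thesis using x by (auto simp: mat_ball_def)
qed

lemma emeasure_mat_ball_finite: "emeasure (lebesgue_mat n) (mat_ball n) < \<infinity>"
proof -
  have "mat_ball n \<subseteq> (\<Pi>\<^sub>E p\<in>square_index n. {-2..2})"
  proof
    fix x assume x: "x \<in> mat_ball n"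
    have "\<bar>x (i, j)\<bar> \<le> 2" if "i < n" "j < n" for i j
    proof -
      have "(x (i, j))\<^sup>2 \<le> (\<Sum>i<n. (x (i, j))\<^sup>2)" using that by (intro member_le_sum) auto
      also have "\<dots> \<le> 2\<^sup>2" using x that by (simp add: mat_ball_def)
      finally show ?thesis using abs_le_square_iff[of "x (i, j)" 2] by simp
    qed
    then show "x \<in> (\<Pi>\<^sub>E p\<in>square_index n. {-2..2})"
      using x by (auto simp: mat_ball_def space_lebesgue_mat PiE_def Pi_def abs_le_iff) (metis minus_le_iff)
  qed
  then have "emeasure (lebesgue_mat n) (mat_ball n) \<le> emeasure (lebesgue_mat n) (\<Pi>\<^sub>E p\<in>square_index n. {-2..2})"
    by (intro emeasure_mono) (auto simp: lebesgue_mat_def intro!: sets_PiM_I_finite)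
  also have "\<dots> = (\<Prod>p\<in>square_index n. emeasure lborel {-2..2 :: real})"
    unfolding lebesgue_mat_def by (rule leb.emeasure_PiM) auto
  also have "\<dots> < \<infinity>" by (simp add: ennreal_prod_eq_top less_top[symmetric] power_eq_top_ennreal)
  finally show ?thesis .
qed

lemma emeasure_mat_box_pos: "emeasure (lebesgue_mat n) (mat_box n) > 0"
proof -
  have "emeasure (lebesgue_mat n) (mat_box n) = (\<Prod>p\<in>square_index n. emeasure lborel {(if fst p = snd p then 1 else 0) - 1 / (2 * (real n + 1)) ..
      (if fst p = snd p then 1 else 0) + 1 / (2 * (real n + 1))})"
    unfolding lebesgue_mat_def mat_box_def by (rule leb.emeasure_PiM) auto
  also have "\<dots> \<noteq> 0"
  proof -
    have "2 * (1 / (2 * (real n + 1))) > 0" by simp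
    then show ?thesis by (simp add: prod_zero_iff)
  qed
  finally show ?thesis by (simp add: zero_less_iff_neq_zero)
qed

lemma mat_box_le:
  assumes "x \<in> mat_box n" "i < n" "j < n"
  shows "\<bar>x (i, j) - (if i = j then 1 else 0)\<bar> \<le> 1 / (2 * (real n + 1))"
proof -
  have "x (i, j) \<in> {(if i = j then 1 else 0) - 1 / (2 * (real n + 1)) .. (if i = j then 1 else 0) + 1 / (2 * (real n + 1))}"
    using PiE_mem[OF assms(1)[unfolded mat_box_def], of "(i, j)"] assms by simp
  then show ?thesis by (auto simp: abs_le_iff)
qed

lemma mat_box_subset_ball: "mat_box n \<subseteq> mat_ball n"
proof
  fix x assume x: "x \<in> mat_box n"
  define e where "e = 1 / (2 * (real n + 1))"
  have e: "0 \<le> e" "e \<le> 1 / 2" "real n * e \<le> 1 / 2" by (auto simp: e_def field_simps)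
  have "(\<Sum>i<n. (x (i, j))\<^sup>2) \<le> 4" if j: "j < n" for j
  proof -
    have "(x (i, j))\<^sup>2 \<le> (if i = j then 2 else 0) + e * e * 2" if "i < n" for i
    proof -
      have "x (i, j) ^ 2 \<le> ((if i = j then 1 else 0) + e)\<^sup>2"
        using mat_box_le[OF x that j, folded e_def] e(1)
        by (intro power2_le_iff_abs_le[THEN iffD2]) (auto split: if_splits)
      \<comment> \<open>For the diagonal entry this is \<open>(1 - e)\<^sup>2 \<ge> 0\<close>
        rearranged.\<close>
      also have "\<dots> \<le> (if i = j then 2 else 0) + e * e * 2"
        using zero_le_square[of "e - 1"] zero_le_square[of e] e(2) by (cases "i = j") (simp_all add: power2_eq_square algebra_simps add_increasing2)
      finally show ?thesis .
    qed
    then have "(\<Sum>i<n. (x (i, j))\<^sup>2) \<le> (\<Sum>i<n. (if i = j then 2 else 0) + e * e * 2)"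
      by (intro sum_mono) auto
    also have "\<dots> = 2 + (real n * e) * e * 2" using j by (simp add: sum.distrib)
    also have "(real n * e) * e \<le> 1 / 2 * (1 / 2)" using e by (intro mult_mono) auto
    finally show ?thesis by simp
  qed
  moreover have "x \<in> space (lebesgue_mat n)"
    using x by (auto simp: mat_box_def space_lebesgue_mat PiE_def)
  ultimately show "x \<in> mat_ball n" by (simp add: mat_ball_def)
qed

text \<open>
  Translation invariance determines a measure up to a factor: for sets \<open>A\<close> and \<open>B\<close>,
  substituting \<open>U x - y\<close> for \<open>y\<close> and then \<open>x + U\<^sup>T y\<close> for \<open>x\<close> exchanges the two sets in
  \<open>\<integral>\<integral> 1\<^sub>A (U x) 1\<^sub>B y\<close>. The factor is 1 because \<open>U\<close> preserves a ball.
\<close>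

lemma distr_mat_act:
  assumes U: "U \<in> orth_group n"
  shows "distr (lebesgue_mat n) (lebesgue_mat n) (mat_act n U) = lebesgue_mat n"
proof (rule measure_eqI)
  let ?L = "lebesgue_mat n" and ?g = "mat_act n U"
  interpret L: sigma_finite_measure ?L by (rule sigma_finite_lebesgue_mat)
  interpret pair_sigma_finite ?L ?L by standard
  have meas: "?g \<in> measurable ?L ?L" by (intro measurable_mat_act measurable_ident_sets[OF refl])
  note [measurable] = measurable_mat_act measurable_mat_affine
  fix A assume "A \<in> sets (distr ?L ?L ?g)"
  then have A [measurable]: "A \<in> sets ?L" by simp
  let ?B = "mat_ball n"
  have gram_schmidt: "?g x \<in> space ?L" for x by (simp add: mat_act_def space_lebesgue_mat)
  have sp: "mat_act n U\<^sup>T x \<in> space ?L" for x by (simp add: mat_act_def space_lebesgue_mat)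
  have B_act: "indicator ?B (?g x) = (indicator ?B x :: ennreal)" if "x \<in> space ?L" for x
    using mat_act_mat_ball[OF U that] by (simp add: indicator_def)
  have "emeasure ?L ?B * emeasure (distr ?L ?L ?g) A =
      (\<integral>\<^sup>+ y. indicator ?B y \<partial>?L) * (\<integral>\<^sup>+ x. indicator A (?g x) \<partial>?L)"
    using nn_integral_distr[OF meas, of "indicator A"] by (simp flip: nn_integral_indicator)
  also have "\<dots> = (\<integral>\<^sup>+ x. \<integral>\<^sup>+ y. indicator A (?g x) * indicator ?B y \<partial>?L \<partial>?L)"
    using measurable_compose[OF meas] by (simp add: nn_integral_cmult nn_integral_multc mult.commute)
  also have "\<dots> = (\<integral>\<^sup>+ x. \<integral>\<^sup>+ y. indicator A (?g x) * indicator ?B (mat_affine n (-1) (?g x) y) \<partial>?L \<partial>?L)"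
    by (intro nn_integral_cong nn_integral_mat_affine[symmetric] gram_schmidt) auto
  also have "\<dots> = (\<integral>\<^sup>+ y. \<integral>\<^sup>+ x. indicator A (?g x) * indicator ?B (mat_affine n (-1) (?g x) y) \<partial>?L \<partial>?L)"
    by (rule Fubini'[symmetric]) measurable
  also have "\<dots> = (\<integral>\<^sup>+ y. \<integral>\<^sup>+ x. indicator A (mat_affine n 1 (?g x) y) * indicator ?B x \<partial>?L \<partial>?L)"
  proof (rule nn_integral_cong)
    fix y assume y: "y \<in> space ?L"
    have "(\<integral>\<^sup>+ x. indicator A (?g x) * indicator ?B (mat_affine n (-1) (?g x) y) \<partial>?L) =
      (\<integral>\<^sup>+ x. indicator A (?g (mat_affine n 1 (mat_act n U\<^sup>T y) x)) *
        indicator ?B (mat_affine n (-1) (?g (mat_affine n 1 (mat_act n U\<^sup>T y) x)) y) \<partial>?L)"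
      using y by (intro nn_integral_mat_affine[symmetric] sp) auto
    also have "\<dots> = (\<integral>\<^sup>+ x. indicator A (mat_affine n 1 (?g x) y) * indicator ?B x \<partial>?L)"
    proof (rule nn_integral_cong)
      fix x assume x: "x \<in> space ?L"
      have 1: "?g (mat_affine n 1 (mat_act n U\<^sup>T y) x) = mat_affine n 1 (?g x) y"
        unfolding mat_act_affine mat_act_transpose[OF U y]
        by (auto simp: mat_affine_def fun_eq_iff)
      have 2: "mat_affine n (-1) (mat_affine n 1 (?g x) y) y = ?g x"
        by (auto simp: mat_affine_def mat_act_def fun_eq_iff)
      show "indicator A (?g (mat_affine n 1 (mat_act n U\<^sup>T y) x)) *
        indicator ?B (mat_affine n (-1) (?g (mat_affine n 1 (mat_act n U\<^sup>T y) x)) y) =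
        indicator A (mat_affine n 1 (?g x) y) * (indicator ?B x :: ennreal)"
        unfolding 1 2 B_act[OF x] ..
    qed
    finally show "(\<integral>\<^sup>+ x. indicator A (?g x) * indicator ?B (mat_affine n (-1) (?g x) y) \<partial>?L) = \<dots>" .
  qed
  also have "\<dots> = (\<integral>\<^sup>+ x. \<integral>\<^sup>+ y. indicator A (mat_affine n 1 (?g x) y) * indicator ?B x \<partial>?L \<partial>?L)"
    by (rule Fubini') measurable
  also have "\<dots> = (\<integral>\<^sup>+ x. emeasure ?L A * indicator ?B x \<partial>?L)"
  proof (rule nn_integral_cong)
    fix x assume "x \<in> space ?L"
    have "(\<integral>\<^sup>+ y. indicator A (mat_affine n 1 (?g x) y) * indicator ?B x \<partial>?L) =
        (\<integral>\<^sup>+ y. indicator A y * indicator ?B x \<partial>?L)"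
      by (rule nn_integral_mat_affine[OF gram_schmidt]) auto
    then show "(\<integral>\<^sup>+ y. indicator A (mat_affine n 1 (?g x) y) * indicator ?B x \<partial>?L) = emeasure ?L A * indicator ?B x"
      by (simp add: nn_integral_multc)
  qed
  also have "\<dots> = emeasure ?L ?B * emeasure ?L A" by (subst nn_integral_cmult) (simp_all add: mult.commute)
  finally have "emeasure ?L ?B * emeasure (distr ?L ?L ?g) A = emeasure ?L ?B * emeasure ?L A" .
  moreover have "emeasure ?L ?B \<noteq> 0"
    using emeasure_mat_box_pos[of n] emeasure_mono[OF mat_box_subset_ball sets_mat_ball, of n] by auto
  moreover have "emeasure ?L ?B \<noteq> \<top>" using emeasure_mat_ball_finite[of n] by auto
  ultimately show "emeasure (distr ?L ?L ?g) A = emeasure ?L A"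
    by (simp add: ennreal_mult_cancel_left)
qed simp


section \<open>Gram-Schmidt orthonormalisation as an equivariant map\<close>

text \<open>Column \<open>j\<close> of the orthonormalised matrix, as a function of the row. The
  residual is written out in numerator and norm because it can be named only after the recursion; if
  it vanishes, division by zero makes the column zero.\<close>

function gram_schmidt :: "nat \<Rightarrow> (nat \<times> nat \<Rightarrow> real) \<Rightarrow> nat \<Rightarrow> nat \<Rightarrow> real" where
  "gram_schmidt n x j = (\<lambda>i. (x (i, j) - (\<Sum>k\<in>{..<j}. (\<Sum>l<n. x (l, j) * gram_schmidt n x k l) * gram_schmidt n x k i)) /
     sqrt (\<Sum>l<n. (x (l, j) - (\<Sum>k\<in>{..<j}. (\<Sum>m<n. x (m, j) * gram_schmidt n x k m) * gram_schmidt n x k l))\<^sup>2))"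
  by auto
termination by (relation "Wellfounded.measure (\<lambda>(n, x, j). j)") auto

declare gram_schmidt.simps [simp del]

definition gram_schmidt_residual :: "nat \<Rightarrow> (nat \<times> nat \<Rightarrow> real) \<Rightarrow> nat \<Rightarrow> nat \<Rightarrow> real" where
  "gram_schmidt_residual n x j i = x (i, j) - (\<Sum>k<j. (\<Sum>l<n. x (l, j) * gram_schmidt n x k l) * gram_schmidt n x k i)"

lemma gram_schmidt_eq: "gram_schmidt n x j i = gram_schmidt_residual n x j i / sqrt (\<Sum>l<n. (gram_schmidt_residual n x j l)\<^sup>2)"
  unfolding gram_schmidt_residual_def by (subst gram_schmidt.simps) simp

lemma measurable_gram_schmidt:
  assumes "j < n" "i < n"
  shows "(\<lambda>x. gram_schmidt n x j i) \<in> borel_measurable (lebesgue_mat n)"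
    and "(\<lambda>x. gram_schmidt_residual n x j i) \<in> borel_measurable (lebesgue_mat n)"
proof -
  have res: "(\<lambda>x. gram_schmidt_residual n x j i) \<in> borel_measurable (lebesgue_mat n)"
    if "\<And>k l. k < j \<Longrightarrow> l < n \<Longrightarrow> (\<lambda>x. gram_schmidt n x k l) \<in> borel_measurable (lebesgue_mat n)" "j < n" "i < n" for i j
    unfolding gram_schmidt_residual_def using that
    by (intro borel_measurable_diff borel_measurable_sum borel_measurable_times
        measurable_lebesgue_mat_component[OF _ measurable_ident_sets[OF refl]]) auto
  have gram_schmidt: "(\<lambda>x. gram_schmidt n x j i) \<in> borel_measurable (lebesgue_mat n)" if "j < n" "i < n" for i j
    using that
  proof (induction j arbitrary: i rule: less_induct)
    case (less j)
    have "(\<lambda>x. gram_schmidt_residual n x j l) \<in> borel_measurable (lebesgue_mat n)" if "l < n" for l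
      using less that by (intro res) auto
    then show ?case unfolding gram_schmidt_eq using less.prems
      by (intro borel_measurable_divide borel_measurable_sum borel_measurable_power
          measurable_compose[OF _ borel_measurable_sqrt]) auto
  qed
  show "(\<lambda>x. gram_schmidt n x j i) \<in> borel_measurable (lebesgue_mat n)" by (rule gram_schmidt[OF assms])
  show "(\<lambda>x. gram_schmidt_residual n x j i) \<in> borel_measurable (lebesgue_mat n)"
    using assms gram_schmidt by (intro res) auto
qed

text \<open>The process uses only inner products and linear combinations of columns: the former are
  invariant under \<open>U\<close>, the latter commute with it.\<close>

lemma gram_schmidt_mat_act:
  assumes U: "U \<in> orth_group n" and "j < n" "i < n"
  shows "gram_schmidt n (mat_act n U x) j i = (\<Sum>k<n. U $$ (i, k) * gram_schmidt n x j k)"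
    and "gram_schmidt_residual n (mat_act n U x) j i = (\<Sum>k<n. U $$ (i, k) * gram_schmidt_residual n x j k)"
proof -
  have res: "gram_schmidt_residual n (mat_act n U x) j i = (\<Sum>k<n. U $$ (i, k) * gram_schmidt_residual n x j k)"
    if hyp: "\<And>k l. k < j \<Longrightarrow> l < n \<Longrightarrow> gram_schmidt n (mat_act n U x) k l = (\<Sum>m<n. U $$ (l, m) * gram_schmidt n x k m)"
      and "j < n" "i < n" for i j
  proof -
    have act: "mat_act n U x (l, j) = (\<Sum>m<n. U $$ (l, m) * x (m, j))" if "l < n" for l
      using that \<open>j < n\<close> by (simp add: mat_act_def)
    have "(\<Sum>l<n. mat_act n U x (l, j) * gram_schmidt n (mat_act n U x) k l) = (\<Sum>l<n. x (l, j) * gram_schmidt n x k l)"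
      if "k < j" for k
      using orth_group_inner[OF U, of "\<lambda>m. x (m, j)" "gram_schmidt n x k"] by (simp add: act hyp[OF that])
    then have "gram_schmidt_residual n (mat_act n U x) j i = (\<Sum>m<n. U $$ (i, m) * x (m, j)) -
        (\<Sum>k<j. (\<Sum>l<n. x (l, j) * gram_schmidt n x k l) * (\<Sum>m<n. U $$ (i, m) * gram_schmidt n x k m))"
      unfolding gram_schmidt_residual_def using act[OF \<open>i < n\<close>] hyp \<open>i < n\<close> by simp
    also have "(\<Sum>k<j. (\<Sum>l<n. x (l, j) * gram_schmidt n x k l) * (\<Sum>m<n. U $$ (i, m) * gram_schmidt n x k m)) =
        (\<Sum>m<n. U $$ (i, m) * (\<Sum>k<j. (\<Sum>l<n. x (l, j) * gram_schmidt n x k l) * gram_schmidt n x k m))"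
      unfolding sum_distrib_left by (subst sum.swap) (simp add: ac_simps)
    finally show ?thesis
      unfolding gram_schmidt_residual_def by (simp add: right_diff_distrib sum_subtractf)
  qed
  have gram_schmidt: "gram_schmidt n (mat_act n U x) j i = (\<Sum>k<n. U $$ (i, k) * gram_schmidt n x j k)" if "j < n" "i < n" for i j
    using that
  proof (induction j arbitrary: i rule: less_induct)
    case (less j)
    have r: "gram_schmidt_residual n (mat_act n U x) j l = (\<Sum>k<n. U $$ (l, k) * gram_schmidt_residual n x j k)" if "l < n" for l
      using less that by (intro res) auto
    have "(\<Sum>l<n. (gram_schmidt_residual n (mat_act n U x) j l)\<^sup>2) = (\<Sum>l<n. (gram_schmidt_residual n x j l)\<^sup>2)"
      using orth_group_inner[OF U, of "gram_schmidt_residual n x j" "gram_schmidt_residual n x j"] by (simp add: r power2_eq_square)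
    then show ?case unfolding gram_schmidt_eq using less.prems by (simp add: r sum_divide_distrib)
  qed
  show "gram_schmidt n (mat_act n U x) j i = (\<Sum>k<n. U $$ (i, k) * gram_schmidt n x j k)" by (rule gram_schmidt[OF assms(2,3)])
  show "gram_schmidt_residual n (mat_act n U x) j i = (\<Sum>k<n. U $$ (i, k) * gram_schmidt_residual n x j k)"
    using assms gram_schmidt by (intro res) auto
qed

text \<open>Equivalent to linear independence of the columns; no normalisation then divides by
  zero.\<close>

definition gram_schmidt_regular :: "nat \<Rightarrow> (nat \<times> nat \<Rightarrow> real) \<Rightarrow> bool" where
  "gram_schmidt_regular n x \<longleftrightarrow> (\<forall>j<n. (\<Sum>l<n. (gram_schmidt_residual n x j l)\<^sup>2) \<noteq> 0)"

lemma gram_schmidt_orthonormal: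
  assumes good: "gram_schmidt_regular n x" and "j < n" "k < n"
  shows "(\<Sum>i<n. gram_schmidt n x j i * gram_schmidt n x k i) = (if j = k then 1 else 0)"
proof -
  have norm: "(\<Sum>i<n. gram_schmidt n x j i * gram_schmidt n x j i) = 1" if "j < n" for j
  proof -
    let ?s = "\<Sum>l<n. (gram_schmidt_residual n x j l)\<^sup>2"
    have "?s > 0" using good that by (simp add: gram_schmidt_regular_def sum_nonneg less_le)
    then have "(\<Sum>i<n. gram_schmidt n x j i * gram_schmidt n x j i) = (\<Sum>i<n. (gram_schmidt_residual n x j i)\<^sup>2 / ?s)"
      unfolding gram_schmidt_eq by (intro sum.cong refl) (simp add: power2_eq_square flip: real_sqrt_mult)
    also have "\<dots> = 1" using \<open>?s > 0\<close> by (simp flip: sum_divide_distrib)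
    finally show ?thesis .
  qed
  have orth: "\<forall>k<j. (\<Sum>i<n. gram_schmidt n x j i * gram_schmidt n x k i) = 0" if "j < n" for j
    using that
  proof (induction j rule: less_induct)
    case (less j)
    show ?case
    proof (intro allI impI)
      fix k assume k: "k < j"
      have ort: "(\<Sum>i<n. gram_schmidt n x m i * gram_schmidt n x k i) = (if m = k then 1 else 0)" if m: "m < j" for m
      proof (cases m k rule: linorder_cases)
        case less
        then have "(\<Sum>i<n. gram_schmidt n x k i * gram_schmidt n x m i) = 0" using less.IH[of k] k \<open>j < n\<close> by auto
        then show ?thesis using less by (simp add: mult.commute)
      next
        case equal
        then show ?thesis using norm[of k] k \<open>j < n\<close> by auto
      next
        case greater
        then show ?thesis using less.IH[of m] m \<open>j < n\<close> by auto
      qed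
      have "(\<Sum>i<n. gram_schmidt_residual n x j i * gram_schmidt n x k i) = (\<Sum>i<n. x (i, j) * gram_schmidt n x k i) -
         (\<Sum>i<n. \<Sum>m<j. (\<Sum>l<n. x (l, j) * gram_schmidt n x m l) * (gram_schmidt n x m i * gram_schmidt n x k i))"
        unfolding gram_schmidt_residual_def by (simp add: left_diff_distrib sum_subtractf sum_distrib_right mult.assoc)
      also have "(\<Sum>i<n. \<Sum>m<j. (\<Sum>l<n. x (l, j) * gram_schmidt n x m l) * (gram_schmidt n x m i * gram_schmidt n x k i)) =
         (\<Sum>m<j. (\<Sum>l<n. x (l, j) * gram_schmidt n x m l) * (\<Sum>i<n. gram_schmidt n x m i * gram_schmidt n x k i))"
        unfolding sum_distrib_left by (subst sum.swap) simp
      also have "\<dots> = (\<Sum>m<j. if m = k then (\<Sum>l<n. x (l, j) * gram_schmidt n x k l) else 0)"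
        by (intro sum.cong refl) (auto simp: ort)
      also have "\<dots> = (\<Sum>l<n. x (l, j) * gram_schmidt n x k l)" using k by simp
      finally have "(\<Sum>i<n. gram_schmidt_residual n x j i * gram_schmidt n x k i) = 0" by simp
      then show "(\<Sum>i<n. gram_schmidt n x j i * gram_schmidt n x k i) = 0"
        unfolding gram_schmidt_eq[of n x j] by (simp flip: sum_divide_distrib)
    qed
  qed
  show ?thesis
  proof (cases j k rule: linorder_cases)
    case less
    then show ?thesis using orth[OF \<open>k < n\<close>] by (simp add: mult.commute)
  qed (use norm orth assms in auto)
qed

text \<open>The coefficient 1 at column \<open>j\<close> makes a vanishing residual a nontrivial
  linear dependence between the columns.\<close>

lemma gram_schmidt_residual_span: "\<exists>d. d j = 1 \<and> (\<forall>i. gram_schmidt_residual n x j i = (\<Sum>m\<le>j. d m * x (i, m)))"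
proof (induction j rule: less_induct)
  case (less j)
  have "\<exists>c. \<forall>i. gram_schmidt n x k i = (\<Sum>m<j. c m * x (i, m))" if k: "k < j" for k
  proof -
    obtain d where d: "\<And>i. gram_schmidt_residual n x k i = (\<Sum>m\<le>k. d m * x (i, m))" using less[OF k] by auto
    let ?s = "sqrt (\<Sum>l<n. (gram_schmidt_residual n x k l)\<^sup>2)"
    have "gram_schmidt n x k i = (\<Sum>m<j. (if m \<le> k then d m / ?s else 0) * x (i, m))" for i
    proof -
      have "gram_schmidt n x k i = (\<Sum>m\<le>k. d m / ?s * x (i, m))"
        unfolding gram_schmidt_eq d[of i] by (simp add: sum_divide_distrib)
      also have "\<dots> = (\<Sum>m<j. (if m \<le> k then d m / ?s else 0) * x (i, m))"
        using k by (intro sum.mono_neutral_cong_left) auto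
      finally show ?thesis .
    qed
    then show ?thesis by (intro exI[of _ "\<lambda>m. if m \<le> k then d m / ?s else 0"]) simp
  qed
  then obtain c where c: "\<And>k i. k < j \<Longrightarrow> gram_schmidt n x k i = (\<Sum>m<j. c k m * x (i, m))" by metis
  let ?a = "\<lambda>k. \<Sum>l<n. x (l, j) * gram_schmidt n x k l"
  let ?d = "\<lambda>m. if m = j then 1 else - (\<Sum>k<j. ?a k * c k m)"
  have "gram_schmidt_residual n x j i = (\<Sum>m\<le>j. ?d m * x (i, m))" for i
  proof -
    have "gram_schmidt_residual n x j i = x (i, j) - (\<Sum>k<j. ?a k * (\<Sum>m<j. c k m * x (i, m)))"
      unfolding gram_schmidt_residual_def by (simp add: c)
    also have "(\<Sum>k<j. ?a k * (\<Sum>m<j. c k m * x (i, m))) = (\<Sum>m<j. (\<Sum>k<j. ?a k * c k m) * x (i, m))"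
      unfolding sum_distrib_left sum_distrib_right by (subst sum.swap) (simp add: mult.assoc sum_distrib_right)
    finally show ?thesis by (simp add: sum_negf flip: lessThan_Suc_atMost)
  qed
  then show ?case by (intro exI[of _ ?d]) auto
qed

text \<open>A dependence between columns is read in the row \<open>i\<close> whose coefficient is
  largest in absolute value. There the off-diagonal entries are too small to cancel the diagonal
  one.\<close>

lemma mat_box_gram_schmidt_regular:
  assumes x: "x \<in> mat_box n"
  shows "gram_schmidt_regular n x"
  unfolding gram_schmidt_regular_def
proof (intro allI impI notI)
  fix j assume j: "j < n" and "(\<Sum>l<n. (gram_schmidt_residual n x j l)\<^sup>2) = 0"
  then have z: "gram_schmidt_residual n x j i = 0" if "i < n" for i
    using that by (simp add: sum_nonneg_eq_0_iff)
  obtain d where d: "d j = 1" "\<And>i. gram_schmidt_residual n x j i = (\<Sum>m\<le>j. d m * x (i, m))" using gram_schmidt_residual_span by metis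
  define e where "e = 1 / (2 * (real n + 1))"
  have e: "0 < e" "real n * e + e < 1" by (auto simp: e_def field_simps)
  have "Max ((\<lambda>m. \<bar>d m\<bar>) ` {..j}) \<in> (\<lambda>m. \<bar>d m\<bar>) ` {..j}" by (rule Max_in) auto
  then obtain i where "Max ((\<lambda>m. \<bar>d m\<bar>) ` {..j}) = \<bar>d i\<bar>" "i \<in> {..j}" by (rule imageE)
  moreover have "\<bar>d m\<bar> \<le> Max ((\<lambda>m. \<bar>d m\<bar>) ` {..j})" if "m \<le> j" for m
    using that by (intro Max_ge) auto
  ultimately have i: "i \<le> j" "\<And>m. m \<le> j \<Longrightarrow> \<bar>d m\<bar> \<le> \<bar>d i\<bar>" by auto
  have "\<bar>d i\<bar> \<ge> 1" using i(2)[of j] d by simp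
  have "0 = (\<Sum>m\<le>j. d m * x (i, m))" using z[of i] d(2)[of i] i j by simp
  also have "\<dots> = d i * x (i, i) + (\<Sum>m\<in>{..j} - {i}. d m * x (i, m))"
    using i by (simp add: sum.remove)
  finally have "\<bar>d i\<bar> * \<bar>x (i, i)\<bar> = \<bar>\<Sum>m\<in>{..j} - {i}. d m * x (i, m)\<bar>"
    by (simp add: abs_mult[symmetric])
  also have "\<dots> \<le> (\<Sum>m\<in>{..j} - {i}. \<bar>d i\<bar> * e)"
  proof (rule order_trans[OF sum_abs], rule sum_mono)
    fix m assume m: "m \<in> {..j} - {i}"
    then have "\<bar>x (i, m)\<bar> \<le> e" using mat_box_le[OF x, of i m, folded e_def] i j by auto
    then show "\<bar>d m * x (i, m)\<bar> \<le> \<bar>d i\<bar> * e" using i(2)[of m] m by (auto simp: abs_mult intro: mult_mono)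
  qed
  also have "\<dots> = real j * (\<bar>d i\<bar> * e)" using i by simp
  also have "\<dots> \<le> \<bar>d i\<bar> * (real n * e)"
    using j e mult_right_mono[of "real j" "real n" "\<bar>d i\<bar> * e"] by (simp add: ac_simps)
  finally have "\<bar>x (i, i)\<bar> \<le> real n * e" using \<open>\<bar>d i\<bar> \<ge> 1\<close> mult_le_cancel_left_pos[of "\<bar>d i\<bar>"] by simp
  moreover have "\<bar>x (i, i) - 1\<bar> \<le> e" using mat_box_le[OF x, of i i, folded e_def] i j by simp
  ultimately show False using e by linarith
qed


section \<open>Haar measure as an image of Lebesgue measure\<close>

text \<open>Stable under left multiplication, of finite positive volume, and contained in the set on
  which orthonormalisation commutes with this action. The uniform distribution on it is therefore an
  invariant source.\<close>

definition haar_domain :: "nat \<Rightarrow> (nat \<times> nat \<Rightarrow> real) set" where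
  "haar_domain n = {x \<in> mat_ball n. gram_schmidt_regular n x}"

text \<open>The identity is a default that keeps every value orthogonal. It is not equivariant,
  which is why \<open>haar_domain\<close> consists of regular matrices only.\<close>

definition gram_schmidt_mat :: "nat \<Rightarrow> (nat \<times> nat \<Rightarrow> real) \<Rightarrow> real mat" where
  "gram_schmidt_mat n x = (if gram_schmidt_regular n x then mat n n (\<lambda>(i, j). gram_schmidt n x j i) else 1\<^sub>m n)"

lemma sets_gram_schmidt_regular: "{x \<in> space (lebesgue_mat n). gram_schmidt_regular n x} \<in> sets (lebesgue_mat n)"
proof -
  have "{x \<in> space (lebesgue_mat n). \<forall>j\<in>{..<n}. (\<Sum>l<n. (gram_schmidt_residual n x j l)\<^sup>2) \<noteq> 0} \<in> sets (lebesgue_mat n)"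
  proof (rule sets.sets_Collect_finite_All)
    fix j assume "j \<in> {..<n}"
    then have "(\<lambda>x. \<Sum>l<n. (gram_schmidt_residual n x j l)\<^sup>2) \<in> borel_measurable (lebesgue_mat n)"
      by (intro borel_measurable_sum borel_measurable_power measurable_gram_schmidt) auto
    then show "{x \<in> space (lebesgue_mat n). (\<Sum>l<n. (gram_schmidt_residual n x j l)\<^sup>2) \<noteq> 0} \<in> sets (lebesgue_mat n)" by measurable
  qed simp
  then show ?thesis unfolding gram_schmidt_regular_def by (simp only: Ball_def lessThan_iff)
qed

lemma sets_haar_domain: "haar_domain n \<in> sets (lebesgue_mat n)"
proof -
  have "haar_domain n = mat_ball n \<inter> {x \<in> space (lebesgue_mat n). gram_schmidt_regular n x}"
    by (auto simp: haar_domain_def mat_ball_def)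
  then show ?thesis using sets_gram_schmidt_regular by auto
qed

lemma emeasure_haar_domain: "emeasure (lebesgue_mat n) (haar_domain n) \<noteq> 0" "emeasure (lebesgue_mat n) (haar_domain n) \<noteq> \<infinity>"
proof -
  have "mat_box n \<subseteq> haar_domain n"
    using mat_box_subset_ball mat_box_gram_schmidt_regular by (auto simp: haar_domain_def)
  then have "emeasure (lebesgue_mat n) (mat_box n) \<le> emeasure (lebesgue_mat n) (haar_domain n)"
    by (intro emeasure_mono sets_haar_domain)
  then show "emeasure (lebesgue_mat n) (haar_domain n) \<noteq> 0" using emeasure_mat_box_pos[of n] by auto
  have "emeasure (lebesgue_mat n) (haar_domain n) \<le> emeasure (lebesgue_mat n) (mat_ball n)"
    by (intro emeasure_mono) (auto simp: haar_domain_def)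
  then show "emeasure (lebesgue_mat n) (haar_domain n) \<noteq> \<infinity>" using emeasure_mat_ball_finite[of n] by auto
qed

lemma gram_schmidt_regular_mat_act:
  assumes U: "U \<in> orth_group n"
  shows "gram_schmidt_regular n (mat_act n U x) \<longleftrightarrow> gram_schmidt_regular n x"
proof -
  have "(\<Sum>l<n. (gram_schmidt_residual n (mat_act n U x) j l)\<^sup>2) = (\<Sum>l<n. (gram_schmidt_residual n x j l)\<^sup>2)" if "j < n" for j
    using orth_group_inner[OF U, of "gram_schmidt_residual n x j" "gram_schmidt_residual n x j"] that
    by (simp add: gram_schmidt_mat_act[OF U] power2_eq_square)
  then show ?thesis by (simp add: gram_schmidt_regular_def)
qed

lemma gram_schmidt_mat_mat_act:
  assumes U: "U \<in> orth_group n" and x: "gram_schmidt_regular n x"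
  shows "gram_schmidt_mat n (mat_act n U x) = U * gram_schmidt_mat n x"
  using U x by (intro eq_matI)
    (auto simp: gram_schmidt_mat_def gram_schmidt_regular_mat_act[OF U] gram_schmidt_mat_act[OF U] orth_group_def scalar_prod_def atLeast0LessThan)

lemma gram_schmidt_mat_orth: "gram_schmidt_mat n x \<in> orth_group n"
proof (cases "gram_schmidt_regular n x")
  case True
  then have "(gram_schmidt_mat n x)\<^sup>T * gram_schmidt_mat n x = 1\<^sub>m n"
    by (intro eq_matI) (auto simp: gram_schmidt_mat_def scalar_prod_def atLeast0LessThan gram_schmidt_orthonormal)
  then show ?thesis by (simp add: orth_group_def gram_schmidt_mat_def)
qed (simp add: gram_schmidt_mat_def orth_group_def)

lemma space_orth_borel [simp]: "space (orth_borel n) = orth_group n"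
  and sets_orth_borel: "sets (orth_borel n) = sigma_sets (orth_group n)
     {(\<lambda>Q. Q $$ (i, j)) -` E \<inter> orth_group n | i j E. i < n \<and> j < n \<and> E \<in> sets borel}"
  unfolding orth_borel_def by (auto intro!: space_measure_of sets_measure_of)

lemma measurable_orth_borelI:
  assumes "\<And>w. w \<in> space M \<Longrightarrow> f w \<in> orth_group n"
    and "\<And>i j. i < n \<Longrightarrow> j < n \<Longrightarrow> (\<lambda>w. f w $$ (i, j)) \<in> borel_measurable M"
  shows "f \<in> measurable M (orth_borel n)"
  unfolding orth_borel_def
proof (rule measurable_measure_of)
  fix y assume "y \<in> {(\<lambda>Q. Q $$ (i, j)) -` E \<inter> orth_group n | i j E. i < n \<and> j < n \<and> E \<in> sets borel}"
  then obtain i j E where y: "y = (\<lambda>Q. Q $$ (i, j)) -` E \<inter> orth_group n" "i < n" "j < n" "E \<in> sets (borel :: real measure)"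
    by auto
  have "f -` y \<inter> space M = (\<lambda>w. f w $$ (i, j)) -` E \<inter> space M"
    using assms(1) y by auto
  also have "\<dots> \<in> sets M" using assms(2) y by (intro measurable_sets) auto
  finally show "f -` y \<inter> space M \<in> sets M" .
qed (use assms(1) in auto)

lemma measurable_orth_borel_entry:
  assumes "i < n" "j < n"
  shows "(\<lambda>Q. Q $$ (i, j)) \<in> borel_measurable (orth_borel n)"
proof (rule measurableI)
  fix E :: "real set" assume "E \<in> sets borel"
  then show "(\<lambda>Q. Q $$ (i, j)) -` E \<inter> space (orth_borel n) \<in> sets (orth_borel n)"
    unfolding sets_orth_borel using assms by auto
qed simp

lemma measurable_gram_schmidt_mat: "gram_schmidt_mat n \<in> measurable (lebesgue_mat n) (orth_borel n)"
proof (rule measurable_orth_borelI)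
  fix i j assume ij: "i < n" "j < n"
  have "(\<lambda>x. if gram_schmidt_regular n x then gram_schmidt n x j i else 1\<^sub>m n $$ (i, j)) \<in> borel_measurable (lebesgue_mat n)"
    using ij sets_gram_schmidt_regular by (intro measurable_If measurable_gram_schmidt) auto
  then show "(\<lambda>x. gram_schmidt_mat n x $$ (i, j)) \<in> borel_measurable (lebesgue_mat n)"
    by (rule measurable_cong[THEN iffD1, rotated]) (simp add: gram_schmidt_mat_def ij)
qed (rule gram_schmidt_mat_orth)

lemma measurable_orth_mult:
  assumes U: "U \<in> orth_group n"
  shows "(\<lambda>Q. U * Q) \<in> measurable (orth_borel n) (orth_borel n)"
proof (rule measurable_orth_borelI)
  fix i j assume ij: "i < n" "j < n"
  have "(\<lambda>Q. \<Sum>k<n. U $$ (i, k) * Q $$ (k, j)) \<in> borel_measurable (orth_borel n)"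
    using ij by (intro borel_measurable_sum borel_measurable_times measurable_orth_borel_entry) auto
  then show "(\<lambda>Q. (U * Q) $$ (i, j)) \<in> borel_measurable (orth_borel n)"
    by (rule measurable_cong[THEN iffD1, rotated])
      (use ij U in \<open>auto simp: orth_group_def scalar_prod_def atLeast0LessThan\<close>)
qed (use orth_group_mult[OF U] in simp)

text \<open>The image of an invariant probability measure under an equivariant map is
  invariant.\<close>

lemma ex_haar_orth: "\<exists>M. is_haar_orth n M"
proof -
  let ?L = "lebesgue_mat n" and ?G = "haar_domain n"
  let ?N = "uniform_measure ?L ?G"
  let ?M = "distr ?N (orth_borel n) (gram_schmidt_mat n)"
  have M0: "prob_space ?N"
    by (rule prob_space_uniform_measure) (use emeasure_haar_domain in auto)
  have meas: "gram_schmidt_mat n \<in> measurable ?N (orth_borel n)" using measurable_gram_schmidt_mat by simp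
  note M = prob_space.prob_space_distr[OF M0 meas]
  have "distr ?M ?M (\<lambda>Q. U * Q) = ?M" if U: "U \<in> orth_group n" for U
  proof (rule measure_eqI)
    fix A assume "A \<in> sets (distr ?M ?M (\<lambda>Q. U * Q))"
    then have A: "A \<in> sets (orth_borel n)" by simp
    have mU: "(\<lambda>Q. U * Q) \<in> measurable ?M ?M" using measurable_orth_mult[OF U] by simp
    let ?P = "gram_schmidt_mat n -` A \<inter> space ?L"
    have P: "?P \<in> sets ?L" using measurable_sets[OF measurable_gram_schmidt_mat A] .
    have UA: "(\<lambda>Q. U * Q) -` A \<inter> orth_group n \<in> sets (orth_borel n)"
      using measurable_sets[OF measurable_orth_mult[OF U] A] by simp
    let ?P' = "gram_schmidt_mat n -` ((\<lambda>Q. U * Q) -` A \<inter> orth_group n) \<inter> space ?L"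
    have P': "?P' \<in> sets ?L" using measurable_sets[OF measurable_gram_schmidt_mat UA] .
    have "emeasure (distr ?M ?M (\<lambda>Q. U * Q)) A = emeasure ?M ((\<lambda>Q. U * Q) -` A \<inter> orth_group n)"
      using A by (subst emeasure_distr[OF mU]) auto
    also have "\<dots> = emeasure ?N ?P'"
      by (subst emeasure_distr[OF meas UA]) simp
    also have "\<dots> = emeasure ?L (?G \<inter> ?P') / emeasure ?L ?G"
      by (rule emeasure_uniform_measure[OF sets_haar_domain P'])
    \<comment> \<open>Equivariance turns multiplication of the orthonormalised matrix by
      \<open>U\<close> into the action of \<open>U\<close> on the source, under which
      \<open>?G\<close> is stable.\<close>
    also have "?G \<inter> ?P' = mat_act n U -` (?G \<inter> ?P) \<inter> space ?L"
    proof -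
      have "mat_act n U x \<in> space ?L" for x by (simp add: mat_act_def space_lebesgue_mat)
      then show ?thesis
        using mat_act_mat_ball[OF U] gram_schmidt_mat_mat_act[OF U] gram_schmidt_regular_mat_act[OF U] gram_schmidt_mat_orth
        by (auto simp: haar_domain_def)
    qed
    also have "emeasure ?L (mat_act n U -` (?G \<inter> ?P) \<inter> space ?L) = emeasure (distr ?L ?L (mat_act n U)) (?G \<inter> ?P)"
      using sets_haar_domain P
      by (intro emeasure_distr[symmetric] measurable_mat_act measurable_ident_sets[OF refl]) auto
    also have "\<dots> / emeasure ?L ?G = emeasure ?N ?P"
      unfolding distr_mat_act[OF U] by (rule emeasure_uniform_measure[OF sets_haar_domain P, symmetric])
    also have "\<dots> = emeasure ?M A"
      by (subst emeasure_distr[OF meas A]) simp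
    finally show "emeasure (distr ?M ?M (\<lambda>Q. U * Q)) A = emeasure ?M A" .
  qed simp
  then show ?thesis using M by (intro exI[of _ ?M]) (simp add: is_haar_orth_def)
qed

lemma is_haar_haar_orth: "is_haar_orth n (haar_orth n)"
  unfolding haar_orth_def using ex_haar_orth by (rule someI_ex)

section \<open>Trigonometric polynomials and determinants\<close>

definition gram_det :: "nat \<Rightarrow> real \<Rightarrow> real mat \<Rightarrow> real" where
  "gram_det d x M = det (x \<cdot>\<^sub>m 1\<^sub>m d - M * M\<^sup>T)"

lemma poly_char_poly_gram:
  "M \<in> carrier_mat d d \<Longrightarrow> poly (char_poly (M * M\<^sup>T)) x = gram_det d x M"
  unfolding gram_det_def by (rule poly_char_poly) simp

lemmas square_mat_simps =
  assoc_mult_mat[of _ d d _ d _ d] add_mult_distrib_mat[of _ d d _ _ d] mult_add_distrib_mat[of _ d d _ d]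
  minus_mult_distrib_mat[of _ d d _ _ d] mult_minus_distrib_mat[of _ d d _ d]
  mult_smult_assoc_mat[of _ d d _ d] mult_smult_distrib[of _ d d _ d]
  mult_carrier_mat[of _ d d _ d] transpose_mult[of _ d d _ d] transpose_add[of _ d d] for d

lemma orth_group_cancel:
  assumes U: "U \<in> orth_group d"
  shows "U \<in> carrier_mat d d" "U\<^sup>T \<in> carrier_mat d d" "U\<^sup>T * U = 1\<^sub>m d" "U * U\<^sup>T = 1\<^sub>m d"
    and "X \<in> carrier_mat d d \<Longrightarrow> U\<^sup>T * (U * X) = X" "X \<in> carrier_mat d d \<Longrightarrow> U * (U\<^sup>T * X) = X"
proof -
  show c: "U \<in> carrier_mat d d" "U\<^sup>T \<in> carrier_mat d d" "U\<^sup>T * U = 1\<^sub>m d" "U * U\<^sup>T = 1\<^sub>m d"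
    using U orth_group_transpose[OF U] by (auto simp: orth_group_def)
  show "X \<in> carrier_mat d d \<Longrightarrow> U\<^sup>T * (U * X) = X" "X \<in> carrier_mat d d \<Longrightarrow> U * (U\<^sup>T * X) = X"
    using c by (simp_all flip: assoc_mult_mat[of _ d d _ d _ d])
qed

lemma gram_matrix_carrier: "N \<in> carrier_mat d d \<Longrightarrow> x \<cdot>\<^sub>m 1\<^sub>m d - N * N\<^sup>T \<in> carrier_mat d d"
  by (rule minus_carrier_mat) simp

lemma gram_det_orth_left:
  assumes U: "U \<in> orth_group d" and M: "M \<in> carrier_mat d d"
  shows "gram_det d x (U * M) = gram_det d x M"
proof -
  note c = orth_group_cancel[OF U]
  have "x \<cdot>\<^sub>m 1\<^sub>m d - U * M * (U * M)\<^sup>T = U * ((x \<cdot>\<^sub>m 1\<^sub>m d - M * M\<^sup>T) * U\<^sup>T)"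
    using c M by (simp add: square_mat_simps[where d = d])
  moreover have "det (U * (Z * U\<^sup>T)) = det Z" if "Z \<in> carrier_mat d d" for Z
  proof -
    have "det U * det U\<^sup>T = 1" using c by (metis det_mult det_one)
    then show ?thesis
      using that c by (simp add: det_mult[of _ d] mult_carrier_mat[of _ d d _ d] mult.left_commute[of "det U"])
  qed
  ultimately show ?thesis using gram_matrix_carrier[OF M] by (simp add: gram_det_def)
qed

lemma gram_det_orth_right:
  assumes U: "U \<in> orth_group d" and M: "M \<in> carrier_mat d d"
  shows "gram_det d x (M * U) = gram_det d x M"
  using orth_group_cancel[OF U] M by (simp add: gram_det_def square_mat_simps[where d = d])

text \<open>Exchanging the two halves of the index set of a bordered matrix exchanges
  \<open>M * M\<^sup>T\<close> with \<open>M\<^sup>T * M\<close> and keeps the determinant.\<close>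

lemma gram_det_transpose:
  assumes M: "M \<in> carrier_mat d d"
  shows "gram_det d x M\<^sup>T = gram_det d x M"
proof -
  have "gram_det d x M = det (four_block_mat (x \<cdot>\<^sub>m 1\<^sub>m d) M M\<^sup>T (1\<^sub>m d))"
    unfolding gram_det_def using M by (subst det_four_block_mat) auto
  also have "\<dots> = det (four_block_mat (1\<^sub>m d) M\<^sup>T M (x \<cdot>\<^sub>m 1\<^sub>m d))"
  proof -
    let ?p = "\<lambda>i. if i < d then i + d else if i < d + d then i - d else i"
    have "bij_betw ?p {0..<d + d} {0..<d + d}"
      by (rule bij_betw_byWitness[where f' = ?p]) auto
    then have p: "?p permutes {0..<d + d}" by (rule bij_imp_permutes) auto
    have "four_block_mat (1\<^sub>m d) M\<^sup>T M (x \<cdot>\<^sub>m 1\<^sub>m d) =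
      mat (d + d) (d + d) (\<lambda>(i, j). four_block_mat (x \<cdot>\<^sub>m 1\<^sub>m d) M M\<^sup>T (1\<^sub>m d) $$ (?p i, ?p j))"
      using M by (intro eq_matI) auto
    then show ?thesis using det_permute_both[OF _ p, of "four_block_mat (x \<cdot>\<^sub>m 1\<^sub>m d) M M\<^sup>T (1\<^sub>m d)"] M
      by simp
  qed
  also have "\<dots> = gram_det d x M\<^sup>T"
    unfolding gram_det_def using M by (subst det_four_block_mat) auto
  finally show ?thesis by simp
qed

text \<open>Trigonometric polynomials with frequencies between \<open>-m\<close> and \<open>n\<close>, with the denominator cleared.\<close>

definition laurent :: "nat \<Rightarrow> nat \<Rightarrow> (real \<Rightarrow> complex) \<Rightarrow> bool" where
  "laurent m n g \<longleftrightarrow> (\<exists>q. degree q \<le> m + n \<and> (\<forall>\<theta>. cis \<theta> ^ m * g \<theta> = poly q (cis \<theta>)))"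

lemma laurent_const: "laurent m n (\<lambda>_. c)"
  unfolding laurent_def
  by (intro exI[of _ "monom c m"]) (auto simp: poly_monom degree_monom_le intro: order_trans[OF degree_monom_le])

lemma laurent_add: "laurent m n f \<Longrightarrow> laurent m n g \<Longrightarrow> laurent m n (\<lambda>\<theta>. f \<theta> + g \<theta>)"
  unfolding laurent_def
proof (elim exE conjE)
  fix q r assume *: "degree q \<le> m + n" "degree r \<le> m + n"
    "\<forall>\<theta>. cis \<theta> ^ m * f \<theta> = poly q (cis \<theta>)" "\<forall>\<theta>. cis \<theta> ^ m * g \<theta> = poly r (cis \<theta>)"
  then show "\<exists>q. degree q \<le> m + n \<and> (\<forall>\<theta>. cis \<theta> ^ m * (f \<theta> + g \<theta>) = poly q (cis \<theta>))"
    by (intro exI[of _ "q + r"]) (simp add: degree_add_le distrib_left)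
qed

lemma laurent_mult: "laurent m n f \<Longrightarrow> laurent m' n' g \<Longrightarrow> laurent (m + m') (n + n') (\<lambda>\<theta>. f \<theta> * g \<theta>)"
  unfolding laurent_def
proof (elim exE conjE)
  fix q r assume *: "degree q \<le> m + n" "degree r \<le> m' + n'"
    "\<forall>\<theta>. cis \<theta> ^ m * f \<theta> = poly q (cis \<theta>)" "\<forall>\<theta>. cis \<theta> ^ m' * g \<theta> = poly r (cis \<theta>)"
  have "degree (q * r) \<le> (m + m') + (n + n')" using degree_mult_le[of q r] * by linarith
  moreover have "cis \<theta> ^ (m + m') * (f \<theta> * g \<theta>) = poly (q * r) (cis \<theta>)" for \<theta>
  proof -
    have "cis \<theta> ^ (m + m') * (f \<theta> * g \<theta>) = (cis \<theta> ^ m * f \<theta>) * (cis \<theta> ^ m' * g \<theta>)"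
      by (simp add: power_add ac_simps)
    then show ?thesis using * by simp
  qed
  ultimately show "\<exists>q. degree q \<le> (m + m') + (n + n') \<and> (\<forall>\<theta>. cis \<theta> ^ (m + m') * (f \<theta> * g \<theta>) = poly q (cis \<theta>))"
    by blast
qed

lemma laurent_mono: "laurent m n g \<Longrightarrow> m \<le> m' \<Longrightarrow> n \<le> n' \<Longrightarrow> laurent m' n' g"
  using laurent_mult[of m n g "m' - m" "n' - n" "\<lambda>_. 1"] laurent_const[of "m' - m" "n' - n" 1] by simp

lemma laurent_sum: "(\<And>i. i \<in> I \<Longrightarrow> laurent m n (f i)) \<Longrightarrow> laurent m n (\<lambda>\<theta>. \<Sum>i\<in>I. f i \<theta>)"
  by (induction I rule: infinite_finite_induct) (auto intro: laurent_const laurent_add)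

lemma laurent_prod:
  "finite I \<Longrightarrow> (\<And>i. i \<in> I \<Longrightarrow> laurent (m i) (n i) (f i)) \<Longrightarrow>
    laurent (\<Sum>i\<in>I. m i) (\<Sum>i\<in>I. n i) (\<lambda>\<theta>. \<Prod>i\<in>I. f i \<theta>)"
  by (induction I rule: finite_induct) (auto intro: laurent_const laurent_mult)

lemma laurent_cis: "laurent 0 1 cis" "laurent 1 0 (\<lambda>\<theta>. cis (- \<theta>))"
proof -
  show "laurent 0 1 cis" unfolding laurent_def by (intro exI[of _ "[:0, 1:]"]) simp
  show "laurent 1 0 (\<lambda>\<theta>. cis (- \<theta>))"
    unfolding laurent_def by (intro exI[of _ 1]) (simp add: cis_mult)
qed

text \<open>Frequencies \<open>\<plusminus>1\<close> and \<open>\<plusminus>2\<close> are not multiples of 3, so they average to zero over the three rotations.\<close>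

lemma laurent_periodic_const:
  assumes g: "laurent 2 2 g" and per: "\<And>\<theta>. g (2 * pi / 3 + \<theta>) = g \<theta>"
  shows "g \<theta> = g 0"
proof -
  obtain q where q: "degree q \<le> 4" "\<And>\<theta>. cis \<theta> ^ 2 * g \<theta> = poly q (cis \<theta>)"
    using g by (auto simp: laurent_def)
  define w where "w = cis (2 * pi / 3)"
  have w: "w ^ 3 = 1" "1 + w + w ^ 2 = 0"
  proof -
    show 1: "w ^ 3 = 1" unfolding w_def by (simp add: Complex.DeMoivre)
    have "Im w \<noteq> 0" by (simp add: w_def sin_120)
    then have "w \<noteq> 1" by auto
    have "(w - 1) * (1 + w + w ^ 2) = w ^ 3 - 1"
      by (simp add: power2_eq_square power3_eq_cube algebra_simps)
    then show "1 + w + w ^ 2 = 0" using 1 \<open>w \<noteq> 1\<close> by simp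
  qed
  have expand: "poly q z = coeff q 0 + coeff q 1 * z + coeff q 2 * z ^ 2 + coeff q 3 * z ^ 3 + coeff q 4 * z ^ 4" for z
  proof -
    have "poly q z = (\<Sum>i\<le>4. coeff q i * z ^ i)"
      unfolding poly_altdef using q(1) by (intro sum.mono_neutral_left) (auto simp: coeff_eq_0)
    also have "{..4 :: nat} = {0, 1, 2, 3, 4}" by auto
    finally show ?thesis by simp
  qed
  have "g \<theta> = coeff q 2" for \<theta>
  proof -
    define z where "z = cis \<theta>"
    have e1: "z ^ 2 * g \<theta> = poly q z" using q(2)[of \<theta>] by (simp add: z_def)
    have e2: "(w * z) ^ 2 * g \<theta> = poly q (w * z)"
      using q(2)[of "2 * pi / 3 + \<theta>"] per[of \<theta>] by (simp add: z_def w_def cis_mult)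
    have e3: "(w * (w * z)) ^ 2 * g \<theta> = poly q (w * (w * z))"
      using q(2)[of "2 * pi / 3 + (2 * pi / 3 + \<theta>)"] per[of \<theta>] per[of "2 * pi / 3 + \<theta>"]
      by (simp add: z_def w_def cis_mult)
    have "3 * (z ^ 2 * g \<theta>) = 3 * (z ^ 2 * coeff q 2)"
    proof -
      \<comment> \<open>With the denominator cleared, frequency 0 sits at exponent 2. The weights 1,
        \<open>w\<close>, \<open>w ^ 2\<close> select the exponents congruent to 2 modulo 3, and
        among 0 to 4 only 2 itself is one.\<close>
      have "w * ((w * z) ^ 2 * g \<theta>) = w ^ 3 * (z ^ 2 * g \<theta>)" by (simp add: eval_nat_numeral algebra_simps)
      moreover have "w ^ 2 * ((w * (w * z)) ^ 2 * g \<theta>) = (w ^ 3) ^ 2 * (z ^ 2 * g \<theta>)" by (simp add: eval_nat_numeral algebra_simps)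
      ultimately have "3 * (z ^ 2 * g \<theta>) = poly q z + w * poly q (w * z) + w ^ 2 * poly q (w * (w * z))"
        using e1 e2 e3 w(1) by simp
      also have "\<dots> = coeff q 0 * (1 + w + w ^ 2) + coeff q 1 * z * (1 + w ^ 2 + w * w ^ 3) +
          coeff q 2 * z ^ 2 * (1 + w ^ 3 + (w ^ 3) ^ 2) + coeff q 3 * z ^ 3 * (1 + w * w ^ 3 + w ^ 2 * (w ^ 3) ^ 2) +
          coeff q 4 * z ^ 4 * (1 + w ^ 2 * w ^ 3 + w * (w ^ 3) ^ 3)"
        unfolding expand by (simp add: eval_nat_numeral algebra_simps)
      also have "\<dots> = 3 * (z ^ 2 * coeff q 2)"
      proof -
        have "1 + w ^ 2 + w = 0" using w(2) by (simp add: ac_simps)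
        then show ?thesis unfolding w(1) using w(2) by simp
      qed
      finally show ?thesis .
    qed
    moreover have "z \<noteq> 0" by (simp add: z_def)
    ultimately show ?thesis by simp
  qed
  then show ?thesis by simp
qed

text \<open>The complex diagonal form of a plane rotation; \<open>a\<close> and \<open>b\<close> are
  the positions of its two nontrivial eigenvalues.\<close>

definition torus_mat :: "nat \<Rightarrow> nat \<Rightarrow> nat \<Rightarrow> real \<Rightarrow> complex mat" where
  "torus_mat d a b \<theta> = mat d d (\<lambda>(i, j). if i = j then
     (if i = a then cis \<theta> else if i = b then cis (- \<theta>) else 1) else 0)"

text \<open>
  Diagonalizing the rotation bounds the degree by 2 separately in every term of the Leibniz formula;
  in real coordinates this would need cancellation between terms.
\<close>

lemma laurent_det_torus:
  fixes K B C D :: "complex mat"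
  assumes ab: "a < d" "b < d" "a \<noteq> b"
    and c: "K \<in> carrier_mat d d" "B \<in> carrier_mat d d" "C \<in> carrier_mat d d" "D \<in> carrier_mat d d"
  shows "laurent 2 2 (\<lambda>\<theta>. det (K + torus_mat d a b \<theta> * B + C * torus_mat d a b (- \<theta>) +
    torus_mat d a b \<theta> * (D * torus_mat d a b (- \<theta>))))"
proof -
  let ?l = "\<lambda>i \<theta>. if i = a then cis \<theta> else if i = b then cis (- \<theta>) else 1"
  let ?X = "\<lambda>\<theta>. K + torus_mat d a b \<theta> * B + C * torus_mat d a b (- \<theta>) + torus_mat d a b \<theta> * (D * torus_mat d a b (- \<theta>))"
  have T: "torus_mat d a b \<theta> \<in> carrier_mat d d" for \<theta> by (simp add: torus_mat_def)
  have X: "?X \<theta> \<in> carrier_mat d d" for \<theta>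
    using c T by (intro add_carrier_mat mult_carrier_mat[of _ d d]) auto
  have entry: "?X \<theta> $$ (i, j) = K $$ (i, j) + ?l i \<theta> * B $$ (i, j) + ?l j (- \<theta>) * C $$ (i, j)
      + ?l i \<theta> * (?l j (- \<theta>) * D $$ (i, j))"
    if ij: "i < d" "j < d" for i j \<theta>
  proof -
    note m = mult_diag_mat[OF _ ij, of _ "\<lambda>i. ?l i \<theta>"] mult_diag_mat[OF _ ij, of _ "\<lambda>i. ?l i (- \<theta>)"]
    have 1: "(torus_mat d a b \<theta> * B) $$ (i, j) = ?l i \<theta> * B $$ (i, j)"
      unfolding torus_mat_def by (rule m(1)[OF c(2)])
    have 2: "(C * torus_mat d a b (- \<theta>)) $$ (i, j) = ?l j (- \<theta>) * C $$ (i, j)"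
      unfolding torus_mat_def by (rule m(4)[OF c(3)])
    have 3: "(D * torus_mat d a b (- \<theta>)) $$ (i, j) = ?l j (- \<theta>) * D $$ (i, j)"
      unfolding torus_mat_def by (rule m(4)[OF c(4)])
    have 4: "(torus_mat d a b \<theta> * (D * torus_mat d a b (- \<theta>))) $$ (i, j) =
        ?l i \<theta> * (D * torus_mat d a b (- \<theta>)) $$ (i, j)"
      unfolding torus_mat_def[of d a b \<theta>] by (rule m(1)[OF mult_carrier_mat[OF c(4) T]])
    have dims: "dim_row (torus_mat d a b t) = d" "dim_col (torus_mat d a b t) = d" for t
      by (simp_all add: torus_mat_def)
    show ?thesis unfolding 1[symmetric] 2[symmetric] 3[symmetric] 4[symmetric]
      using ij c by (simp add: dims)
  qed
  have l: "laurent (if i = b then 1 else 0) (if i = a then 1 else 0) (?l i)"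
    and l': "laurent (if i = a then 1 else 0) (if i = b then 1 else 0) (\<lambda>\<theta>. ?l i (- \<theta>))" for i
    using ab laurent_cis laurent_const[of 0 0 1] by auto
  have "laurent 2 2 (\<lambda>\<theta>. \<Prod>i = 0..<d. ?X \<theta> $$ (i, p i))" if p: "p permutes {0..<d}" for p
  proof -
    \<comment> \<open>Bounds for the negative and positive frequencies of the factor in row
      \<open>i\<close>, one part from the row multiplier at \<open>i\<close> and one from the column
      multiplier at \<open>p i\<close>. A permutation meets \<open>a\<close> and \<open>b\<close>
      once as a row and once as a column each, so both totals are 2.\<close>
    let ?m = "\<lambda>i. (if i = b then 1 else 0) + (if p i = a then 1 else 0 :: nat)"
    let ?n = "\<lambda>i. (if i = a then 1 else 0) + (if p i = b then 1 else 0 :: nat)"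
    have fac: "laurent (?m i) (?n i) (\<lambda>\<theta>. ?X \<theta> $$ (i, p i))" if i: "i \<in> {0..<d}" for i
    proof -
      have pi: "p i < d" using permutes_less[OF p] i by simp
      have lm: "laurent (?m i) (?n i) (?l i)" "laurent (?m i) (?n i) (\<lambda>\<theta>. ?l (p i) (- \<theta>))"
        by (rule laurent_mono[OF l], simp, simp) (rule laurent_mono[OF l'], simp, simp)
      have c0: "laurent (?m i) (?n i) (\<lambda>\<theta>. f \<theta> * k)" if "laurent (?m i) (?n i) f" for f k
        using laurent_mult[OF that laurent_const[of 0 0 k]] by simp
      have "laurent (?m i) (?n i) (\<lambda>\<theta>. K $$ (i, p i) + ?l i \<theta> * B $$ (i, p i) + ?l (p i) (- \<theta>) * C $$ (i, p i)
        + (?l i \<theta> * ?l (p i) (- \<theta>)) * D $$ (i, p i))"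
        by (intro laurent_add laurent_const c0 lm laurent_mult[OF l l'])
      then show ?thesis using entry[of i "p i"] i pi by (simp add: mult.assoc)
    qed
    have "laurent (\<Sum>i = 0..<d. ?m i) (\<Sum>i = 0..<d. ?n i) (\<lambda>\<theta>. \<Prod>i = 0..<d. ?X \<theta> $$ (i, p i))"
      by (rule laurent_prod) (use fac in auto)
    moreover have "(\<Sum>i = 0..<d. if p i = k then 1 else 0 :: nat) = 1" if "k < d" for k
    proof -
      have "(\<Sum>i = 0..<d. if p i = k then 1 else 0 :: nat) = (\<Sum>i = 0..<d. if i = k then 1 else 0)"
        using sum.permute[OF p, of "\<lambda>i. if i = k then 1 else 0 :: nat"] by simp
      then show ?thesis using that by simp
    qed
    ultimately show ?thesis using ab by (simp add: sum.distrib numeral_2_eq_2)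
  qed
  then have "laurent 2 2 (\<lambda>\<theta>. of_int (sign p) * (\<Prod>i = 0..<d. ?X \<theta> $$ (i, p i)))"
    if "p permutes {0..<d}" for p
    using laurent_mult[OF laurent_const[of 0 0]] that by force
  then have "laurent 2 2 (\<lambda>\<theta>. \<Sum>p | p permutes {0..<d}. of_int (sign p) * (\<Prod>i = 0..<d. ?X \<theta> $$ (i, p i)))"
    by (intro laurent_sum) auto
  then show ?thesis using det_def'[OF X] by simp
qed

text \<open>In the Gram matrix the rotation stands on the left and its inverse on the right.
  Conjugation by the eigenbasis \<open>E\<close> makes both diagonal and preserves the
  determinant.\<close>

lemma laurent_gram_det:
  fixes R :: "real \<Rightarrow> real mat"
  assumes ab: "a < d" "b < d" "a \<noteq> b" and A: "A \<in> carrier_mat d d" and Y: "Y \<in> carrier_mat d d"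
    and E: "E \<in> carrier_mat d d" "E' \<in> carrier_mat d d" "E * E' = 1\<^sub>m d"
    and R: "\<And>\<theta>. R \<theta> \<in> carrier_mat d d" "\<And>\<theta>. (R \<theta>)\<^sup>T = R (- \<theta>)"
    and diag: "\<And>\<theta>. map_mat of_real (R \<theta>) = E * (torus_mat d a b \<theta> * E')"
  shows "laurent 2 2 (\<lambda>\<theta>. of_real (gram_det d x (A + R \<theta> * Y)))"
proof -
  let ?c = "map_mat (of_real :: real \<Rightarrow> complex)"
  let ?L = "torus_mat d a b"
  have E2: "E' * E = 1\<^sub>m d" by (rule mat_mult_left_right_inverse[OF E])
  have EE: "E' * (E * Z) = Z" if "Z \<in> carrier_mat d d" for Z
    using E2 E that by (simp flip: assoc_mult_mat[of _ d d _ d _ d])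
  have T: "?L \<theta> \<in> carrier_mat d d" for \<theta> by (simp add: torus_mat_def)
  let ?K = "E' * (?c (x \<cdot>\<^sub>m 1\<^sub>m d - A * A\<^sup>T) * E)"
  let ?B = "E' * (?c (- (Y * A\<^sup>T)) * E)"
  let ?C = "E' * (?c (- (A * Y\<^sup>T)) * E)"
  let ?D = "E' * (?c (- (Y * Y\<^sup>T)) * E)"
  have hom: "?c (M + N) = ?c M + ?c N" "?c (M * N) = ?c M * ?c N"
    if "M \<in> carrier_mat d d" "N \<in> carrier_mat d d" for M N
    using that by (auto simp: of_real_hom.mat_hom_mult[of _ d d _ d] intro!: eq_matI)
  have "of_real (gram_det d x (A + R \<theta> * Y)) =
    det (?K + ?L \<theta> * ?B + ?C * ?L (- \<theta>) + ?L \<theta> * (?D * ?L (- \<theta>)))" for \<theta>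
  proof -
    \<comment> \<open>The four terms are sorted by where the rotation occurs: nowhere, on the left,
      on the right, on both sides.\<close>
    have expand: "x \<cdot>\<^sub>m 1\<^sub>m d - (A + R \<theta> * Y) * (A + R \<theta> * Y)\<^sup>T =
      (x \<cdot>\<^sub>m 1\<^sub>m d - A * A\<^sup>T) + R \<theta> * (- (Y * A\<^sup>T)) + - (A * Y\<^sup>T) * R (- \<theta>) + R \<theta> * (- (Y * Y\<^sup>T) * R (- \<theta>))"
    proof -
      have "(A + R \<theta> * Y) * (A + R \<theta> * Y)\<^sup>T =
        A * A\<^sup>T + R \<theta> * (Y * A\<^sup>T) + (A * (Y\<^sup>T * R (- \<theta>)) + R \<theta> * (Y * (Y\<^sup>T * R (- \<theta>))))"
        using A Y R by (simp add: square_mat_simps[where d = d])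
      moreover have "- (A * Y\<^sup>T) * R (- \<theta>) = - (A * (Y\<^sup>T * R (- \<theta>)))"
        "R \<theta> * - (Y * A\<^sup>T) = - (R \<theta> * (Y * A\<^sup>T))"
        "R \<theta> * (- (Y * Y\<^sup>T) * R (- \<theta>)) = - (R \<theta> * (Y * (Y\<^sup>T * R (- \<theta>))))"
        using A Y R carrier_matD[OF R(1)] by (simp_all add: square_mat_simps[where d = d])
      ultimately show ?thesis
        using A Y carrier_matD[OF R(1)] by (auto intro!: eq_matI)
    qed
    have "of_real (gram_det d x (A + R \<theta> * Y)) = det (?c (x \<cdot>\<^sub>m 1\<^sub>m d - (A + R \<theta> * Y) * (A + R \<theta> * Y)\<^sup>T))"
      unfolding gram_det_def by (rule of_real_hom.hom_det[symmetric])
    also have "\<dots> = det (E' * (?c (x \<cdot>\<^sub>m 1\<^sub>m d - (A + R \<theta> * Y) * (A + R \<theta> * Y)\<^sup>T) * E))"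
    proof -
      have "det E' * det E = 1" using E2 E by (metis det_mult det_one)
      moreover have "det (E' * (Z * E)) = det E' * (det Z * det E)" if "Z \<in> carrier_mat d d" for Z
        using that E by (simp add: det_mult[of _ d] mult_carrier_mat[of _ d d _ d])
      moreover have "?c (x \<cdot>\<^sub>m 1\<^sub>m d - (A + R \<theta> * Y) * (A + R \<theta> * Y)\<^sup>T) \<in> carrier_mat d d"
        unfolding map_carrier_mat
        by (intro gram_matrix_carrier add_carrier_mat mult_carrier_mat[OF R(1) Y])
      ultimately show ?thesis by (simp add: mult.left_commute[of _ "det E'"] mult.commute)
    qed
    also have "E' * (?c (x \<cdot>\<^sub>m 1\<^sub>m d - (A + R \<theta> * Y) * (A + R \<theta> * Y)\<^sup>T) * E) =
      ?K + ?L \<theta> * ?B + ?C * ?L (- \<theta>) + ?L \<theta> * (?D * ?L (- \<theta>))"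
    proof -
      let ?G = "?c (x \<cdot>\<^sub>m 1\<^sub>m d - A * A\<^sup>T)" and ?P = "?c (- (Y * A\<^sup>T))" and ?Q = "?c (- (A * Y\<^sup>T))" and ?S = "?c (- (Y * Y\<^sup>T))"
      have c: "?G \<in> carrier_mat d d" "?P \<in> carrier_mat d d" "?Q \<in> carrier_mat d d" "?S \<in> carrier_mat d d"
        using A Y by auto
      have "?c (x \<cdot>\<^sub>m 1\<^sub>m d - (A + R \<theta> * Y) * (A + R \<theta> * Y)\<^sup>T) =
        ?G + ?c (R \<theta>) * ?P + ?Q * ?c (R (- \<theta>)) + ?c (R \<theta>) * (?S * ?c (R (- \<theta>)))"
        unfolding expand using A Y R(1)
        by (subst hom, auto intro!: mult_carrier_mat[of _ d d] add_carrier_mat simp: hom)+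
      also have "E' * (\<dots> * E) = ?K + ?L \<theta> * ?B + ?C * ?L (- \<theta>) + ?L \<theta> * (?D * ?L (- \<theta>))"
        unfolding diag using c E T E2
          by (simp add: square_mat_simps[where d = d] EE right_mult_one_mat[OF T] assoc_add_mat[of _ d d])
      finally show ?thesis .
    qed
    finally show ?thesis .
  qed
  moreover have "?K \<in> carrier_mat d d"
    by (intro mult_carrier_mat[OF E(2)] mult_carrier_mat[OF _ E(1)]) (simp add: gram_matrix_carrier[OF A])
  ultimately show ?thesis
    using laurent_det_torus[OF ab, of ?K ?B ?C ?D] A Y E by (simp add: mult_carrier_mat[of _ d d _ d])
qed

section \<open>Sums over permutation matrices\<close>

definition perm_mat :: "nat \<Rightarrow> (nat \<Rightarrow> nat) \<Rightarrow> real mat" where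
  "perm_mat d \<sigma> = mat d d (\<lambda>(i, j). if i = \<sigma> j then 1 else 0)"

lemma perm_mats_eq: "perm_mats d = perm_mat d ` {\<sigma>. \<sigma> permutes {..<d}}"
  by (auto simp: perm_mats_def perm_mat_def)

lemma finite_perm_mats [simp]: "finite (perm_mats d)"
  unfolding perm_mats_eq by (simp add: finite_permutations)

lemma perm_mat_mult:
  assumes "\<tau> permutes {..<d}"
  shows "perm_mat d \<sigma> * perm_mat d \<tau> = perm_mat d (\<sigma> \<circ> \<tau>)"
proof (rule eq_matI)
  fix i j assume "i < dim_row (perm_mat d (\<sigma> \<circ> \<tau>))" "j < dim_col (perm_mat d (\<sigma> \<circ> \<tau>))"
  then have ij: "i < d" "j < d" by (auto simp: perm_mat_def)
  have tj: "\<tau> j < d" using permutes_in_image[OF assms, of j] ij by simp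
  have "(perm_mat d \<sigma> * perm_mat d \<tau>) $$ (i, j) = (\<Sum>k<d. (if i = \<sigma> k then 1 else 0) * (if k = \<tau> j then 1 else 0))"
    using ij by (simp add: perm_mat_def scalar_prod_def atLeast0LessThan)
  also have "\<dots> = (\<Sum>k<d. if k = \<tau> j then (if i = \<sigma> (\<tau> j) then 1 else 0) else 0)"
    by (intro sum.cong) auto
  finally show "(perm_mat d \<sigma> * perm_mat d \<tau>) $$ (i, j) = perm_mat d (\<sigma> \<circ> \<tau>) $$ (i, j)"
    using ij tj by (simp add: perm_mat_def)
qed (auto simp: perm_mat_def)

lemma perm_mat_orth:
  assumes "\<sigma> permutes {..<d}"
  shows "perm_mat d \<sigma> \<in> orth_group d"
proof -
  have "(perm_mat d \<sigma>)\<^sup>T * perm_mat d \<sigma> = 1\<^sub>m d"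
  proof (rule eq_matI)
    fix i j assume "i < dim_row (1\<^sub>m d :: real mat)" "j < dim_col (1\<^sub>m d :: real mat)"
    then have ij: "i < d" "j < d" by auto
    have s: "\<sigma> j < d" using permutes_in_image[OF assms, of j] ij by simp
    have "((perm_mat d \<sigma>)\<^sup>T * perm_mat d \<sigma>) $$ (i, j) = (\<Sum>k<d. (if k = \<sigma> i then 1 else 0) * (if k = \<sigma> j then 1 else 0))"
      using ij by (simp add: perm_mat_def scalar_prod_def atLeast0LessThan)
    also have "\<dots> = (\<Sum>k<d. if k = \<sigma> j then (if i = j then 1 else 0) else 0)"
      using permutes_inj[OF assms] by (intro sum.cong) (auto dest: injD)
    finally show "((perm_mat d \<sigma>)\<^sup>T * perm_mat d \<sigma>) $$ (i, j) = 1\<^sub>m d $$ (i, j)"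
      using ij s by simp
  qed (auto simp: perm_mat_def)
  then show ?thesis by (simp add: orth_group_def perm_mat_def)
qed

lemma perm_mats_orth: "P \<in> perm_mats d \<Longrightarrow> P \<in> orth_group d"
  unfolding perm_mats_eq using perm_mat_orth by auto

lemma perm_mats_carrier: "P \<in> perm_mats d \<Longrightarrow> P \<in> carrier_mat d d"
  by (auto simp: perm_mats_eq perm_mat_def)

lemma perm_mats_mult: "P \<in> perm_mats d \<Longrightarrow> S \<in> perm_mats d \<Longrightarrow> P * S \<in> perm_mats d"
  unfolding perm_mats_eq by (auto simp: perm_mat_mult intro!: imageI permutes_compose)

lemma perm_mats_transpose:
  assumes "P \<in> perm_mats d"
  shows "P\<^sup>T \<in> perm_mats d"
proof -
  obtain \<sigma> where \<sigma>: "\<sigma> permutes {..<d}" "P = perm_mat d \<sigma>" using assms by (auto simp: perm_mats_eq)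
  have "P\<^sup>T = perm_mat d (inv_into UNIV \<sigma>)"
    using \<sigma> permutes_inverses[OF \<sigma>(1)]
    by (intro eq_matI) (auto simp: perm_mat_def)
  then show ?thesis using permutes_inv[OF \<sigma>(1)] by (auto simp: perm_mats_eq)
qed

lemma sum_perm_mats_mult:
  assumes C: "C \<in> perm_mats d"
  shows "(\<Sum>P\<in>perm_mats d. f (P * C)) = (\<Sum>P\<in>perm_mats d. f P)"
proof -
  have c: "C \<in> carrier_mat d d" "C\<^sup>T * C = 1\<^sub>m d" "C * C\<^sup>T = 1\<^sub>m d"
    using perm_mats_orth[OF C] orth_group_transpose[OF perm_mats_orth[OF C]] by (auto simp: orth_group_def)
  have "P * C * C\<^sup>T = P" "P * C\<^sup>T * C = P" if "P \<in> perm_mats d" for P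
    using perm_mats_carrier[OF that] c by (simp_all add: assoc_mult_mat[of _ d d _ d _ d])
  then show ?thesis
    using C by (intro sum.reindex_bij_witness[of _ "\<lambda>P. P * C\<^sup>T" "\<lambda>P. P * C"])
      (auto simp: perm_mats_mult perm_mats_transpose)
qed

section \<open>Derivatives along matrix paths\<close>

definition has_mat_deriv :: "nat \<Rightarrow> (real \<Rightarrow> real mat) \<Rightarrow> real mat \<Rightarrow> real \<Rightarrow> bool" where
  "has_mat_deriv d X X' t \<longleftrightarrow> (\<forall>s. X s \<in> carrier_mat d d) \<and> X' \<in> carrier_mat d d \<and>
     (\<forall>i<d. \<forall>j<d. ((\<lambda>s. X s $$ (i, j)) has_real_derivative X' $$ (i, j)) (at t))"

lemma has_mat_deriv_const: "C \<in> carrier_mat d d \<Longrightarrow> has_mat_deriv d (\<lambda>_. C) (0\<^sub>m d d) t"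
  by (auto simp: has_mat_deriv_def)

lemma has_mat_deriv_add:
  assumes "has_mat_deriv d X X' t" "has_mat_deriv d Y Y' t"
  shows "has_mat_deriv d (\<lambda>s. X s + Y s) (X' + Y') t"
  unfolding has_mat_deriv_def
proof (intro conjI allI impI)
  fix i j assume ij: "i < d" "j < d"
  have *: "(X s + Y s) $$ (i, j) = X s $$ (i, j) + Y s $$ (i, j)" for s
    using assms ij unfolding has_mat_deriv_def by (metis carrier_matD index_add_mat(1))
  have **: "(X' + Y') $$ (i, j) = X' $$ (i, j) + Y' $$ (i, j)"
    using assms ij unfolding has_mat_deriv_def by (metis carrier_matD index_add_mat(1))
  show "((\<lambda>s. (X s + Y s) $$ (i, j)) has_real_derivative (X' + Y') $$ (i, j)) (at t)"
    unfolding * ** using assms ij by (intro DERIV_add) (auto simp: has_mat_deriv_def)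
qed (use assms in \<open>auto simp: has_mat_deriv_def\<close>)

lemma has_mat_deriv_uminus:
  assumes "has_mat_deriv d X X' t"
  shows "has_mat_deriv d (\<lambda>s. - X s) (- X') t"
  unfolding has_mat_deriv_def
proof (intro conjI allI impI)
  fix i j assume ij: "i < d" "j < d"
  have *: "(- X s) $$ (i, j) = - X s $$ (i, j)" for s
    using assms ij unfolding has_mat_deriv_def by (metis carrier_matD index_uminus_mat(1))
  have **: "(- X') $$ (i, j) = - X' $$ (i, j)"
    using assms ij unfolding has_mat_deriv_def by (metis carrier_matD index_uminus_mat(1))
  show "((\<lambda>s. (- X s) $$ (i, j)) has_real_derivative (- X') $$ (i, j)) (at t)"
    unfolding * ** using assms ij by (intro DERIV_minus) (auto simp: has_mat_deriv_def)
qed (use assms in \<open>auto simp: has_mat_deriv_def\<close>)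

lemma index_mult_square:
  assumes "X \<in> carrier_mat d d" "Y \<in> carrier_mat d d" "i < d" "j < d"
  shows "(X * Y) $$ (i, j) = (\<Sum>k<d. X $$ (i, k) * Y $$ (k, j))"
  using assms by (simp add: scalar_prod_def atLeast0LessThan)

lemma has_mat_deriv_mult:
  assumes X: "has_mat_deriv d X X' t" and Y: "has_mat_deriv d Y Y' t"
  shows "has_mat_deriv d (\<lambda>s. X s * Y s) (X' * Y t + X t * Y') t"
  unfolding has_mat_deriv_def
proof (intro conjI allI impI)
  have c: "X s \<in> carrier_mat d d" "Y s \<in> carrier_mat d d" "X' \<in> carrier_mat d d" "Y' \<in> carrier_mat d d" for s
    using assms by (auto simp: has_mat_deriv_def)
  show "X s * Y s \<in> carrier_mat d d" for s by (rule mult_carrier_mat[OF c(1) c(2)])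
  have m: "X' * Y t \<in> carrier_mat d d" "X t * Y' \<in> carrier_mat d d"
    using c by (auto intro: mult_carrier_mat)
  then show "X' * Y t + X t * Y' \<in> carrier_mat d d" by simp
  fix i j assume ij: "i < d" "j < d"
  have "(X' * Y t + X t * Y') $$ (i, j) = (\<Sum>k<d. X' $$ (i, k) * Y t $$ (k, j) + X t $$ (i, k) * Y' $$ (k, j))"
    using m ij c by (simp add: index_mult_square[OF c(3) c(2) ij] index_mult_square[OF c(1) c(4) ij] sum.distrib del: index_mult_mat)
  moreover have "((\<lambda>s. \<Sum>k<d. X s $$ (i, k) * Y s $$ (k, j)) has_real_derivative
      (\<Sum>k<d. X' $$ (i, k) * Y t $$ (k, j) + X t $$ (i, k) * Y' $$ (k, j))) (at t)"
  proof (rule DERIV_sum)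
    fix k assume "k \<in> {..<d}"
    then have "((\<lambda>s. X s $$ (i, k)) has_real_derivative X' $$ (i, k)) (at t)"
      "((\<lambda>s. Y s $$ (k, j)) has_real_derivative Y' $$ (k, j)) (at t)"
      using X Y ij by (auto simp: has_mat_deriv_def)
    from DERIV_mult[OF this] show "((\<lambda>s. X s $$ (i, k) * Y s $$ (k, j)) has_real_derivative
      X' $$ (i, k) * Y t $$ (k, j) + X t $$ (i, k) * Y' $$ (k, j)) (at t)"
      by (simp add: ac_simps)
  qed
  ultimately show "((\<lambda>s. (X s * Y s) $$ (i, j)) has_real_derivative (X' * Y t + X t * Y') $$ (i, j)) (at t)"
    by (simp add: index_mult_square[OF c(1) c(2) ij] del: index_mult_mat)
qed

lemma has_mat_deriv_transpose:
  assumes "has_mat_deriv d X X' t"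
  shows "has_mat_deriv d (\<lambda>s. (X s)\<^sup>T) (X'\<^sup>T) t"
  unfolding has_mat_deriv_def
proof (intro conjI allI impI)
  fix i j assume ij: "i < d" "j < d"
  have *: "(X s)\<^sup>T $$ (i, j) = X s $$ (j, i)" for s
    using assms ij unfolding has_mat_deriv_def by (metis carrier_matD index_transpose_mat(1))
  have **: "X'\<^sup>T $$ (i, j) = X' $$ (j, i)"
    using assms ij unfolding has_mat_deriv_def by (metis carrier_matD index_transpose_mat(1))
  show "((\<lambda>s. (X s)\<^sup>T $$ (i, j)) has_real_derivative X'\<^sup>T $$ (i, j)) (at t)"
    unfolding * ** using assms ij by (auto simp: has_mat_deriv_def)
qed (use assms in \<open>auto simp: has_mat_deriv_def\<close>)

text \<open>The derivative of the determinant at \<open>M\<close> in direction \<open>N\<close>,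
  left in Leibniz form. What matters below is that it is linear in \<open>N\<close>.\<close>

definition det_deriv :: "nat \<Rightarrow> real mat \<Rightarrow> real mat \<Rightarrow> real" where
  "det_deriv d M N = (\<Sum>p | p permutes {0..<d}. of_int (sign p) *
     (\<Sum>k\<in>{0..<d}. N $$ (k, p k) * (\<Prod>i\<in>{0..<d} - {k}. M $$ (i, p i))))"

lemma has_mat_deriv_det:
  assumes X: "has_mat_deriv d X X' t"
  shows "((\<lambda>s. det (X s)) has_real_derivative det_deriv d (X t) X') (at t)"
proof -
  have c: "X s \<in> carrier_mat d d" for s using X by (simp add: has_mat_deriv_def)
  have "((\<lambda>s. \<Sum>p | p permutes {0..<d}. of_int (sign p) * (\<Prod>i\<in>{0..<d}. X s $$ (i, p i))) has_real_derivative
     det_deriv d (X t) X') (at t)"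
    unfolding det_deriv_def
  proof (intro DERIV_sum DERIV_cmult has_field_derivative_prod)
    fix p k assume "p \<in> {p. p permutes {0..<d}}" "k \<in> {0..<d}"
    then show "((\<lambda>s. X s $$ (k, p k)) has_real_derivative X' $$ (k, p k)) (at t)"
      using X permutes_less[of p d k] by (auto simp: has_mat_deriv_def)
  qed
  then show ?thesis by (simp add: det_def'[OF c])
qed

text \<open>For a direction that depends linearly on \<open>J\<close>, this isolates the coefficient
  of each entry of \<open>J\<close>; a gradient independent of \<open>J\<close> can then be read
  off.\<close>

lemma det_deriv_linear:
  assumes "\<And>k l. k < d \<Longrightarrow> l < d \<Longrightarrow> N $$ (k, l) = (\<Sum>r<d. \<Sum>s<d. J $$ (r, s) * w k l r s)"
  shows "det_deriv d M N = (\<Sum>r<d. \<Sum>s<d. J $$ (r, s) * (\<Sum>p | p permutes {0..<d}. of_int (sign p) *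
     (\<Sum>k\<in>{0..<d}. w k (p k) r s * (\<Prod>i\<in>{0..<d} - {k}. M $$ (i, p i)))))"
proof -
  let ?c = "\<lambda>p k. of_int (sign p) * (\<Prod>i\<in>{0..<d} - {k}. M $$ (i, p i))"
  have "det_deriv d M N = (\<Sum>p | p permutes {0..<d}. \<Sum>k\<in>{0..<d}. \<Sum>r<d. \<Sum>s<d. J $$ (r, s) * w k (p k) r s * ?c p k)"
    unfolding det_deriv_def sum_distrib_left
  proof (intro sum.cong refl)
    fix p k assume "p \<in> {p. p permutes {0..<d}}" "k \<in> {0..<d}"
    then have "N $$ (k, p k) = (\<Sum>r<d. \<Sum>s<d. J $$ (r, s) * w k (p k) r s)"
      using permutes_less[of p d k] by (intro assms) auto
    then show "of_int (sign p) * (N $$ (k, p k) * (\<Prod>i\<in>{0..<d} - {k}. M $$ (i, p i))) =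
       (\<Sum>r<d. \<Sum>s<d. J $$ (r, s) * w k (p k) r s * ?c p k)"
      by (simp add: sum_distrib_right sum_distrib_left ac_simps)
  qed
  also have "\<dots> = (\<Sum>r<d. \<Sum>s<d. \<Sum>p | p permutes {0..<d}. \<Sum>k\<in>{0..<d}. J $$ (r, s) * w k (p k) r s * ?c p k)"
  proof -
    have swap3: "(\<Sum>x\<in>X. \<Sum>r<d. \<Sum>s<d. f x r s) = (\<Sum>r<d. \<Sum>s<d. \<Sum>x\<in>X. f x r s)"
      for X :: "'b set" and f :: "'b \<Rightarrow> nat \<Rightarrow> nat \<Rightarrow> real"
      by (subst sum.swap) (intro sum.cong refl sum.swap)
    show ?thesis unfolding swap3 ..
  qed
  also have "\<dots> = (\<Sum>r<d. \<Sum>s<d. J $$ (r, s) * (\<Sum>p | p permutes {0..<d}. of_int (sign p) *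
     (\<Sum>k\<in>{0..<d}. w k (p k) r s * (\<Prod>i\<in>{0..<d} - {k}. M $$ (i, p i)))))"
    unfolding sum_distrib_left by (intro sum.cong refl) (simp add: ac_simps)
  finally show ?thesis .
qed

lemma index_mult3:
  fixes X J Z :: "real mat"
  assumes X: "X \<in> carrier_mat d d" and J: "J \<in> carrier_mat d d" and Z: "Z \<in> carrier_mat d d" and kl: "k < d" "l < d"
  shows "(X * J * Z) $$ (k, l) = (\<Sum>r<d. \<Sum>s<d. J $$ (r, s) * (X $$ (k, r) * Z $$ (s, l)))"
proof -
  have "(X * J * Z) $$ (k, l) = (\<Sum>s<d. (\<Sum>r<d. X $$ (k, r) * J $$ (r, s)) * Z $$ (s, l))"
    using index_mult_square[OF X J kl(1)] by (subst index_mult_square[OF mult_carrier_mat[OF X J] Z kl]) simp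
  also have "\<dots> = (\<Sum>r<d. \<Sum>s<d. J $$ (r, s) * (X $$ (k, r) * Z $$ (s, l)))"
    unfolding sum_distrib_right by (subst sum.swap) (intro sum.cong refl, simp add: ac_simps)
  finally show ?thesis .
qed

text \<open>The function \<open>L\<close> of the overview, with \<open>A\<close> and
  \<open>x\<close> made explicit.\<close>

definition perm_sum :: "nat \<Rightarrow> real \<Rightarrow> real mat \<Rightarrow> real mat \<Rightarrow> real" where
  "perm_sum d x A Y = (\<Sum>P\<in>perm_mats d. gram_det d x (A + P * Y))"

lemma has_mat_deriv_cmult:
  assumes X: "has_mat_deriv d X X' t" and C: "C \<in> carrier_mat d d"
  shows "has_mat_deriv d (\<lambda>s. C * X s) (C * X') t" "has_mat_deriv d (\<lambda>s. X s * C) (X' * C) t"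
    "has_mat_deriv d (\<lambda>s. C + X s) X' t"
proof -
  have c: "X' \<in> carrier_mat d d" "X t \<in> carrier_mat d d" using X by (auto simp: has_mat_deriv_def)
  have m: "C * X' \<in> carrier_mat d d" "X' * C \<in> carrier_mat d d" using c C by auto
  show "has_mat_deriv d (\<lambda>s. C * X s) (C * X') t"
    using has_mat_deriv_mult[OF has_mat_deriv_const[OF C] X] left_mult_zero_mat[OF c(2)] left_add_zero_mat[OF m(1)] by simp
  show "has_mat_deriv d (\<lambda>s. X s * C) (X' * C) t"
    using has_mat_deriv_mult[OF X has_mat_deriv_const[OF C]] right_mult_zero_mat[OF c(2)] right_add_zero_mat[OF m(2)] by simp
  show "has_mat_deriv d (\<lambda>s. C + X s) X' t"
    using has_mat_deriv_add[OF has_mat_deriv_const[OF C] X] left_add_zero_mat[OF c(1)] by simp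
qed

text \<open>The gradient of \<open>perm_sum\<close> at \<open>Y\<close> for infinitesimal left
  multiplication: entry \<open>r\<close>, \<open>s\<close> is the coefficient of
  \<open>J $$ (r, s)\<close> in the derivative in direction \<open>J * Y\<close>. The two products
  come from differentiating the two factors of \<open>N * N\<^sup>T\<close>.\<close>

definition tangent :: "nat \<Rightarrow> real \<Rightarrow> real mat \<Rightarrow> real mat \<Rightarrow> nat \<Rightarrow> nat \<Rightarrow> real" where
  "tangent d x A Y r s = (\<Sum>P\<in>perm_mats d. let N = A + P * Y in
     (\<Sum>p | p permutes {0..<d}. of_int (sign p) *
       (\<Sum>k\<in>{0..<d}. - (P $$ (k, r) * (Y * N\<^sup>T) $$ (s, p k) + P $$ (p k, r) * (Y * N\<^sup>T) $$ (s, k)) *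
          (\<Prod>i\<in>{0..<d} - {k}. (x \<cdot>\<^sub>m 1\<^sub>m d - N * N\<^sup>T) $$ (i, p i)))))"

text \<open>With the velocity written as \<open>J * H t\<close>, the derivative at time
  \<open>t\<close> is the gradient at the current point \<open>H t * Y\<close> paired with
  \<open>J\<close>.\<close>

lemma perm_sum_deriv:
  assumes A: "A \<in> carrier_mat d d" and Y: "Y \<in> carrier_mat d d" and J: "J \<in> carrier_mat d d"
    and H: "has_mat_deriv d H (J * H t) t"
  shows "((\<lambda>s. perm_sum d x A (H s * Y)) has_real_derivative
    (\<Sum>r<d. \<Sum>s<d. J $$ (r, s) * tangent d x A (H t * Y) r s)) (at t)"
proof -
  have Hc: "H s \<in> carrier_mat d d" for s using H by (simp add: has_mat_deriv_def)
  let ?Y = "H t * Y"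
  have Yc: "?Y \<in> carrier_mat d d" by (rule mult_carrier_mat[OF Hc Y])
  let ?N = "\<lambda>P s. A + P * (H s * Y)"
  let ?w = "\<lambda>P k l r s. - (P $$ (k, r) * (?Y * (?N P t)\<^sup>T) $$ (s, l) + P $$ (l, r) * (?Y * (?N P t)\<^sup>T) $$ (s, k))"
  let ?T = "\<lambda>P r s. \<Sum>p | p permutes {0..<d}. of_int (sign p) *
       (\<Sum>k\<in>{0..<d}. ?w P k (p k) r s * (\<Prod>i\<in>{0..<d} - {k}. (x \<cdot>\<^sub>m 1\<^sub>m d - ?N P t * (?N P t)\<^sup>T) $$ (i, p i)))"
  have single: "((\<lambda>s. gram_det d x (?N P s)) has_real_derivative (\<Sum>r<d. \<Sum>s<d. J $$ (r, s) * ?T P r s)) (at t)"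
    if P: "P \<in> perm_mats d" for P
  proof -
    have Pc: "P \<in> carrier_mat d d" by (rule perm_mats_carrier[OF P])
    have Nc: "?N P s \<in> carrier_mat d d" for s using A Pc Hc Y by (auto intro!: mult_carrier_mat)
    let ?N' = "P * (J * H t * Y)"
    have N: "has_mat_deriv d (?N P) ?N' t"
      by (intro has_mat_deriv_cmult H A Y Pc)
    have N'c: "?N' \<in> carrier_mat d d" using Pc J Hc Y by (auto intro!: mult_carrier_mat)
    let ?X' = "- (?N' * (?N P t)\<^sup>T + ?N P t * ?N'\<^sup>T)"
    have "has_mat_deriv d (\<lambda>s. x \<cdot>\<^sub>m 1\<^sub>m d + - (?N P s * (?N P s)\<^sup>T)) ?X' t"
      by (intro has_mat_deriv_cmult(3) has_mat_deriv_uminus has_mat_deriv_mult N has_mat_deriv_transpose) simp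
    moreover have "x \<cdot>\<^sub>m 1\<^sub>m d + - (?N P s * (?N P s)\<^sup>T) = x \<cdot>\<^sub>m 1\<^sub>m d - ?N P s * (?N P s)\<^sup>T" for s
      using Nc[of s] by (intro eq_matI) auto
    ultimately have "((\<lambda>s. gram_det d x (?N P s)) has_real_derivative
        det_deriv d (x \<cdot>\<^sub>m 1\<^sub>m d - ?N P t * (?N P t)\<^sup>T) ?X') (at t)"
      unfolding gram_det_def using has_mat_deriv_det[of d "\<lambda>s. x \<cdot>\<^sub>m 1\<^sub>m d - ?N P s * (?N P s)\<^sup>T" ?X' t] by simp
    also have "det_deriv d (x \<cdot>\<^sub>m 1\<^sub>m d - ?N P t * (?N P t)\<^sup>T) ?X' = (\<Sum>r<d. \<Sum>s<d. J $$ (r, s) * ?T P r s)"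
    proof (rule det_deriv_linear)
      fix k l assume kl: "k < d" "l < d"
      have YNc: "?Y * (?N P t)\<^sup>T \<in> carrier_mat d d" by (rule mult_carrier_mat[OF Yc]) (use Nc in simp)
      have eq: "?N' * (?N P t)\<^sup>T = P * J * (?Y * (?N P t)\<^sup>T)"
        using Pc J Hc[of t] Y Nc[of t] by (simp add: square_mat_simps[where d = d])
      have c1: "?N' * (?N P t)\<^sup>T \<in> carrier_mat d d" by (rule mult_carrier_mat[OF N'c]) (use Nc in simp)
      have "?N P t * ?N'\<^sup>T = (?N' * (?N P t)\<^sup>T)\<^sup>T"
        using N'c Nc[of t] by (subst transpose_mult[of _ d d _ d]) auto
      then have "?X' $$ (k, l) = - ((?N' * (?N P t)\<^sup>T) $$ (k, l) + (?N' * (?N P t)\<^sup>T) $$ (l, k))"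
        using c1 kl by (simp del: index_mult_mat)
      also have "\<dots> = (\<Sum>r<d. \<Sum>s<d. J $$ (r, s) * ?w P k l r s)"
        unfolding eq index_mult3[OF Pc J YNc kl] index_mult3[OF Pc J YNc kl(2,1)]
        by (simp add: sum_negf sum.distrib sum_subtractf algebra_simps)
      finally show "?X' $$ (k, l) = (\<Sum>r<d. \<Sum>s<d. J $$ (r, s) * ?w P k l r s)" .
    qed
    finally show ?thesis .
  qed
  have "((\<lambda>s. perm_sum d x A (H s * Y)) has_real_derivative
     (\<Sum>P\<in>perm_mats d. \<Sum>r<d. \<Sum>s<d. J $$ (r, s) * ?T P r s)) (at t)"
    unfolding perm_sum_def by (intro DERIV_sum single)
  also have "(\<Sum>P\<in>perm_mats d. \<Sum>r<d. \<Sum>s<d. J $$ (r, s) * ?T P r s) =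
      (\<Sum>r<d. \<Sum>s<d. \<Sum>P\<in>perm_mats d. J $$ (r, s) * ?T P r s)"
    by (subst sum.swap) (intro sum.cong refl sum.swap)
  also have "\<dots> = (\<Sum>r<d. \<Sum>s<d. J $$ (r, s) * tangent d x A ?Y r s)"
    unfolding tangent_def Let_def sum_distrib_left[of "J $$ _"] ..
  finally show ?thesis .
qed

section \<open>Rotations of three coordinates\<close>

definition block3 :: "nat \<Rightarrow> (nat \<Rightarrow> nat \<Rightarrow> 'a :: comm_ring_1) \<Rightarrow> 'a mat" where
  "block3 d f = mat d d (\<lambda>(i, j). if i < 3 \<and> j < 3 then f i j else if i = j then 1 else 0)"

lemma block3_carrier [simp]: "block3 d f \<in> carrier_mat d d"
  by (simp add: block3_def)

lemma block3_mult:
  assumes "3 \<le> d"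
  shows "block3 d f * block3 d g = block3 d (\<lambda>i j. \<Sum>k<3. f i k * g k j)"
proof (rule eq_matI)
  fix i j assume "i < dim_row (block3 d (\<lambda>i j. \<Sum>k<3. f i k * g k j))" "j < dim_col (block3 d (\<lambda>i j. \<Sum>k<3. f i k * g k j))"
  then have ij: "i < d" "j < d" by (auto simp: block3_def)
  let ?G = "\<lambda>k j. if k < 3 \<and> j < 3 then g k j else if k = j then 1 else 0"
  have *: "(block3 d f * block3 d g) $$ (i, j) = (\<Sum>k<d. (if i < 3 \<and> k < 3 then f i k else if i = k then 1 else 0) * ?G k j)"
    using ij by (simp add: block3_def scalar_prod_def atLeast0LessThan)
  show "(block3 d f * block3 d g) $$ (i, j) = block3 d (\<lambda>i j. \<Sum>k<3. f i k * g k j) $$ (i, j)"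
  proof (cases "i < 3")
    case True
    have "(block3 d f * block3 d g) $$ (i, j) = (\<Sum>k<3. f i k * ?G k j)"
      unfolding * using True assms by (intro sum.mono_neutral_cong_right) auto
    also have "\<dots> = (if j < 3 then \<Sum>k<3. f i k * g k j else 0)"
      by (auto intro!: sum.neutral)
    finally show ?thesis using True ij by (auto simp: block3_def)
  next
    case False
    have "(block3 d f * block3 d g) $$ (i, j) = (\<Sum>k<d. if k = i then ?G i j else 0)"
      unfolding * using False by (intro sum.cong) auto
    then show ?thesis using False ij by (auto simp: block3_def)
  qed
qed (auto simp: block3_def)

lemma block3_cong: "(\<And>i j. i < 3 \<Longrightarrow> j < 3 \<Longrightarrow> f i j = g i j) \<Longrightarrow> block3 d f = block3 d g"
  by (auto simp: block3_def)

lemma less_3_cases: "(i :: nat) < 3 \<Longrightarrow> i = 0 \<or> i = 1 \<or> i = 2"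
  by linarith

lemma sum_less_3: "(\<Sum>k<3. f k) = f 0 + f 1 + f (2 :: nat)"
  by (simp add: numeral_3_eq_3 numeral_2_eq_2)

text \<open>Rodrigues' formula for the axis (1, 1, 1) divided by \<open>sqrt 3\<close>. The sense is
  such that the angle \<open>2 * pi / 3\<close> gives the permutation matrix that sends coordinate 0
  to 2, 2 to 1 and 1 to 0.\<close>

definition rot3 :: "real \<Rightarrow> nat \<Rightarrow> nat \<Rightarrow> real" where
  "rot3 \<theta> i j = (if i = j then (1 + 2 * cos \<theta>) / 3
     else if (i, j) \<in> {(1, 0), (2, 1), (0, 2)} then (1 - cos \<theta> - sqrt 3 * sin \<theta>) / 3
     else (1 - cos \<theta> + sqrt 3 * sin \<theta>) / 3)"

text \<open>A rotation about (1, 1, 1) is a circulant matrix, so the discrete Fourier matrix of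
  order 3 diagonalises it: \<open>w\<close> is a primitive cube root of unity, \<open>e i j\<close>
  is its power with exponent \<open>i * j\<close>, and the inverse is the conjugate divided by
  3.\<close>

lemma rot3_diagonalization:
  assumes d: "3 \<le> d"
  obtains E E' :: "complex mat" where "E \<in> carrier_mat d d" "E' \<in> carrier_mat d d" "E * E' = 1\<^sub>m d"
    "\<And>\<theta>. map_mat of_real (block3 d (rot3 \<theta>)) = E * (torus_mat d 1 2 \<theta> * E')"
proof -
  define w where "w = Complex (- 1 / 2) (sqrt 3 / 2)"
  define e where "e i j = (if i = 0 \<or> j = 0 then 1 else if i = j then w else cnj w)" for i j :: nat
  let ?E = "block3 d e" and ?E' = "block3 d (\<lambda>i j. cnj (e i j) / 3)"
  have s3: "sqrt 3 * sqrt 3 = 3" by simp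
  have one: "1\<^sub>m d = block3 d (\<lambda>i j. if i = j then 1 else 0 :: complex)"
    by (auto simp: block3_def)
  have "?E * ?E' = 1\<^sub>m d"
    unfolding block3_mult[OF d] one
  proof (rule block3_cong)
    fix i j :: nat assume "i < 3" "j < 3"
    then show "(\<Sum>k<3. e i k * (cnj (e k j) / 3)) = (if i = j then 1 else 0)"
      unfolding sum_less_3
      by (elim less_3_cases[THEN disjE] disjE) (auto dest!: less_3_cases simp: e_def w_def complex_eq_iff field_simps)
  qed
  moreover have "map_mat of_real (block3 d (rot3 \<theta>)) = ?E * (torus_mat d 1 2 \<theta> * ?E')" for \<theta>
  proof -
    have T: "torus_mat d 1 2 \<theta> = block3 d (\<lambda>i j. if i = j then
       (if i = 1 then cis \<theta> else if i = 2 then cis (- \<theta>) else 1) else 0)"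
      using d by (auto simp: torus_mat_def block3_def)
    have "map_mat of_real (block3 d (rot3 \<theta>)) = block3 d (\<lambda>i j. of_real (rot3 \<theta> i j))"
      by (auto simp: block3_def)
    also have "\<dots> = ?E * (torus_mat d 1 2 \<theta> * ?E')"
      unfolding T block3_mult[OF d]
    proof (rule block3_cong)
      fix i j :: nat assume "i < 3" "j < 3"
      then show "complex_of_real (rot3 \<theta> i j) = (\<Sum>k<3. e i k * (\<Sum>l<3.
        (if k = l then (if k = 1 then cis \<theta> else if k = 2 then cis (- \<theta>) else 1) else 0) * (cnj (e l j) / 3)))"
        unfolding sum_less_3
        by (elim less_3_cases[THEN disjE] disjE) (auto dest!: less_3_cases simp: e_def w_def rot3_def complex_eq_iff field_simps)
    qed
    finally show ?thesis .
  qed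
  ultimately show ?thesis by (intro that[of ?E ?E']) auto
qed

lemma perm_sum_rot3:
  assumes d: "3 \<le> d" and A: "A \<in> carrier_mat d d" and Y: "Y \<in> carrier_mat d d"
  shows "perm_sum d x A (block3 d (rot3 \<theta>) * Y) = perm_sum d x A (block3 d (rot3 0) * Y)"
proof -
  let ?R = "\<lambda>\<theta>. block3 d (rot3 \<theta>)"
  let ?g = "\<lambda>\<theta>. complex_of_real (perm_sum d x A (?R \<theta> * Y))"
  obtain E E' :: "complex mat" where E: "E \<in> carrier_mat d d" "E' \<in> carrier_mat d d" "E * E' = 1\<^sub>m d"
    "\<And>\<theta>. map_mat of_real (?R \<theta>) = E * (torus_mat d 1 2 \<theta> * E')"
    using rot3_diagonalization[OF d] by blast
  have Rt: "(?R \<theta>)\<^sup>T = ?R (- \<theta>)" for \<theta>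
    by (intro eq_matI) (auto simp: block3_def rot3_def)
  have "laurent 2 2 (\<lambda>\<theta>. of_real (gram_det d x (A + P * (?R \<theta> * Y))))" if P: "P \<in> perm_mats d" for P
  proof -
    have Pc: "P \<in> orth_group d" by (rule perm_mats_orth[OF P])
    note c = orth_group_cancel[OF Pc]
    have Rc: "?R \<theta> * Y \<in> carrier_mat d d" for \<theta> using Y by (intro mult_carrier_mat) auto
    have PA: "P\<^sup>T * A \<in> carrier_mat d d" using c A by (intro mult_carrier_mat) auto
    \<comment> \<open>Pulling out \<open>P\<close> leaves the rotation as the leftmost factor beside
      a constant matrix, the form in which its frequencies are bounded.\<close>
    have "A + P * (?R \<theta> * Y) = P * (P\<^sup>T * A + ?R \<theta> * Y)" for \<theta>
      using c(1,2,6) A Rc PA by (simp add: mult_add_distrib_mat[of _ d d _ d])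
    then have "gram_det d x (A + P * (?R \<theta> * Y)) = gram_det d x (P\<^sup>T * A + ?R \<theta> * Y)" for \<theta>
      using gram_det_orth_left[OF Pc, of "P\<^sup>T * A + ?R \<theta> * Y" x] Rc PA by simp
    then show ?thesis
      using laurent_gram_det[OF _ _ _ PA Y E(1-3) _ Rt E(4), of x] d by simp
  qed
  then have "laurent 2 2 ?g"
    unfolding perm_sum_def of_real_sum by (intro laurent_sum)
  moreover have "?g (2 * pi / 3 + \<theta>) = ?g \<theta>" for \<theta>
  proof -
    let ?c = "\<lambda>i :: nat. if i = 0 then 2 else if i = 1 then 0 else if i = 2 then 1 else i"
    let ?ci = "\<lambda>i :: nat. if i = 0 then 1 else if i = 1 then 2 else if i = 2 then 0 else i"
    have "bij_betw ?c {..<d} {..<d}"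
      using d by (intro bij_betw_byWitness[where f' = ?ci]) auto
    then have "?c permutes {..<d}" by (rule bij_imp_permutes) (use d in auto)
    then have C: "perm_mat d ?c \<in> perm_mats d" by (simp add: perm_mats_eq)
    have Cb: "perm_mat d ?c = block3 d (\<lambda>i j. if i = ?c j then 1 else 0)"
      using d by (auto simp: perm_mat_def block3_def)
    define \<phi> where "\<phi> = 2 * pi / 3 + \<theta>"
    have tr: "cos \<phi> = - cos \<theta> / 2 - sqrt 3 * sin \<theta> / 2"
      "sin \<phi> = sqrt 3 * cos \<theta> / 2 - sin \<theta> / 2"
      by (simp_all add: \<phi>_def cos_add sin_add cos_120 sin_120)
    have "?R \<phi> = perm_mat d ?c * ?R \<theta>"
      unfolding Cb block3_mult[OF d]
    proof (rule block3_cong)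
      fix i j :: nat assume "i < 3" "j < 3"
      then show "rot3 \<phi> i j = (\<Sum>k<3. (if i = ?c k then 1 else 0) * rot3 \<theta> k j)"
        unfolding sum_less_3
        by (elim less_3_cases[THEN disjE] disjE) (auto dest!: less_3_cases simp: rot3_def tr field_simps)
    qed
    then have "?R \<phi> * Y = perm_mat d ?c * (?R \<theta> * Y)"
      using Y perm_mats_carrier[OF C] by (simp add: assoc_mult_mat[of _ d d _ d _ d])
    then have "perm_sum d x A (?R \<phi> * Y) = (\<Sum>P\<in>perm_mats d. gram_det d x (A + P * perm_mat d ?c * (?R \<theta> * Y)))"
      unfolding perm_sum_def using Y perm_mats_carrier[OF C] perm_mats_carrier
      by (intro sum.cong) (auto simp: assoc_mult_mat[of _ d d _ d _ d] mult_carrier_mat[of _ d d _ d])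
    also have "\<dots> = perm_sum d x A (?R \<theta> * Y)"
      unfolding perm_sum_def by (rule sum_perm_mats_mult[OF C])
    finally show ?thesis by (simp add: \<phi>_def)
  qed
  ultimately have "?g \<theta> = ?g 0" by (rule laurent_periodic_const)
  then show ?thesis by (simp only: of_real_eq_iff)
qed


section \<open>Stationarity of the permutation sum\<close>

text \<open>The constancy under \<open>rot3\<close>, differentiated at angle 0 and carried from
  coordinates 0, 1, 2 to \<open>i\<close>, \<open>j\<close>, \<open>k\<close> by a permutation
  matrix. The generator has opposite values on the two cyclic orientations, hence the two cyclic
  sums.\<close>

lemma tangent_cycle:
  assumes A: "A \<in> carrier_mat d d" and Y: "Y \<in> carrier_mat d d"
    and ijk: "i < d" "j < d" "k < d" "i \<noteq> j" "j \<noteq> k" "i \<noteq> k"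
  shows "tangent d x A Y i j + tangent d x A Y j k + tangent d x A Y k i =
    tangent d x A Y j i + tangent d x A Y k j + tangent d x A Y i k"
proof -
  have d: "3 \<le> d"
  proof -
    have "card {i, j, k} \<le> card {..<d}" using ijk by (intro card_mono) auto
    then show ?thesis using ijk by simp
  qed
  let ?T = "tangent d x A Y"
  obtain \<sigma> where \<sigma>: "\<sigma> permutes {..<d}" "\<sigma> 0 = i" "\<sigma> 1 = j" "\<sigma> 2 = k"
  proof -
    let ?f = "\<lambda>n :: nat. if n = 0 then i else if n = 1 then j else k"
    have f: "bij_betw ?f {..<3} {i, j, k}"
    proof -
      have "{..<3 :: nat} = {0, 1, 2}" by auto
      then show ?thesis using ijk by (auto simp: bij_betw_def)
    qed
    have "card ({..<d} - {..<3}) = card ({..<d} - {i, j, k})" using ijk d by (simp add: card_Diff_subset)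
    then obtain g where g: "bij_betw g ({..<d} - {..<3}) ({..<d} - {i, j, k})"
      using finite_same_card_bij[of "{..<d} - {..<3}" "{..<d} - {i, j, k}"] by auto
    define \<sigma> where "\<sigma> n = (if n < 3 then ?f n else if n < d then g n else n)" for n
    have "bij_betw \<sigma> {..<3} {i, j, k}" using f by (rule bij_betw_cong[THEN iffD1, rotated]) (auto simp: \<sigma>_def)
    moreover have "bij_betw \<sigma> ({..<d} - {..<3}) ({..<d} - {i, j, k})"
      using g by (rule bij_betw_cong[THEN iffD1, rotated]) (auto simp: \<sigma>_def)
    ultimately have "bij_betw \<sigma> ({..<3} \<union> ({..<d} - {..<3})) ({i, j, k} \<union> ({..<d} - {i, j, k}))"
      by (rule bij_betw_combine) auto
    moreover have "{..<3} \<union> ({..<d} - {..<3}) = {..<d}" "{i, j, k} \<union> ({..<d} - {i, j, k}) = {..<d}"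
      using d ijk by auto
    ultimately have "\<sigma> permutes {..<d}" by (intro bij_imp_permutes) (use d in \<open>auto simp: \<sigma>_def\<close>)
    then show ?thesis by (rule that) (auto simp: \<sigma>_def)
  qed
  let ?P = "perm_mat d \<sigma>"
  have P: "?P \<in> perm_mats d" using \<sigma> by (simp add: perm_mats_eq)
  note c = orth_group_cancel[OF perm_mats_orth[OF P]]
  have \<sigma>d: "\<sigma> r < d" if "r < d" for r using permutes_in_image[OF \<sigma>(1), of r] that by simp
  have \<sigma>inj: "\<sigma> r = \<sigma> s \<longleftrightarrow> r = s" for r s using permutes_inj[OF \<sigma>(1)] by (auto dest: injD)
  have conj: "(?P * X * ?P\<^sup>T) $$ (\<sigma> r, \<sigma> s) = X $$ (r, s)"
    if X: "X \<in> carrier_mat d d" and rs: "r < d" "s < d" for X r s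
  proof -
    have "(?P * X * ?P\<^sup>T) $$ (\<sigma> r, \<sigma> s) = (\<Sum>r'<d. \<Sum>s'<d. X $$ (r', s') * ((if r' = r then 1 else 0) * (if s' = s then 1 else 0)))"
    proof -
      have "?P $$ (\<sigma> r, r') = (if r' = r then 1 else 0)" if "r' < d" for r'
        using that \<sigma>d[OF rs(1)] by (auto simp: perm_mat_def \<sigma>inj)
      moreover have "?P\<^sup>T $$ (s', \<sigma> s) = (if s' = s then 1 else 0)" if "s' < d" for s'
        using that \<sigma>d[OF rs(2)] by (auto simp: perm_mat_def \<sigma>inj)
      ultimately show ?thesis
        unfolding index_mult3[OF c(1) X c(2) \<sigma>d[OF rs(1)] \<sigma>d[OF rs(2)]]
        by (intro sum.cong refl) (simp only: lessThan_iff)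
    qed
    also have "\<dots> = (\<Sum>r'<d. if r' = r then X $$ (r, s) else 0)"
    proof (rule sum.cong[OF refl])
      fix r'
      have "(\<Sum>s'<d. X $$ (r', s') * ((if r' = r then 1 else 0) * (if s' = s then 1 else 0))) =
        (\<Sum>s'<d. if s' = s then (if r' = r then X $$ (r, s) else 0) else 0)"
        by (intro sum.cong) auto
      then show "(\<Sum>s'<d. X $$ (r', s') * ((if r' = r then 1 else 0) * (if s' = s then 1 else 0))) =
        (if r' = r then X $$ (r, s) else 0)" using rs by simp
    qed
    finally show ?thesis using rs by simp
  qed
  \<comment> \<open>The derivative of the rotation at angle 0; \<open>sqrt 3 / 3\<close> is each
    coordinate of the unit vector on the axis.\<close>
  let ?D = "mat d d (\<lambda>(r, s). if r < 3 \<and> s < 3 then (if r = s then 0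
     else if (r, s) \<in> {(1, 0), (2, 1), (0, 2)} then - sqrt 3 / 3 else sqrt 3 / 3) else 0)"
  let ?H = "\<lambda>\<theta>. ?P * block3 d (rot3 \<theta>) * ?P\<^sup>T"
  let ?J = "?P * ?D * ?P\<^sup>T"
  have D: "?D \<in> carrier_mat d d" by simp
  have R0: "block3 d (rot3 0) = 1\<^sub>m d" by (auto simp: block3_def rot3_def)
  have H0: "?H 0 = 1\<^sub>m d" using c by (simp add: R0)
  have Jc: "?J \<in> carrier_mat d d" using c D by (intro mult_carrier_mat) auto
  have "has_mat_deriv d (\<lambda>\<theta>. block3 d (rot3 \<theta>)) ?D 0"
    unfolding has_mat_deriv_def
  proof (intro conjI allI impI)
    fix r s assume rs: "r < d" "s < d"
    have "((\<lambda>\<theta>. if r < 3 \<and> s < 3 then rot3 \<theta> r s else if r = s then 1 else 0) has_real_derivative ?D $$ (r, s)) (at 0)"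
      using rs unfolding rot3_def by (auto intro!: derivative_eq_intros)
    then show "((\<lambda>\<theta>. block3 d (rot3 \<theta>) $$ (r, s)) has_real_derivative ?D $$ (r, s)) (at 0)"
      using rs by (simp add: block3_def)
  qed simp_all
  then have "has_mat_deriv d ?H ?J 0"
    by (intro has_mat_deriv_cmult c)
  then have "has_mat_deriv d ?H (?J * ?H 0) 0"
    using right_mult_one_mat[OF Jc] by (simp add: H0)
  then have "((\<lambda>\<theta>. perm_sum d x A (?H \<theta> * Y)) has_real_derivative
    (\<Sum>r<d. \<Sum>s<d. ?J $$ (r, s) * ?T r s)) (at 0)"
    using perm_sum_deriv[OF A Y Jc, of ?H 0 x] left_mult_one_mat[OF Y] by (simp add: H0)
  moreover
  have "perm_sum d x A (?H \<theta> * Y) = perm_sum d x A (?H 0 * Y)" for \<theta>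
  proof -
    let ?Y = "?P\<^sup>T * Y"
    have Yc: "?Y \<in> carrier_mat d d" using c Y by (intro mult_carrier_mat) auto
    have "perm_sum d x A (?H \<theta> * Y) = perm_sum d x A (block3 d (rot3 \<theta>) * ?Y)" for \<theta>
    proof -
      have "perm_sum d x A (?H \<theta> * Y) = (\<Sum>Q\<in>perm_mats d. gram_det d x (A + Q * ?P * (block3 d (rot3 \<theta>) * ?Y)))"
        unfolding perm_sum_def using c Y perm_mats_carrier
        by (intro sum.cong) (auto simp: assoc_mult_mat[of _ d d _ d _ d] mult_carrier_mat[of _ d d _ d])
      then show ?thesis
        unfolding perm_sum_def
        using sum_perm_mats_mult[OF P, of "\<lambda>Q. gram_det d x (A + Q * (block3 d (rot3 \<theta>) * ?Y))"]
        by (simp only:)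
    qed
    then show ?thesis using perm_sum_rot3[OF d A Yc, of x \<theta>] by simp
  qed
  then have "(\<lambda>\<theta>. perm_sum d x A (?H \<theta> * Y)) = (\<lambda>_. perm_sum d x A (?H 0 * Y))" by (rule ext)
  then have "((\<lambda>\<theta>. perm_sum d x A (?H \<theta> * Y)) has_real_derivative 0) (at 0)"
    by (rule ssubst) (rule DERIV_const)
  ultimately have "0 = (\<Sum>r<d. \<Sum>s<d. ?J $$ (r, s) * ?T r s)" by (rule DERIV_unique[rotated])
  also have "\<dots> = (\<Sum>r<d. \<Sum>s<d. ?J $$ (\<sigma> r, \<sigma> s) * ?T (\<sigma> r) (\<sigma> s))"
    using sum.permute[OF \<sigma>(1), of "\<lambda>r. \<Sum>s<d. ?J $$ (r, s) * ?T r s"]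
      sum.permute[OF \<sigma>(1), of "\<lambda>s. ?J $$ (\<sigma> _, s) * ?T (\<sigma> _) s"] by (simp add: comp_def)
  also have "\<dots> = (\<Sum>r<d. \<Sum>s<d. ?D $$ (r, s) * ?T (\<sigma> r) (\<sigma> s))"
    by (intro sum.cong refl) (simp only: conj[OF D] lessThan_iff)
  also have "\<dots> = (\<Sum>r<3. \<Sum>s<3. ?D $$ (r, s) * ?T (\<sigma> r) (\<sigma> s))"
  proof -
    have "(\<Sum>s<d. ?D $$ (r, s) * ?T (\<sigma> r) (\<sigma> s)) = (\<Sum>s<3. ?D $$ (r, s) * ?T (\<sigma> r) (\<sigma> s))" if "r < d" for r
      using d that by (intro sum.mono_neutral_right) auto
    moreover have "(\<Sum>r<d. \<Sum>s<3. ?D $$ (r, s) * ?T (\<sigma> r) (\<sigma> s)) = (\<Sum>r<3. \<Sum>s<3. ?D $$ (r, s) * ?T (\<sigma> r) (\<sigma> s))"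
      using d by (intro sum.mono_neutral_right) (auto intro!: sum.neutral)
    ultimately show ?thesis by simp
  qed
  also have "\<dots> = sqrt 3 / 3 * (?T i j + ?T j k + ?T k i - (?T j i + ?T k j + ?T i k))"
    unfolding sum_less_3 using d \<sigma> by (simp add: field_simps)
  finally show ?thesis by simp
qed

text \<open>
  The matrices \<open>(e\<^sub>i - e\<^sub>0) \<and> (e\<^sub>j - e\<^sub>0)\<close> span the skew matrices that annihilate the all-ones vector.
\<close>

lemma tangent_skew:
  assumes A: "A \<in> carrier_mat d d" and Y: "Y \<in> carrier_mat d d"
    and skew: "\<And>r s. r < d \<Longrightarrow> s < d \<Longrightarrow> J r s = - J s r"
    and rows: "\<And>r. r < d \<Longrightarrow> (\<Sum>s<d. J r s) = 0"
  shows "(\<Sum>r<d. \<Sum>s<d. J r s * tangent d x A Y r s) = 0"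
proof (cases "d = 0")
  case False
  then have d: "0 < d" by simp
  let ?T = "tangent d x A Y"
  let ?a = "\<lambda>r s. ?T r s - ?T s r"
  \<comment> \<open>The cyclic identity is a cocycle condition for the antisymmetrised gradient,
    which is therefore a function of \<open>r\<close> plus a function of \<open>s\<close>. Paired
    with \<open>J\<close>, these meet only row sums and column sums, all of them zero.\<close>
  have cyc: "?a r s = ?a r 0 + ?a 0 s" if "r < d" "s < d" for r s
  proof (cases "r = s \<or> r = 0 \<or> s = 0")
    case False
    then show ?thesis using tangent_cycle[OF A Y that d, of x] by auto
  qed auto
  have cols: "(\<Sum>r<d. J r s) = 0" if "s < d" for s
  proof -
    have "(\<Sum>r<d. J r s) = - (\<Sum>r<d. J s r)" unfolding sum_negf[symmetric] using that by (intro sum.cong refl skew) auto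
    then show ?thesis using rows[OF that] by simp
  qed
  have "2 * (\<Sum>r<d. \<Sum>s<d. J r s * ?T r s) = (\<Sum>r<d. \<Sum>s<d. J r s * ?T r s) + (\<Sum>s<d. \<Sum>r<d. J r s * ?T r s)"
    using sum.swap[of "\<lambda>r s. J r s * ?T r s" "{..<d}" "{..<d}"] by simp
  also have "(\<Sum>s<d. \<Sum>r<d. J r s * ?T r s) = (\<Sum>r<d. \<Sum>s<d. - (J r s * ?T s r))"
  proof (intro sum.cong refl)
    fix s r assume "s \<in> {..<d}" "r \<in> {..<d}"
    then show "J r s * ?T r s = - (J s r * ?T r s)" using skew[of r s] by simp
  qed
  also have "(\<Sum>r<d. \<Sum>s<d. J r s * ?T r s) + (\<Sum>r<d. \<Sum>s<d. - (J r s * ?T s r)) = (\<Sum>r<d. \<Sum>s<d. J r s * ?a r s)"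
    by (simp add: sum.distrib[symmetric] algebra_simps)
  also have "\<dots> = (\<Sum>r<d. \<Sum>s<d. J r s * ?a r 0 + J r s * ?a 0 s)"
    by (intro sum.cong refl) (subst cyc, simp_all add: distrib_left)
  also have "\<dots> = (\<Sum>r<d. (\<Sum>s<d. J r s) * ?a r 0) + (\<Sum>s<d. (\<Sum>r<d. J r s) * ?a 0 s)"
    by (simp only: sum.distrib sum_distrib_right[symmetric] sum.swap[of "\<lambda>r s. J r s * ?a 0 s"])
  also have "\<dots> = 0" by (simp add: rows cols)
  finally show ?thesis by simp
qed simp

text \<open>Orthogonality makes the logarithmic derivative \<open>H' t * (H t)\<^sup>T\<close> skew,
  and constant row and column sums make it annihilate the all-ones vector. The derivative of the
  permutation sum then vanishes at every time.\<close>

lemma perm_sum_path: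
  assumes A: "A \<in> carrier_mat d d" and Y: "Y \<in> carrier_mat d d"
    and H: "\<And>t. has_mat_deriv d H (H' t) t" and orth: "\<And>t. H t \<in> orth_group d"
    and rows: "\<And>t r. r < d \<Longrightarrow> (\<Sum>s<d. H t $$ (r, s)) = 1"
    and cols: "\<And>t s. s < d \<Longrightarrow> (\<Sum>r<d. H t $$ (r, s)) = 1"
  shows "perm_sum d x A (H t * Y) = perm_sum d x A (H u * Y)"
proof -
  have "((\<lambda>s. perm_sum d x A (H s * Y)) has_real_derivative 0) (at t)" for t
  proof -
    note c = orth_group_cancel[OF orth[of t]]
    have H'c: "H' t \<in> carrier_mat d d" using H by (simp add: has_mat_deriv_def)
    let ?J = "H' t * (H t)\<^sup>T"
    have J: "?J \<in> carrier_mat d d" using H'c c by (intro mult_carrier_mat) auto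
    have "?J * H t = H' t" using H'c c by (simp add: assoc_mult_mat[of _ d d _ d _ d])
    then have der: "((\<lambda>s. perm_sum d x A (H s * Y)) has_real_derivative
       (\<Sum>r<d. \<Sum>s<d. ?J $$ (r, s) * tangent d x A (H t * Y) r s)) (at t)"
      using H by (intro perm_sum_deriv[OF A Y J]) simp
    have "(\<Sum>r<d. \<Sum>s<d. ?J $$ (r, s) * tangent d x A (H t * Y) r s) = 0"
    proof (rule tangent_skew[OF A mult_carrier_mat[OF c(1) Y]])
      fix r s assume rs: "r < d" "s < d"
      have "has_mat_deriv d (\<lambda>s. H s * (H s)\<^sup>T) (?J + H t * (H' t)\<^sup>T) t"
        by (intro has_mat_deriv_mult has_mat_deriv_transpose H)
      then have "((\<lambda>u. (H u * (H u)\<^sup>T) $$ (r, s)) has_real_derivative (?J + H t * (H' t)\<^sup>T) $$ (r, s)) (at t)"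
        using rs unfolding has_mat_deriv_def by blast
      moreover have "H u * (H u)\<^sup>T = 1\<^sub>m d" for u using orth_group_cancel[OF orth[of u]] by simp
      ultimately have "((\<lambda>u. 1\<^sub>m d $$ (r, s)) has_real_derivative (?J + H t * (H' t)\<^sup>T) $$ (r, s)) (at t)"
        by simp
      then have "(?J + H t * (H' t)\<^sup>T) $$ (r, s) = 0" using DERIV_const by (rule DERIV_unique)
      moreover have "H t * (H' t)\<^sup>T = ?J\<^sup>T" using c H'c by (simp add: transpose_mult[of _ d d _ d])
      ultimately have "?J $$ (r, s) + ?J $$ (s, r) = 0"
        using rs J by (metis carrier_matD index_add_mat(1) index_transpose_mat(1) index_transpose_mat(2) index_transpose_mat(3))
      then show "?J $$ (r, s) = - ?J $$ (s, r)" by simp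
    next
      fix r assume r: "r < d"
      \<comment> \<open>Column sums 1 mean that the transpose of \<open>H t\<close> fixes the
        all-ones vector, so the row sums of \<open>?J\<close> are those of \<open>H' t\<close>,
        which vanish because the row sums of \<open>H\<close> are constant.\<close>
      have "(\<Sum>s<d. ?J $$ (r, s)) = (\<Sum>s<d. \<Sum>k<d. H' t $$ (r, k) * H t $$ (s, k))"
        using c(1) by (intro sum.cong refl) (subst index_mult_square[OF H'c c(2)], use r in auto)
      also have "\<dots> = (\<Sum>k<d. H' t $$ (r, k) * (\<Sum>s<d. H t $$ (s, k)))"
        unfolding sum_distrib_left by (rule sum.swap)
      also have "\<dots> = (\<Sum>k<d. H' t $$ (r, k))" by (intro sum.cong refl) (simp add: cols)
      finally have 1: "(\<Sum>s<d. ?J $$ (r, s)) = (\<Sum>k<d. H' t $$ (r, k))" .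
      have "((\<lambda>u. \<Sum>k<d. H u $$ (r, k)) has_real_derivative (\<Sum>k<d. H' t $$ (r, k))) (at t)"
        using H[of t] r by (intro DERIV_sum) (auto simp: has_mat_deriv_def)
      then have "((\<lambda>u. 1) has_real_derivative (\<Sum>k<d. H' t $$ (r, k))) (at t)" by (simp add: rows r)
      then have "(\<Sum>k<d. H' t $$ (r, k)) = 0" using DERIV_const by (rule DERIV_unique)
      with 1 show "(\<Sum>s<d. ?J $$ (r, s)) = 0" by simp
    qed
    with der show ?thesis by simp
  qed
  then show ?thesis by (rule DERIV_isconst_all[rule_format, rotated]) 
qed

section \<open>Reflections orthogonal to the all-ones vector\<close>

text \<open>For \<open>v = 0\<close> division by zero turns this into the identity, so it is always orthogonal.\<close>

definition refl_mat :: "nat \<Rightarrow> (nat \<Rightarrow> real) \<Rightarrow> real mat" where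
  "refl_mat d v = mat d d (\<lambda>(i, j). (if i = j then 1 else 0) - 2 * v i * v j / (\<Sum>k<d. (v k)\<^sup>2))"

lemma refl_mat_carrier [simp]: "refl_mat d v \<in> carrier_mat d d"
  by (simp add: refl_mat_def)

lemma refl_mat_cong: "(\<And>i. i < d \<Longrightarrow> v i = w i) \<Longrightarrow> refl_mat d v = refl_mat d w"
  unfolding refl_mat_def by (intro eq_matI) auto

lemma refl_mat_scale:
  assumes "c \<noteq> 0"
  shows "refl_mat d (\<lambda>i. c * v i) = refl_mat d v"
proof -
  have "(\<Sum>k<d. (c * v k)\<^sup>2) = c * c * (\<Sum>k<d. (v k)\<^sup>2)"
    by (simp add: sum_distrib_left power2_eq_square ac_simps)
  moreover have "2 * (c * a) * (c * b) / (c * c * s) = 2 * a * b / s" for a b s :: real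
    using assms by (simp add: field_simps)
  ultimately show ?thesis by (simp add: refl_mat_def)
qed

lemma refl_mat_orth: "refl_mat d v \<in> orth_group d"
proof -
  define c where "c = 2 / (\<Sum>k<d. (v k)\<^sup>2)"
  \<comment> \<open>This includes \<open>v = 0\<close>, where \<open>c\<close> is 0 by division by
    zero.\<close>
  have cc: "c * c * (\<Sum>k<d. (v k)\<^sup>2) = 2 * c" by (simp add: c_def)
  have "(refl_mat d v)\<^sup>T * refl_mat d v = 1\<^sub>m d"
  proof (rule eq_matI)
    fix i j assume "i < dim_row (1\<^sub>m d :: real mat)" "j < dim_col (1\<^sub>m d :: real mat)"
    then have ij: "i < d" "j < d" by auto
    have "((refl_mat d v)\<^sup>T * refl_mat d v) $$ (i, j) =
      (\<Sum>k<d. ((if k = i then 1 else 0) - c * v k * v i) * ((if k = j then 1 else 0) - c * v k * v j))"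
      using ij by (simp add: refl_mat_def scalar_prod_def atLeast0LessThan c_def)
    also have "\<dots> = (\<Sum>k<d. (if k = i then (if i = j then 1 else 0) - c * v i * v j else 0) -
        (if k = j then c * v i * v j else 0) + c * c * v i * v j * (v k)\<^sup>2)"
      by (intro sum.cong) (auto simp: algebra_simps power2_eq_square)
    also have "\<dots> = (if i = j then 1 else 0) - c * v i * v j - c * v i * v j + c * c * (\<Sum>k<d. (v k)\<^sup>2) * v i * v j"
      using ij by (simp add: sum.distrib sum_subtractf sum_distrib_left sum_distrib_right ac_simps)
    also have "\<dots> = 1\<^sub>m d $$ (i, j)" unfolding cc using ij by simp
    finally show "((refl_mat d v)\<^sup>T * refl_mat d v) $$ (i, j) = 1\<^sub>m d $$ (i, j)" .
  qed (auto simp: refl_mat_def)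
  then show ?thesis by (simp add: orth_group_def)
qed

lemma refl_mat_sums:
  assumes "(\<Sum>k<d. v k) = 0" "i < d"
  shows "(\<Sum>j<d. refl_mat d v $$ (i, j)) = 1" "(\<Sum>j<d. refl_mat d v $$ (j, i)) = 1"
proof -
  let ?S = "\<Sum>k<d. (v k)\<^sup>2"
  have "(\<Sum>j<d. refl_mat d v $$ (i, j)) = (\<Sum>j<d. (if j = i then 1 else 0) - 2 * v i / ?S * v j)"
    using assms(2) by (intro sum.cong) (auto simp: refl_mat_def)
  then show *: "(\<Sum>j<d. refl_mat d v $$ (i, j)) = 1"
    using assms by (simp only: sum_subtractf sum_distrib_left[symmetric]) simp
  have "refl_mat d v $$ (j, i) = refl_mat d v $$ (i, j)" if "j < d" for j
    using that assms(2) by (auto simp: refl_mat_def)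
  then show "(\<Sum>j<d. refl_mat d v $$ (j, i)) = 1" using * by simp
qed

text \<open>Quantified over all \<open>A\<close> and \<open>Y\<close>, so that the invariant
  matrices are closed under products.\<close>

definition perm_invariant :: "nat \<Rightarrow> real \<Rightarrow> real mat \<Rightarrow> bool" where
  "perm_invariant d x X \<longleftrightarrow> X \<in> carrier_mat d d \<and>
     (\<forall>A\<in>carrier_mat d d. \<forall>Y\<in>carrier_mat d d. perm_sum d x A (X * Y) = perm_sum d x A Y)"

lemma perm_invariant_one: "perm_invariant d x (1\<^sub>m d)"
  by (simp add: perm_invariant_def)

lemma perm_invariant_mult:
  assumes "perm_invariant d x X" "perm_invariant d x Z"
  shows "perm_invariant d x (X * Z)"
  using assms unfolding perm_invariant_def
  by (auto simp: assoc_mult_mat[of _ d d _ d _ d] mult_carrier_mat[of _ d d _ d])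

lemma perm_invariant_perm_mat:
  assumes P: "P \<in> perm_mats d"
  shows "perm_invariant d x P"
  unfolding perm_invariant_def
proof (intro conjI ballI)
  fix A Y :: "real mat" assume "A \<in> carrier_mat d d" and Y: "Y \<in> carrier_mat d d"
  have "perm_sum d x A (P * Y) = (\<Sum>Q\<in>perm_mats d. gram_det d x (A + Q * P * Y))"
    unfolding perm_sum_def using Y perm_mats_carrier[OF P] perm_mats_carrier
    by (intro sum.cong) (auto simp: assoc_mult_mat[of _ d d _ d _ d])
  then show "perm_sum d x A (P * Y) = perm_sum d x A Y"
    unfolding perm_sum_def using sum_perm_mats_mult[OF P, of "\<lambda>Q. gram_det d x (A + Q * Y)"] by (simp only:)
qed (rule perm_mats_carrier[OF P])

text \<open>The segment from \<open>?u\<close>, whose reflection is a transposition, to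
  \<open>v\<close> stays orthogonal to the all-ones vector, and its reflections form a
  differentiable path unless it passes through 0. In that case \<open>v\<close> is a multiple of
  \<open>?u\<close> and has the same reflection.\<close>

lemma perm_invariant_refl_mat:
  assumes v: "(\<Sum>k<d. v k) = 0"
  shows "perm_invariant d x (refl_mat d v)"
proof (cases "(\<Sum>k<d. (v k)\<^sup>2) = 0")
  case True
  then have "refl_mat d v = 1\<^sub>m d" by (auto simp: refl_mat_def)
  then show ?thesis by (simp add: perm_invariant_one)
next
  case False
  have d: "2 \<le> d"
  proof (rule ccontr)
    assume "\<not> 2 \<le> d"
    then have "d = 0 \<or> d = 1" by linarith
    then show False using False v by auto
  qed
  let ?u = "\<lambda>i :: nat. if i = 0 then 1 else if i = 1 then - 1 else 0 :: real"
  have sum2: "(\<Sum>k<d. f k) = f 0 + f 1" if "\<And>k. 2 \<le> k \<Longrightarrow> f k = 0" for f :: "nat \<Rightarrow> real"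
  proof -
    have "(\<Sum>k<d. f k) = (\<Sum>k\<in>{0, 1}. f k)" using d that by (intro sum.mono_neutral_right) auto
    then show ?thesis by simp
  qed
  have u: "(\<Sum>k<d. ?u k) = 0" "(\<Sum>k<d. (?u k)\<^sup>2) = 2" by (subst sum2; simp)+
  have tau: "Transposition.transpose 0 1 permutes {..<d}" using d by (intro permutes_swap_id) auto
  have "refl_mat d ?u = perm_mat d (Transposition.transpose 0 1)"
    unfolding refl_mat_def u(2) perm_mat_def by (intro eq_matI) (auto simp: Transposition.transpose_def)
  then have uP: "refl_mat d ?u \<in> perm_mats d" using tau by (simp add: perm_mats_eq)
  let ?x = "\<lambda>t i. (1 - t) * ?u i + t * v i"
  show ?thesis
  proof (cases "\<exists>t. (\<Sum>k<d. (?x t k)\<^sup>2) = 0")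
    case True
    then obtain t where "(\<Sum>k<d. (?x t k)\<^sup>2) = 0" by blast
    then have z: "?x t k = 0" if "k < d" for k using that by (simp add: sum_nonneg_eq_0_iff)
    have t: "t \<noteq> 0" using z[of 0] d by auto
    \<comment> \<open>Solves \<open>?x t k = 0\<close> for \<open>v\<close>; the segment starts at
      \<open>?u\<close>, which is not zero, so \<open>t\<close> is not 0.\<close>
    define c where "c = - (1 - t) / t"
    have vc: "v k = c * ?u k" if "k < d" for k
      using z[OF that] t unfolding c_def by (simp add: field_simps split: if_splits)
    have "c \<noteq> 0" using False vc by auto
    have "refl_mat d v = refl_mat d (\<lambda>k. c * ?u k)" by (rule refl_mat_cong) (rule vc)
    also have "\<dots> = refl_mat d ?u" by (rule refl_mat_scale[OF \<open>c \<noteq> 0\<close>])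
    finally show ?thesis using perm_invariant_perm_mat[OF uP] by simp
  next
    case nz: False
    let ?H = "\<lambda>t. refl_mat d (?x t)"
    let ?H' = "\<lambda>t. mat d d (\<lambda>(i, j). deriv (\<lambda>s. ?H s $$ (i, j)) t)"
    have H: "has_mat_deriv d ?H (?H' t) t" for t
      unfolding has_mat_deriv_def
    proof (intro conjI allI impI)
      fix i j assume ij: "i < d" "j < d"
      have nz': "(\<Sum>k<d. (?x t k)\<^sup>2) \<noteq> 0" using nz by blast
      have "(\<lambda>s. (if i = j then 1 else 0) - 2 * ?x s i * ?x s j / (\<Sum>k<d. (?x s k)\<^sup>2)) differentiable at t"
        using nz' by (intro derivative_intros) auto
      then have "(\<lambda>s. ?H s $$ (i, j)) differentiable at t" using ij by (simp add: refl_mat_def)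
      then show "((\<lambda>s. ?H s $$ (i, j)) has_real_derivative ?H' t $$ (i, j)) (at t)"
        using ij by (simp add: DERIV_deriv_iff_real_differentiable)
    qed simp_all
    have x0: "(\<Sum>k<d. ?x t k) = 0" for t
      unfolding sum.distrib sum_distrib_left[symmetric] u(1) v by simp
    show ?thesis unfolding perm_invariant_def
    proof (intro conjI ballI)
      fix A Y :: "real mat" assume A: "A \<in> carrier_mat d d" and Y: "Y \<in> carrier_mat d d"
      have "perm_sum d x A (?H 1 * Y) = perm_sum d x A (?H 0 * Y)"
        by (rule perm_sum_path[OF A Y H refl_mat_orth refl_mat_sums(1)[OF x0] refl_mat_sums(2)[OF x0]])
      moreover have "?H 1 = refl_mat d v" "?H 0 = refl_mat d ?u" by (rule refl_mat_cong; simp)+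
      ultimately show "perm_sum d x A (refl_mat d v * Y) = perm_sum d x A Y"
        using perm_invariant_perm_mat[OF uP] A Y by (simp add: perm_invariant_def)
    qed simp
  qed
qed

lemma orth_conj_refl_mat:
  assumes H: "H \<in> orth_group d"
  shows "H * refl_mat d v * H\<^sup>T = refl_mat d (\<lambda>i. \<Sum>k<d. H $$ (i, k) * v k)"
proof (rule eq_matI)
  let ?w = "\<lambda>i. \<Sum>k<d. H $$ (i, k) * v k"
  note c = orth_group_cancel[OF H]
  fix i j assume "i < dim_row (refl_mat d ?w)" "j < dim_col (refl_mat d ?w)"
  then have ij: "i < d" "j < d" by (auto simp: refl_mat_def)
  let ?S = "\<Sum>k<d. (v k)\<^sup>2"
  have S: "(\<Sum>k<d. (?w k)\<^sup>2) = ?S"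
    using orth_group_inner[OF H, of v v] by (simp add: power2_eq_square)
  have "(H * refl_mat d v * H\<^sup>T) $$ (i, j) =
      (\<Sum>r<d. \<Sum>s<d. ((if s = r then 1 else 0) - 2 / ?S * v r * v s) * (H $$ (i, r) * H $$ (j, s)))"
    using c(1) ij by (subst index_mult3[OF c(1) _ c(2) ij]) (auto simp: refl_mat_def intro!: sum.cong)
  also have "\<dots> = (\<Sum>r<d. \<Sum>s<d. (if s = r then H $$ (i, r) * H $$ (j, r) else 0) -
      2 / ?S * ((H $$ (i, r) * v r) * (H $$ (j, s) * v s)))"
    by (intro sum.cong refl) (auto simp: algebra_simps)
  also have "\<dots> = (\<Sum>r<d. H $$ (i, r) * H $$ (j, r)) - 2 / ?S * (?w i * ?w j)"
    unfolding sum_product by (simp add: sum_subtractf sum_distrib_left)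
  also have "(\<Sum>r<d. H $$ (i, r) * H $$ (j, r)) = (if i = j then 1 else 0)"
    using orth_group_columns[OF orth_group_transpose[OF H] ij] c(1) ij by simp
  also have "(if i = j then 1 else 0) - 2 / ?S * (?w i * ?w j) = refl_mat d ?w $$ (i, j)"
    using ij by (simp add: refl_mat_def S)
  finally show "(H * refl_mat d v * H\<^sup>T) $$ (i, j) = refl_mat d ?w $$ (i, j)" .
qed (use orth_group_cancel[OF H] in \<open>auto simp: refl_mat_def\<close>)

text \<open>The Householder reflection that exchanges the first unit vector with the normalised
  all-ones vector; \<open>w\<close> is their difference.\<close>

lemma ex_orth_ones_column:
  assumes d: "0 < d"
  obtains H where "H \<in> orth_group d" "\<And>i. i < d \<Longrightarrow> H $$ (i, 0) = 1 / sqrt d"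
proof -
  define q where "q = 1 / sqrt d"
  define w where "w i = (if i = 0 then 1 else 0) - q" for i :: nat
  have q: "real d * q\<^sup>2 = 1" using d by (simp add: q_def power_divide)
  \<comment> \<open>Both vectors have length 1, so the squared distance is 2 minus twice their inner
    product \<open>q\<close>.\<close>
  have S: "(\<Sum>k<d. (w k)\<^sup>2) = 2 * w 0"
  proof -
    have "(\<Sum>k<d. (w k)\<^sup>2) = (\<Sum>k<d. (if k = 0 then 1 - 2 * q else 0) + q\<^sup>2)"
      by (intro sum.cong) (auto simp: w_def power2_eq_square algebra_simps)
    also have "\<dots> = 1 - 2 * q + real d * q\<^sup>2" using d by (simp add: sum.distrib)
    finally show ?thesis unfolding q by (simp add: w_def)
  qed
  have "refl_mat d w $$ (i, 0) = q" if i: "i < d" for i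
  proof (cases "w 0 = 0")
    case True
    then have "q = 1" by (simp add: w_def)
    then have "d = 1" using q by simp
    then show ?thesis using i \<open>q = 1\<close> True unfolding refl_mat_def S by simp
  next
    case False
    have "refl_mat d w $$ (i, 0) = (if i = 0 then 1 else 0) - 2 * w i * w 0 / (2 * w 0)"
      using i d unfolding refl_mat_def S by simp
    also have "2 * w i * w 0 / (2 * w 0) = w i" using False by simp
    finally show ?thesis using w_def[of i] by simp
  qed
  then show ?thesis unfolding q_def by (rule that[OF refl_mat_orth])
qed

section \<open>Splitting off the all-ones direction\<close>

text \<open>The shape of a matrix with all row and column sums \<open>c\<close> in an orthonormal
  basis that begins with the normalised all-ones vector.\<close>

definition corner_mat :: "nat \<Rightarrow> real \<Rightarrow> real mat \<Rightarrow> real mat" where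
  "corner_mat n c U = four_block_mat (mat 1 1 (\<lambda>_. c)) (0\<^sub>m 1 n) (0\<^sub>m n 1) U"

lemma corner_mat_carrier [simp]: "U \<in> carrier_mat n n \<Longrightarrow> corner_mat n c U \<in> carrier_mat (Suc n) (Suc n)"
  unfolding corner_mat_def using four_block_carrier_mat[of "mat 1 1 (\<lambda>_. c)" 1 1 U n n] by simp

lemma index_corner_mat:
  assumes "U \<in> carrier_mat n n" "i < Suc n" "j < Suc n"
  shows "corner_mat n c U $$ (i, j) = (if i = 0 \<or> j = 0 then if i = j then c else 0 else U $$ (i - 1, j - 1))"
  using assms by (auto simp: corner_mat_def)

lemma corner_mat_mult:
  assumes "U \<in> carrier_mat n n" "V \<in> carrier_mat n n"
  shows "corner_mat n c U * corner_mat n e V = corner_mat n (c * e) (U * V)"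
proof -
  have "mat 1 1 (\<lambda>_. c) * mat 1 1 (\<lambda>_. e) = mat 1 1 (\<lambda>_. c * e)"
    by (intro eq_matI) (auto simp: scalar_prod_def)
  then show ?thesis
    unfolding corner_mat_def using assms
    by (subst mult_four_block_mat[of _ 1 1 _ n _ n _ _ 1 _ n]) (auto simp: mult_carrier_mat[of _ n n _ n])
qed

lemma corner_mat_add:
  assumes "U \<in> carrier_mat n n" "V \<in> carrier_mat n n"
  shows "corner_mat n c U + corner_mat n e V = corner_mat n (c + e) (U + V)"
  using assms by (intro eq_matI) (auto simp: index_corner_mat corner_mat_def)

lemma corner_mat_transpose:
  assumes "U \<in> carrier_mat n n"
  shows "(corner_mat n c U)\<^sup>T = corner_mat n c U\<^sup>T"
  using assms by (intro eq_matI) (auto simp: corner_mat_def)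

lemma corner_mat_one: "corner_mat n 1 (1\<^sub>m n) = 1\<^sub>m (Suc n)"
  by (intro eq_matI) (auto simp: corner_mat_def)

lemma gram_det_corner_mat:
  assumes U: "U \<in> carrier_mat n n"
  shows "gram_det (Suc n) x (corner_mat n c U) = (x - c\<^sup>2) * gram_det n x U"
proof -
  have UU: "U * U\<^sup>T \<in> carrier_mat n n" using U by simp
  have "corner_mat n c U * (corner_mat n c U)\<^sup>T = corner_mat n (c\<^sup>2) (U * U\<^sup>T)"
    using U by (simp add: corner_mat_transpose corner_mat_mult power2_eq_square)
  then have "x \<cdot>\<^sub>m 1\<^sub>m (Suc n) - corner_mat n c U * (corner_mat n c U)\<^sup>T =
      corner_mat n (x - c\<^sup>2) (x \<cdot>\<^sub>m 1\<^sub>m n - U * U\<^sup>T)"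
    using UU U by (simp, intro eq_matI) (auto simp: corner_mat_def)
  moreover have "det (corner_mat n (x - c\<^sup>2) (x \<cdot>\<^sub>m 1\<^sub>m n - U * U\<^sup>T)) = (x - c\<^sup>2) * det (x \<cdot>\<^sub>m 1\<^sub>m n - U * U\<^sup>T)"
    unfolding corner_mat_def using gram_matrix_carrier[OF U]
    by (subst det_four_block_mat_lower_left_zero[of _ 1 _ n]) (auto simp: det_single)
  ultimately show ?thesis by (simp add: gram_det_def)
qed

lemma corner_refl_mat:
  "corner_mat n 1 (refl_mat n w) = refl_mat (Suc n) (\<lambda>i. if i = 0 then 0 else w (i - 1))"
proof -
  have "(\<Sum>k<Suc n. (if k = 0 then 0 else w (k - 1))\<^sup>2) = (\<Sum>k<n. (w k)\<^sup>2)"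
    by (subst sum.lessThan_Suc_shift) simp
  then show ?thesis
    by (intro eq_matI) (auto simp: index_corner_mat refl_mat_def corner_mat_def)
qed

text \<open>The later columns of \<open>H\<close> are orthogonal to its first one and so have sum
  zero. The conjugated reflection therefore has a normal vector orthogonal to the all-ones
  vector.\<close>

lemma perm_invariant_corner_refl:
  assumes H: "H \<in> orth_group (Suc n)" and col: "\<And>i. i < Suc n \<Longrightarrow> H $$ (i, 0) = 1 / sqrt (Suc n)"
  shows "perm_invariant (Suc n) x (H * corner_mat n 1 (refl_mat n w) * H\<^sup>T)"
  unfolding corner_refl_mat orth_conj_refl_mat[OF H]
proof (rule perm_invariant_refl_mat)
  let ?w = "\<lambda>i. if i = 0 then 0 else w (i - 1)"
  have "(\<Sum>i<Suc n. H $$ (i, k)) = 0" if k: "k < Suc n" "k \<noteq> 0" for k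
  proof -
    have "0 = (\<Sum>i<Suc n. H $$ (i, 0) * H $$ (i, k))"
      using orth_group_columns[OF H, of 0 k] k by simp
    also have "\<dots> = (\<Sum>i<Suc n. 1 / sqrt (Suc n) * H $$ (i, k))"
      by (intro sum.cong refl) (simp only: col lessThan_iff)
    also have "\<dots> = 1 / sqrt (Suc n) * (\<Sum>i<Suc n. H $$ (i, k))" by (simp only: sum_distrib_left)
    finally show ?thesis by simp
  qed
  then have "(\<Sum>k<Suc n. (\<Sum>i<Suc n. H $$ (i, k)) * ?w k) = 0" by (intro sum.neutral) auto
  then show "(\<Sum>i<Suc n. \<Sum>k<Suc n. H $$ (i, k) * ?w k) = 0"
    unfolding sum_distrib_right by (subst sum.swap)
qed

lemma signed_perm_mat_cong:
  "(\<And>i. i < n \<Longrightarrow> \<sigma> i = \<tau> i) \<Longrightarrow> (\<And>i. i < n \<Longrightarrow> e i = f i) \<Longrightarrow> signed_perm_mat n \<sigma> e = signed_perm_mat n \<tau> f"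
  by (auto simp: signed_perm_mat_def)

lemma signed_perm_mat_mult:
  assumes "\<And>i. i < n \<Longrightarrow> \<sigma> i < n"
  shows "signed_perm_mat n \<sigma> e * signed_perm_mat n \<tau> f = signed_perm_mat n (\<tau> \<circ> \<sigma>) (\<lambda>i. e i * f (\<sigma> i))"
proof (rule eq_matI)
  fix i j assume "i < dim_row (signed_perm_mat n (\<tau> \<circ> \<sigma>) (\<lambda>i. e i * f (\<sigma> i)))"
    "j < dim_col (signed_perm_mat n (\<tau> \<circ> \<sigma>) (\<lambda>i. e i * f (\<sigma> i)))"
  then have ij: "i < n" "j < n" by (auto simp: signed_perm_mat_def)
  show "(signed_perm_mat n \<sigma> e * signed_perm_mat n \<tau> f) $$ (i, j) = signed_perm_mat n (\<tau> \<circ> \<sigma>) (\<lambda>i. e i * f (\<sigma> i)) $$ (i, j)"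
    unfolding index_signed_perm_mult[where \<sigma> = \<sigma>, OF signed_perm_mat_carrier ij assms[OF ij(1)]]
    using ij assms[OF ij(1)] by (simp add: signed_perm_mat_def)
qed (auto simp: signed_perm_mat_def)

lemma signed_perm_mat_one: "signed_perm_mat n id (\<lambda>_. 1) = 1\<^sub>m n"
  by (intro eq_matI) (auto simp: signed_perm_mat_def)

lemma signed_perm_mat_orth:
  assumes \<sigma>: "\<sigma> permutes {..<n}" and e: "\<And>i. i < n \<Longrightarrow> e i * e i = 1"
  shows "signed_perm_mat n \<sigma> e \<in> orth_group n"
proof -
  let ?U = "signed_perm_mat n \<sigma> e"
  have \<sigma>n: "\<sigma> i < n" if "i < n" for i using permutes_in_image[OF \<sigma>, of i] that by simp
  have "?U * ?U\<^sup>T = 1\<^sub>m n"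
  proof (rule eq_matI)
    fix i j assume "i < dim_row (1\<^sub>m n :: real mat)" "j < dim_col (1\<^sub>m n :: real mat)"
    then have ij: "i < n" "j < n" by auto
    have "(?U * ?U\<^sup>T) $$ (i, j) = e i * ?U\<^sup>T $$ (\<sigma> i, j)"
      by (rule index_signed_perm_mult) (use ij \<sigma>n in auto)
    then show "(?U * ?U\<^sup>T) $$ (i, j) = 1\<^sub>m n $$ (i, j)"
      using ij \<sigma>n e permutes_inj[OF \<sigma>] by (auto simp: signed_perm_mat_def dest: injD)
  qed (auto simp: signed_perm_mat_def)
  then have "?U\<^sup>T \<in> orth_group n" by (simp add: orth_group_def)
  then show ?thesis using orth_group_transpose by force
qed

lemma refl_mat_sign_flip:
  assumes "a < n"
  shows "refl_mat n (\<lambda>i. if i = a then 1 else 0) = signed_perm_mat n id (sign_flip {a})"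
proof -
  have "(\<Sum>k<n. (if k = a then 1 else 0 :: real)\<^sup>2) = (\<Sum>k<n. if k = a then 1 else 0)" by (intro sum.cong) auto
  then have "(\<Sum>k<n. (if k = a then 1 else 0 :: real)\<^sup>2) = 1" using assms by simp
  then show ?thesis by (intro eq_matI) (auto simp: refl_mat_def signed_perm_mat_def sign_flip_def)
qed

lemma refl_mat_swap:
  assumes "a < n" "b < n" "a \<noteq> b"
  shows "refl_mat n (\<lambda>i. if i = a then 1 else if i = b then - 1 else 0) = signed_perm_mat n (Transposition.transpose a b) (\<lambda>_. 1)"
proof -
  have "(\<Sum>k<n. (if k = a then 1 else if k = b then - 1 else 0 :: real)\<^sup>2) =
    (\<Sum>k<n. (if k = a then 1 else 0) + (if k = b then 1 else 0))" using assms by (intro sum.cong) auto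
  then have "(\<Sum>k<n. (if k = a then 1 else if k = b then - 1 else 0 :: real)\<^sup>2) = 2"
    using assms by (simp add: sum.distrib)
  then show ?thesis using assms
    by (intro eq_matI) (auto simp: refl_mat_def signed_perm_mat_def Transposition.transpose_def)
qed

text \<open>Signed permutation matrices are products of reflections: in unit vectors for the sign
  changes, in differences of two unit vectors for the transpositions.\<close>

lemma perm_invariant_corner_signed_perm:
  assumes H: "H \<in> orth_group (Suc n)" and col: "\<And>i. i < Suc n \<Longrightarrow> H $$ (i, 0) = 1 / sqrt (Suc n)"
    and \<sigma>: "\<sigma> permutes {..<n}" and e: "\<And>i. i < n \<Longrightarrow> e i \<in> {- 1, 1}"
  shows "perm_invariant (Suc n) x (H * corner_mat n 1 (signed_perm_mat n \<sigma> e) * H\<^sup>T)"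
proof -
  note c = orth_group_cancel[OF H]
  let ?I = "\<lambda>U. perm_invariant (Suc n) x (H * corner_mat n 1 U * H\<^sup>T)"
  have one: "?I (1\<^sub>m n)" using c by (simp add: corner_mat_one perm_invariant_one)
  have mult: "?I (U * V)" if "?I U" "?I V" and UV: "U \<in> carrier_mat n n" "V \<in> carrier_mat n n" for U V
  proof -
    have k: "corner_mat n 1 U \<in> carrier_mat (Suc n) (Suc n)" "corner_mat n 1 V \<in> carrier_mat (Suc n) (Suc n)"
      using UV by simp_all
    have "H * corner_mat n 1 U * H\<^sup>T * (H * corner_mat n 1 V * H\<^sup>T) = H * corner_mat n 1 (U * V) * H\<^sup>T"
    proof -
      have UV': "corner_mat n 1 (U * V) = corner_mat n 1 U * corner_mat n 1 V"
        using corner_mat_mult[OF UV, of 1 1] by simp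
      show ?thesis
        unfolding UV' using c k
        by (simp add: assoc_mult_mat[of _ "Suc n" "Suc n" _ "Suc n" _ "Suc n"] mult_carrier_mat[of _ "Suc n" "Suc n" _ "Suc n"])
    qed
    then show ?thesis using perm_invariant_mult[OF that(1,2)] by simp
  qed
  note refl = perm_invariant_corner_refl[OF H col]
  have flips: "?I (signed_perm_mat n id (sign_flip T))" if "finite T" "T \<subseteq> {..<n}" for T
    using that
  proof (induction T rule: finite_induct)
    case empty
    have "sign_flip {} = (\<lambda>_. 1)" by (auto simp: sign_flip_def)
    show ?case unfolding \<open>sign_flip {} = _\<close> signed_perm_mat_one by (rule one)
  next
    case (insert a T)
    have "signed_perm_mat n id (sign_flip (insert a T)) = refl_mat n (\<lambda>i. if i = a then 1 else 0) * signed_perm_mat n id (sign_flip T)"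
      using insert by (subst refl_mat_sign_flip, simp, subst signed_perm_mat_mult, simp)
        (rule signed_perm_mat_cong; auto simp: sign_flip_def)
    moreover have "?I (signed_perm_mat n id (sign_flip T))" by (rule insert.IH) (use insert.prems in simp)
    ultimately show ?case using mult[OF refl, of "signed_perm_mat n id (sign_flip T)"] by (simp only: refl_mat_carrier signed_perm_mat_carrier)
  qed
  have perms: "?I (signed_perm_mat n \<sigma> (\<lambda>_. 1))"
    using \<sigma> finite_lessThan
  proof (induction rule: permutes_induct)
    case id
    show ?case unfolding signed_perm_mat_one by (rule one)
  next
    case (swap a b p)
    have "p i < n" if "i < n" for i using permutes_in_image[OF \<open>p permutes _\<close>, of i] that by simp
    then have "signed_perm_mat n (Transposition.transpose a b \<circ> p) (\<lambda>_. 1) =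
        signed_perm_mat n p (\<lambda>_. 1) * refl_mat n (\<lambda>i. if i = a then 1 else if i = b then - 1 else 0)"
      using swap by (subst refl_mat_swap, simp_all add: signed_perm_mat_mult)
    then show ?case using mult[OF swap.IH refl] by (simp only: refl_mat_carrier signed_perm_mat_carrier)
  qed
  let ?T = "{i. i < n \<and> e i = - 1}"
  have "signed_perm_mat n \<sigma> e = signed_perm_mat n id (sign_flip ?T) * signed_perm_mat n \<sigma> (\<lambda>_. 1)"
    by (subst signed_perm_mat_mult, simp) (rule signed_perm_mat_cong; use e in \<open>auto simp: sign_flip_def\<close>)
  moreover have "?I (signed_perm_mat n id (sign_flip ?T))" by (rule flips) auto
  ultimately show ?thesis using mult[OF _ perms] by simp
qed

section \<open>The asymmetric additive convolution\<close>

lemma signed_perm_sum_gram_det: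
  assumes "C \<in> carrier_mat n n" "D \<in> carrier_mat n n"
  shows "signed_perm_sum n x C D = (\<Sum>\<rho>\<in>block_perms n. \<Sum>T\<in>Pow {..<n + n}.
     gram_det n x (C + row_signed_perm n \<rho> T * D * (col_signed_perm n \<rho> T)\<^sup>T))"
proof -
  have "C + row_signed_perm n \<rho> T * D * (col_signed_perm n \<rho> T)\<^sup>T \<in> carrier_mat n n" for \<rho> T
    using assms by (intro add_carrier_mat mult_carrier_mat[of _ n n]) auto
  then show ?thesis
    unfolding signed_perm_sum_def Let_def by (intro sum.cong refl poly_char_poly_gram)
qed

text \<open>\<open>\<rho>\<close> also moves the second half; replaced by the identity there, it
  becomes a permutation of the row indices with the same matrix.\<close>

lemma row_signed_perm_eq:
  assumes \<rho>: "\<rho> \<in> block_perms n"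
  obtains \<sigma> e where "\<sigma> permutes {..<n}" "\<And>i. e i \<in> {- 1, 1}" "row_signed_perm n \<rho> T = signed_perm_mat n \<sigma> e"
proof -
  let ?s = "\<lambda>i. if i < n then \<rho> i else i"
  have inj: "inj \<rho>" using \<rho> permutes_inj by (auto simp: block_perms_def)
  have "inj_on ?s {..<n}" using inj by (auto simp: inj_on_def)
  moreover have "?s ` {..<n} \<subseteq> {..<n}" using block_perms_less(1)[OF \<rho>] by auto
  ultimately have "bij_betw ?s {..<n} {..<n}"
    unfolding bij_betw_def using endo_inj_surj[OF finite_lessThan] by blast
  then have "?s permutes {..<n}" by (rule bij_imp_permutes) auto
  moreover have "row_signed_perm n \<rho> T = signed_perm_mat n ?s (sign_flip T)"
    unfolding row_signed_perm_def by (rule signed_perm_mat_cong) auto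
  ultimately show ?thesis by (intro that[of ?s "sign_flip T"]) (auto simp: sign_flip_def)
qed

lemma col_signed_perm_eq:
  assumes \<rho>: "\<rho> \<in> block_perms n"
  obtains \<sigma> e where "\<sigma> permutes {..<n}" "\<And>i. e i \<in> {- 1, 1}" "col_signed_perm n \<rho> T = signed_perm_mat n \<sigma> e"
proof -
  let ?s = "\<lambda>i. if i < n then \<rho> (n + i) - n else i"
  have inj: "inj \<rho>" using \<rho> permutes_inj by (auto simp: block_perms_def)
  note l = block_perms_less[OF \<rho>]
  have "inj_on ?s {..<n}"
  proof (rule inj_onI)
    fix i j assume ij: "i \<in> {..<n}" "j \<in> {..<n}" "?s i = ?s j"
    then have "\<rho> (n + i) = \<rho> (n + j)" using l(2)[of "n + i"] l(2)[of "n + j"] by simp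
    from injD[OF inj this] show "i = j" by simp
  qed
  moreover have "?s ` {..<n} \<subseteq> {..<n}"
  proof
    fix y assume "y \<in> ?s ` {..<n}"
    then obtain i where "i < n" "y = \<rho> (n + i) - n" by auto
    then show "y \<in> {..<n}" using l(2)[of "n + i"] l(3)[of "n + i"] by simp
  qed
  ultimately have "bij_betw ?s {..<n} {..<n}"
    unfolding bij_betw_def using endo_inj_surj[OF finite_lessThan] by blast
  then have "?s permutes {..<n}" by (rule bij_imp_permutes) auto
  moreover have "col_signed_perm n \<rho> T = signed_perm_mat n ?s (\<lambda>j. sign_flip T (n + j))"
    unfolding col_signed_perm_def by (rule signed_perm_mat_cong) auto
  ultimately show ?thesis by (intro that[of ?s "\<lambda>j. sign_flip T (n + j)"]) (auto simp: sign_flip_def)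
qed

lemma signed_perms_orth:
  assumes "\<rho> \<in> block_perms n"
  shows "row_signed_perm n \<rho> T \<in> orth_group n" "col_signed_perm n \<rho> T \<in> orth_group n"
proof -
  have orth: "signed_perm_mat n \<sigma> e \<in> orth_group n"
    if "\<sigma> permutes {..<n}" "\<And>i. e i \<in> {- 1, 1}" for \<sigma> e
  proof (rule signed_perm_mat_orth[OF that(1)])
    show "e i * e i = 1" for i using that(2)[of i] by auto
  qed
  show "row_signed_perm n \<rho> T \<in> orth_group n"
    using row_signed_perm_eq[OF assms, of T] orth by metis
  show "col_signed_perm n \<rho> T \<in> orth_group n"
    using col_signed_perm_eq[OF assms, of T] orth by metis
qed

lemma char_poly_gram_eqI:
  assumes "C \<in> carrier_mat n n" "D \<in> carrier_mat n n" "\<And>x. gram_det n x C = gram_det n x D"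
  shows "char_poly (C * C\<^sup>T) = char_poly (D * D\<^sup>T)"
  using assms by (simp add: poly_char_poly_gram poly_eq_poly_eq_iff[symmetric] fun_eq_iff)

lemma char_poly_orth_conj:
  assumes "D \<in> carrier_mat n n" "Q \<in> orth_group n" "R \<in> orth_group n"
  shows "char_poly ((Q * D * R\<^sup>T) * (Q * D * R\<^sup>T)\<^sup>T) = char_poly (D * D\<^sup>T)"
proof (rule char_poly_gram_eqI)
  have c: "Q \<in> carrier_mat n n" "R \<in> carrier_mat n n" using assms by (auto simp: orth_group_def)
  then have QD: "Q * D \<in> carrier_mat n n" using assms by simp
  show "Q * D * R\<^sup>T \<in> carrier_mat n n" by (rule mult_carrier_mat[OF QD]) (use c in simp)
  show "gram_det n x (Q * D * R\<^sup>T) = gram_det n x D" for x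
    using gram_det_orth_right[OF orth_group_transpose[OF assms(3)] QD] gram_det_orth_left[OF assms(2,1)] by simp
qed (rule assms)

section \<open>Integration over pairs of orthogonal matrices\<close>

text \<open>Closed under sums and products, hence inherited by determinants from the entries; on a
  probability space it implies integrability.\<close>

definition bounded_measurable :: "'a measure \<Rightarrow> ('a \<Rightarrow> real) \<Rightarrow> bool" where
  "bounded_measurable M f \<longleftrightarrow> f \<in> borel_measurable M \<and> (\<exists>B. \<forall>w\<in>space M. \<bar>f w\<bar> \<le> B)"

lemma bounded_measurable_const: "bounded_measurable M (\<lambda>_. c)"
  by (auto simp: bounded_measurable_def)

lemma bounded_measurable_add:
  assumes "bounded_measurable M f" "bounded_measurable M g"
  shows "bounded_measurable M (\<lambda>w. f w + g w)"
proof -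
  obtain B B' where "\<forall>w\<in>space M. \<bar>f w\<bar> \<le> B" "\<forall>w\<in>space M. \<bar>g w\<bar> \<le> B'"
    using assms by (auto simp: bounded_measurable_def)
  then have "\<forall>w\<in>space M. \<bar>f w + g w\<bar> \<le> B + B'" by (auto intro: order_trans[OF abs_triangle_ineq] add_mono)
  then show ?thesis using assms by (auto simp: bounded_measurable_def)
qed

lemma bounded_measurable_mult:
  assumes "bounded_measurable M f" "bounded_measurable M g"
  shows "bounded_measurable M (\<lambda>w. f w * g w)"
proof -
  obtain B B' where B: "\<forall>w\<in>space M. \<bar>f w\<bar> \<le> B" "\<forall>w\<in>space M. \<bar>g w\<bar> \<le> B'"
    using assms by (auto simp: bounded_measurable_def)
  have "\<bar>f w * g w\<bar> \<le> B * B'" if "w \<in> space M" for w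
    unfolding abs_mult using B that abs_ge_zero[of "f w"] by (intro mult_mono) (auto intro: order_trans)
  then show ?thesis using assms by (auto simp: bounded_measurable_def)
qed

lemma bounded_measurable_sum:
  "(\<And>i. i \<in> I \<Longrightarrow> bounded_measurable M (f i)) \<Longrightarrow> bounded_measurable M (\<lambda>w. \<Sum>i\<in>I. f i w)"
  by (induction I rule: infinite_finite_induct) (auto intro: bounded_measurable_const bounded_measurable_add)

lemma bounded_measurable_prod:
  "(\<And>i. i \<in> I \<Longrightarrow> bounded_measurable M (f i)) \<Longrightarrow> bounded_measurable M (\<lambda>w. \<Prod>i\<in>I. f i w)"
  by (induction I rule: infinite_finite_induct) (auto intro: bounded_measurable_const bounded_measurable_mult)

lemma bounded_measurable_cong:
  assumes "bounded_measurable M f" "\<And>w. w \<in> space M \<Longrightarrow> f w = g w"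
  shows "bounded_measurable M g"
  using assms unfolding bounded_measurable_def by (metis (no_types, lifting) measurable_cong)

lemma bounded_measurable_det:
  assumes "\<And>w. w \<in> space M \<Longrightarrow> X w \<in> carrier_mat n n"
    and "\<And>i j. i < n \<Longrightarrow> j < n \<Longrightarrow> bounded_measurable M (\<lambda>w. X w $$ (i, j))"
  shows "bounded_measurable M (\<lambda>w. det (X w))"
proof (rule bounded_measurable_cong)
  show "bounded_measurable M (\<lambda>w. \<Sum>p | p permutes {0..<n}. of_int (sign p) * (\<Prod>i = 0..<n. X w $$ (i, p i)))"
    using assms(2) by (intro bounded_measurable_sum bounded_measurable_mult bounded_measurable_const
        bounded_measurable_prod) (auto intro: permutes_less)
qed (simp add: det_def'[OF assms(1)])

lemma bounded_measurable_mat_mult: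
  assumes "\<And>w. w \<in> space M \<Longrightarrow> X w \<in> carrier_mat n n" "\<And>w. w \<in> space M \<Longrightarrow> Y w \<in> carrier_mat n n"
    and "\<And>i j. i < n \<Longrightarrow> j < n \<Longrightarrow> bounded_measurable M (\<lambda>w. X w $$ (i, j))"
    and "\<And>i j. i < n \<Longrightarrow> j < n \<Longrightarrow> bounded_measurable M (\<lambda>w. Y w $$ (i, j))"
    and "i < n" "j < n"
  shows "bounded_measurable M (\<lambda>w. (X w * Y w) $$ (i, j))"
proof (rule bounded_measurable_cong)
  show "bounded_measurable M (\<lambda>w. \<Sum>k<n. X w $$ (i, k) * Y w $$ (k, j))"
    using assms by (intro bounded_measurable_sum bounded_measurable_mult) auto
qed (simp only: index_mult_square[OF assms(1,2,5,6)])

lemma haar_orth_facts: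
  shows "prob_space (haar_orth n)" "sets (haar_orth n) = sets (orth_borel n)" "space (haar_orth n) = orth_group n"
    "U \<in> orth_group n \<Longrightarrow> distr (haar_orth n) (haar_orth n) (\<lambda>Q. U * Q) = haar_orth n"
  using is_haar_haar_orth[of n] sets_eq_imp_space_eq[of "haar_orth n" "orth_borel n"]
  by (auto simp: is_haar_orth_def)

abbreviation haar_pair :: "nat \<Rightarrow> (real mat \<times> real mat) measure" where
  "haar_pair n \<equiv> haar_orth n \<Otimes>\<^sub>M haar_orth n"

lemma prob_space_haar_pair: "prob_space (haar_pair n)"
  by (intro prob_space_pair haar_orth_facts)

lemma space_haar_pair: "space (haar_pair n) = orth_group n \<times> orth_group n"
  by (simp add: space_pair_measure haar_orth_facts)

lemma abs_orth_entry_le: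
  assumes "Q \<in> orth_group n" "i < n" "j < n"
  shows "\<bar>Q $$ (i, j)\<bar> \<le> 1"
proof -
  have "Q $$ (i, j) * Q $$ (i, j) \<le> (\<Sum>k<n. Q $$ (k, j) * Q $$ (k, j))"
    using assms by (intro member_le_sum) auto
  also have "\<dots> = 1" using orth_group_columns[OF assms(1,3,3)] by simp
  finally show ?thesis using abs_le_square_iff[of "Q $$ (i, j)" 1] by (simp add: power2_eq_square)
qed

lemma bounded_measurable_haar_entries:
  assumes "i < n" "j < n"
  shows "bounded_measurable (haar_pair n) (\<lambda>w. fst w $$ (i, j))" "bounded_measurable (haar_pair n) (\<lambda>w. snd w $$ (i, j))"
proof -
  have m: "(\<lambda>Q. Q $$ (i, j)) \<in> borel_measurable (haar_orth n)"
    using measurable_orth_borel_entry[OF assms] measurable_cong_sets[OF haar_orth_facts(2)[of n] refl] by blast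
  show "bounded_measurable (haar_pair n) (\<lambda>w. fst w $$ (i, j))"
    unfolding bounded_measurable_def space_haar_pair
    using measurable_compose[OF measurable_fst m] abs_orth_entry_le[OF _ assms] by auto
  show "bounded_measurable (haar_pair n) (\<lambda>w. snd w $$ (i, j))"
    unfolding bounded_measurable_def space_haar_pair
    using measurable_compose[OF measurable_snd m] abs_orth_entry_le[OF _ assms] by auto
qed

lemma bounded_measurable_gram_det:
  assumes C: "C \<in> carrier_mat n n" and D: "D \<in> carrier_mat n n"
  shows "bounded_measurable (haar_pair n) (\<lambda>w. gram_det n x (C + fst w * D * (snd w)\<^sup>T))"
proof -
  let ?b = "bounded_measurable (haar_pair n)"
  have Q: "fst w \<in> carrier_mat n n" and Rt: "(snd w)\<^sup>T \<in> carrier_mat n n" if "w \<in> space (haar_pair n)" for w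
    using that by (auto simp: space_haar_pair orth_group_def)
  have Rte: "?b (\<lambda>w. (snd w)\<^sup>T $$ (i, j))" if "i < n" "j < n" for i j
    using bounded_measurable_haar_entries(2)[OF that(2,1)]
    by (rule bounded_measurable_cong) (use that in \<open>auto simp: space_haar_pair orth_group_def\<close>)
  have QD: "fst w * D \<in> carrier_mat n n" if "w \<in> space (haar_pair n)" for w
    by (rule mult_carrier_mat[OF Q[OF that] D])
  have QDe: "?b (\<lambda>w. (fst w * D) $$ (i, j))" if "i < n" "j < n" for i j
    by (rule bounded_measurable_mat_mult[OF Q _ bounded_measurable_haar_entries(1) _ that])
      (auto intro: D bounded_measurable_const)
  have QDR: "fst w * D * (snd w)\<^sup>T \<in> carrier_mat n n" if "w \<in> space (haar_pair n)" for w
    by (rule mult_carrier_mat[OF QD[OF that] Rt[OF that]])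
  have QDRe: "?b (\<lambda>w. (fst w * D * (snd w)\<^sup>T) $$ (i, j))" if "i < n" "j < n" for i j
    by (rule bounded_measurable_mat_mult[OF QD Rt QDe Rte that])
  let ?M = "\<lambda>w. C + fst w * D * (snd w)\<^sup>T"
  have M: "?M w \<in> carrier_mat n n" if "w \<in> space (haar_pair n)" for w
    using QDR[OF that] by simp
  have Mt: "(?M w)\<^sup>T \<in> carrier_mat n n" if "w \<in> space (haar_pair n)" for w
    unfolding transpose_carrier_mat by (rule M[OF that])
  have Me: "?b (\<lambda>w. ?M w $$ (i, j))" if "i < n" "j < n" for i j
  proof (rule bounded_measurable_cong)
    show "?b (\<lambda>w. C $$ (i, j) + (fst w * D * (snd w)\<^sup>T) $$ (i, j))"
      using that by (intro bounded_measurable_add bounded_measurable_const QDRe)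
    show "C $$ (i, j) + (fst w * D * (snd w)\<^sup>T) $$ (i, j) = ?M w $$ (i, j)" if w: "w \<in> space (haar_pair n)" for w
      using QDR[OF w] \<open>i < n\<close> \<open>j < n\<close> by (metis carrier_matD index_add_mat(1))
  qed
  have Mte: "?b (\<lambda>w. (?M w)\<^sup>T $$ (i, j))" if "i < n" "j < n" for i j
    using Me[OF that(2,1)]
  proof (rule bounded_measurable_cong)
    show "?M w $$ (j, i) = (?M w)\<^sup>T $$ (i, j)" if w: "w \<in> space (haar_pair n)" for w
      using M[OF w] \<open>i < n\<close> \<open>j < n\<close> by (metis carrier_matD index_transpose_mat(1))
  qed
  have MMe: "?b (\<lambda>w. (?M w * (?M w)\<^sup>T) $$ (i, j))" if "i < n" "j < n" for i j
    by (rule bounded_measurable_mat_mult[OF M Mt Me Mte that])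
  show ?thesis
    unfolding gram_det_def
  proof (rule bounded_measurable_det)
    show "x \<cdot>\<^sub>m 1\<^sub>m n - ?M w * (?M w)\<^sup>T \<in> carrier_mat n n" if "w \<in> space (haar_pair n)" for w
      by (rule gram_matrix_carrier[OF M[OF that]])
    fix i j assume ij: "i < n" "j < n"
    show "?b (\<lambda>w. (x \<cdot>\<^sub>m 1\<^sub>m n - ?M w * (?M w)\<^sup>T) $$ (i, j))"
    proof (rule bounded_measurable_cong)
      show "?b (\<lambda>w. (x \<cdot>\<^sub>m 1\<^sub>m n) $$ (i, j) + (- 1) * (?M w * (?M w)\<^sup>T) $$ (i, j))"
        by (intro bounded_measurable_add bounded_measurable_mult bounded_measurable_const MMe[OF ij])
      fix w assume w: "w \<in> space (haar_pair n)"
      have "?M w * (?M w)\<^sup>T \<in> carrier_mat n n" using M[OF w] by simp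
      then have "(x \<cdot>\<^sub>m 1\<^sub>m n - ?M w * (?M w)\<^sup>T) $$ (i, j) = (x \<cdot>\<^sub>m 1\<^sub>m n) $$ (i, j) - (?M w * (?M w)\<^sup>T) $$ (i, j)"
        using ij by (metis carrier_matD index_minus_mat(1))
      then show "(x \<cdot>\<^sub>m 1\<^sub>m n) $$ (i, j) + (- 1) * (?M w * (?M w)\<^sup>T) $$ (i, j) = (x \<cdot>\<^sub>m 1\<^sub>m n - ?M w * (?M w)\<^sup>T) $$ (i, j)"
        by simp
    qed
  qed
qed

text \<open>The number of pairs of signed permutation matrices of size \<open>n\<close>, counted
  through their joint encoding.\<close>

definition num_signed_perms :: "nat \<Rightarrow> real" where
  "num_signed_perms n = real (card (block_perms n)) * 2 ^ (n + n)"

lemma num_signed_perms_pos: "num_signed_perms n > 0"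
proof -
  have "id \<in> block_perms n" by (simp add: block_perms_def permutes_id)
  then have "card (block_perms n) > 0" by (auto simp: card_gt_0_iff)
  then show ?thesis by (simp add: num_signed_perms_def)
qed

lemma sum_signed_perms_const: "(\<Sum>\<rho>\<in>block_perms n. \<Sum>T\<in>Pow {..<n + n}. c) = num_signed_perms n * c"
  by (simp add: num_signed_perms_def card_Pow)

text \<open>Left invariance in both variables permits averaging the integrand over signed
  permutations. The average at the point \<open>Q\<close>, \<open>R\<close> is
  \<open>signed_perm_sum\<close> for \<open>Q * D * R\<^sup>T\<close>, and this has the same value
  as for \<open>D\<close>.\<close>

lemma haar_integral_gram_det:
  assumes C: "C \<in> carrier_mat n n" and D: "D \<in> carrier_mat n n"
  shows "(\<integral>w. gram_det n x (C + fst w * D * (snd w)\<^sup>T) \<partial>haar_pair n) = signed_perm_sum n x C D / num_signed_perms n"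
proof -
  let ?H = "haar_pair n"
  let ?F = "\<lambda>w. gram_det n x (C + fst w * D * (snd w)\<^sup>T)"
  let ?a = "\<lambda>\<rho> T (Q, R). (row_signed_perm n \<rho> T * Q, col_signed_perm n \<rho> T * R)"
  interpret H: prob_space ?H by (rule prob_space_haar_pair)
  have F: "?F \<in> borel_measurable ?H"
    using bounded_measurable_gram_det[OF C D] by (simp add: bounded_measurable_def)
  obtain B where B: "\<And>w. w \<in> space ?H \<Longrightarrow> \<bar>?F w\<bar> \<le> B"
    using bounded_measurable_gram_det[OF C D, of x] by (auto simp: bounded_measurable_def)
  have mm: "(\<lambda>Q. U * Q) \<in> measurable (haar_orth n) (haar_orth n)" if "U \<in> orth_group n" for U
    using measurable_orth_mult[OF that] measurable_cong_sets[OF haar_orth_facts(2)[of n] haar_orth_facts(2)[of n]] by blast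
  have inv: "(\<integral>w. ?F (?a \<rho> T w) \<partial>?H) = (\<integral>w. ?F w \<partial>?H)" and meas: "(\<lambda>w. ?F (?a \<rho> T w)) \<in> borel_measurable ?H"
    and int: "integrable ?H (\<lambda>w. ?F (?a \<rho> T w))"
    if \<rho>: "\<rho> \<in> block_perms n" for \<rho> T
  proof -
    note U = signed_perms_orth[OF \<rho>, of T]
    have d: "distr ?H ?H (?a \<rho> T) = ?H"
    proof -
      have "distr (haar_orth n) (haar_orth n) (\<lambda>Q. row_signed_perm n \<rho> T * Q) \<Otimes>\<^sub>M
        distr (haar_orth n) (haar_orth n) (\<lambda>Q. col_signed_perm n \<rho> T * Q) = distr ?H ?H (?a \<rho> T)"
        by (rule pair_measure_distr[OF mm[OF U(1)] mm[OF U(2)]])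
          (simp add: haar_orth_facts(4)[OF U(2)] prob_space_imp_sigma_finite haar_orth_facts(1))
      then show ?thesis by (simp add: haar_orth_facts(4)[OF U(1)] haar_orth_facts(4)[OF U(2)])
    qed
    have ma: "?a \<rho> T \<in> measurable ?H ?H"
      unfolding case_prod_beta
      by (intro measurable_Pair measurable_compose[OF measurable_fst mm[OF U(1)]] measurable_compose[OF measurable_snd mm[OF U(2)]])
    show "(\<integral>w. ?F (?a \<rho> T w) \<partial>?H) = (\<integral>w. ?F w \<partial>?H)"
      using integral_distr[OF ma F] unfolding d by simp
    show m: "(\<lambda>w. ?F (?a \<rho> T w)) \<in> borel_measurable ?H" by (rule measurable_compose[OF ma F])
    show "integrable ?H (\<lambda>w. ?F (?a \<rho> T w))"
      using B measurable_space[OF ma] by (intro H.integrable_const_bound[where B = B] m AE_I2) simp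
  qed
  have "num_signed_perms n * (\<integral>w. ?F w \<partial>?H) = (\<Sum>\<rho>\<in>block_perms n. \<Sum>T\<in>Pow {..<n + n}. \<integral>w. ?F w \<partial>?H)"
    by (rule sum_signed_perms_const[symmetric])
  also have "\<dots> = (\<Sum>\<rho>\<in>block_perms n. \<Sum>T\<in>Pow {..<n + n}. \<integral>w. ?F (?a \<rho> T w) \<partial>?H)"
    by (intro sum.cong refl inv[symmetric])
  also have "\<dots> = (\<Sum>\<rho>\<in>block_perms n. \<integral>w. (\<Sum>T\<in>Pow {..<n + n}. ?F (?a \<rho> T w)) \<partial>?H)"
    using int by (intro sum.cong refl Bochner_Integration.integral_sum[symmetric])
  also have "\<dots> = (\<integral>w. (\<Sum>\<rho>\<in>block_perms n. \<Sum>T\<in>Pow {..<n + n}. ?F (?a \<rho> T w)) \<partial>?H)"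
    using int by (intro Bochner_Integration.integral_sum[symmetric] Bochner_Integration.integrable_sum)
  also have "\<dots> = (\<integral>w. signed_perm_sum n x C D \<partial>?H)"
  proof (rule Bochner_Integration.integral_cong[OF refl])
    fix w assume "w \<in> space ?H"
    then obtain Q R where w: "w = (Q, R)" "Q \<in> orth_group n" "R \<in> orth_group n" by (auto simp: space_haar_pair)
    then have c: "Q \<in> carrier_mat n n" "R \<in> carrier_mat n n" by (auto simp: orth_group_def)
    have QDR: "Q * D * R\<^sup>T \<in> carrier_mat n n" using c D by (intro mult_carrier_mat[of _ n n]) auto
    have "?F (?a \<rho> T w) = gram_det n x (C + row_signed_perm n \<rho> T * (Q * D * R\<^sup>T) * (col_signed_perm n \<rho> T)\<^sup>T)" for \<rho> T
      using c D by (simp add: w square_mat_simps[where d = n])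
    then have "(\<Sum>\<rho>\<in>block_perms n. \<Sum>T\<in>Pow {..<n + n}. ?F (?a \<rho> T w)) = signed_perm_sum n x C (Q * D * R\<^sup>T)"
      by (simp add: signed_perm_sum_gram_det[OF C QDR])
    also have "\<dots> = signed_perm_sum n x C D"
      by (rule signed_perm_sum_cong[OF C C QDR D refl char_poly_orth_conj[OF D w(2,3)]])
    finally show "(\<Sum>\<rho>\<in>block_perms n. \<Sum>T\<in>Pow {..<n + n}. ?F (?a \<rho> T w)) = signed_perm_sum n x C D" .
  qed
  also have "\<dots> = signed_perm_sum n x C D" by (simp add: H.prob_space)
  finally show ?thesis using num_signed_perms_pos[of n] by (simp add: field_simps)
qed

text \<open>Any \<open>C\<close> and \<open>D\<close> with the given characteristic polynomials may
  serve as witnesses: \<open>signed_perm_sum_cong\<close> makes the value independent of them, and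
  this is the uniqueness that the definite description requires.\<close>

lemma poly_asym_add_conv:
  assumes C: "C \<in> carrier_mat n n" and D: "D \<in> carrier_mat n n"
    and p: "p = char_poly (C * C\<^sup>T)" and q: "q = char_poly (D * D\<^sup>T)"
  shows "poly (asym_add_conv n p q) x = signed_perm_sum n x C D / num_signed_perms n"
proof -
  have haar: "(\<integral>(Q, R). poly (char_poly ((C + Q * D * R\<^sup>T) * (C + Q * D * R\<^sup>T)\<^sup>T)) x \<partial>haar_pair n) =
      signed_perm_sum n x C D / num_signed_perms n"
    if C: "C \<in> carrier_mat n n" and D: "D \<in> carrier_mat n n" for C D x
  proof -
    have "(\<integral>(Q, R). poly (char_poly ((C + Q * D * R\<^sup>T) * (C + Q * D * R\<^sup>T)\<^sup>T)) x \<partial>haar_pair n) =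
      (\<integral>w. gram_det n x (C + fst w * D * (snd w)\<^sup>T) \<partial>haar_pair n)"
    proof (rule Bochner_Integration.integral_cong[OF refl], clarsimp simp: space_haar_pair)
      fix Q R assume "Q \<in> orth_group n" "R \<in> orth_group n"
      then have "C + Q * D * R\<^sup>T \<in> carrier_mat n n"
        using C D by (intro add_carrier_mat mult_carrier_mat[of _ n n]) (auto simp: orth_group_def)
      then show "poly (char_poly ((C + Q * D * R\<^sup>T) * (C + Q * D * R\<^sup>T)\<^sup>T)) x = gram_det n x (C + Q * D * R\<^sup>T)"
        by (rule poly_char_poly_gram)
    qed
    then show ?thesis by (simp add: haar_integral_gram_det[OF C D])
  qed
  \<comment> \<open>The average is formed in the ring of polynomials, since the description asks for
    a polynomial and not for a function of \<open>x\<close>.\<close>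
  define r where "r = Polynomial.smult (1 / num_signed_perms n) (\<Sum>\<rho>\<in>block_perms n. \<Sum>T\<in>Pow {..<n + n}.
     let M = C + row_signed_perm n \<rho> T * D * (col_signed_perm n \<rho> T)\<^sup>T in char_poly (M * M\<^sup>T))"
  have r: "poly r x = signed_perm_sum n x C D / num_signed_perms n" for x
    by (simp add: r_def signed_perm_sum_def poly_sum Let_def)
  have "asym_add_conv n p q = r"
    unfolding asym_add_conv_def
  proof (rule the_equality)
    show "\<exists>C\<in>carrier_mat n n. \<exists>D\<in>carrier_mat n n. p = char_poly (C * C\<^sup>T) \<and> q = char_poly (D * D\<^sup>T) \<and>
       (\<forall>x. poly r x = (\<integral>(Q, R). poly (char_poly ((C + Q * D * R\<^sup>T) * (C + Q * D * R\<^sup>T)\<^sup>T)) x \<partial>haar_pair n))"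
      using C D p q by (intro bexI[of _ C] bexI[of _ D]) (simp_all add: haar r)
  next
    fix r' assume "\<exists>C\<in>carrier_mat n n. \<exists>D\<in>carrier_mat n n. p = char_poly (C * C\<^sup>T) \<and> q = char_poly (D * D\<^sup>T) \<and>
       (\<forall>x. poly r' x = (\<integral>(Q, R). poly (char_poly ((C + Q * D * R\<^sup>T) * (C + Q * D * R\<^sup>T)\<^sup>T)) x \<partial>haar_pair n))"
    then obtain C' D' where *: "C' \<in> carrier_mat n n" "D' \<in> carrier_mat n n" "p = char_poly (C' * C'\<^sup>T)" "q = char_poly (D' * D'\<^sup>T)"
      "\<And>x. poly r' x = signed_perm_sum n x C' D' / num_signed_perms n" by (auto simp: haar)
    have "poly r' = poly r"
    proof
      fix x
      have "signed_perm_sum n x C' D' = signed_perm_sum n x C D"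
        using * p q by (intro signed_perm_sum_cong C D) auto
      then show "poly r' x = poly r x" by (simp add: * r)
    qed
    then show "r' = r" by (simp add: poly_eq_poly_eq_iff)
  qed
  then show ?thesis by (simp add: r)
qed

section \<open>The expectation over permutation matrices\<close>

lemma perm_mats_nonempty: "perm_mats d \<noteq> {}"
  unfolding perm_mats_eq using permutes_id by blast

lemma pair_pmf_of_set:
  assumes "finite A" "A \<noteq> {}" "finite B" "B \<noteq> {}"
  shows "pair_pmf (pmf_of_set A) (pmf_of_set B) = pmf_of_set (A \<times> B)"
proof (rule pmf_eqI)
  fix z :: "'a \<times> 'b"
  show "pmf (pair_pmf (pmf_of_set A) (pmf_of_set B)) z = pmf (pmf_of_set (A \<times> B)) z"
    using assms by (cases z) (simp add: pmf_pair indicator_def card_cartesian_product)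
qed

text \<open>Conjugation by a direct sum keeps the bipartite form, so the random matrix of double
  size is governed by a single \<open>d\<close> by \<open>d\<close> matrix.\<close>

lemma bipartite_mat_conj:
  assumes A: "A \<in> carrier_mat d d" and B: "B \<in> carrier_mat d d" and P: "P \<in> carrier_mat d d" and S: "S \<in> carrier_mat d d"
  shows "bipartite_mat d A + direct_sum_mat d P S * bipartite_mat d B * (direct_sum_mat d P S)\<^sup>T =
    bipartite_mat d (A + P * B * S\<^sup>T)"
proof -
  have PB: "P * B \<in> carrier_mat d d" and SB: "S * B\<^sup>T \<in> carrier_mat d d"
    and PBS: "P * B * S\<^sup>T \<in> carrier_mat d d" and SBP: "S * B\<^sup>T * P\<^sup>T \<in> carrier_mat d d"
    using P B S by (auto simp: mult_carrier_mat[of _ d d _ d])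
  have "direct_sum_mat d P S * bipartite_mat d B = four_block_mat (0\<^sub>m d d) (P * B) (S * B\<^sup>T) (0\<^sub>m d d)"
    unfolding direct_sum_mat_def bipartite_mat_def
    using P S B PB SB by (subst mult_four_block_mat[of _ d d _ d _ d _ _ d _ d]) auto
  moreover have "(direct_sum_mat d P S)\<^sup>T = four_block_mat P\<^sup>T (0\<^sub>m d d) (0\<^sub>m d d) S\<^sup>T"
    unfolding direct_sum_mat_def using P S by (subst transpose_four_block_mat[of _ d d _ d _ d]) auto
  moreover have "four_block_mat (0\<^sub>m d d) X Y (0\<^sub>m d d) * four_block_mat P\<^sup>T (0\<^sub>m d d) (0\<^sub>m d d) S\<^sup>T =
     four_block_mat (0\<^sub>m d d) (X * S\<^sup>T) (Y * P\<^sup>T) (0\<^sub>m d d)"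
    if "X \<in> carrier_mat d d" "Y \<in> carrier_mat d d" for X Y
    using P S that by (subst mult_four_block_mat[of _ d d _ d _ d _ _ d _ d]) auto
  ultimately have "direct_sum_mat d P S * bipartite_mat d B * (direct_sum_mat d P S)\<^sup>T =
     four_block_mat (0\<^sub>m d d) (P * B * S\<^sup>T) (S * B\<^sup>T * P\<^sup>T) (0\<^sub>m d d)"
    using PB SB by (simp only:)
  moreover have "S * B\<^sup>T * P\<^sup>T = (P * B * S\<^sup>T)\<^sup>T"
    using P S B PB by (simp add: square_mat_simps[where d = d])
  moreover have "four_block_mat (0\<^sub>m d d) A A\<^sup>T (0\<^sub>m d d) + four_block_mat (0\<^sub>m d d) X X\<^sup>T (0\<^sub>m d d) =
      four_block_mat (0\<^sub>m d d) (A + X) (A + X)\<^sup>T (0\<^sub>m d d)" if "X \<in> carrier_mat d d" for X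
    using A that by (subst add_four_block_mat[of _ d d _ d _ d]) (auto simp: transpose_add[of _ d d])
  ultimately show ?thesis
    unfolding bipartite_mat_def[of d A] bipartite_mat_def[of d "A + _"] using PBS by (simp only:)
qed

text \<open>The spectrum of the bipartite matrix consists of the singular values of \<open>M\<close>
  with both signs, which is where the substitution of the square comes from.\<close>

lemma poly_char_poly_bipartite:
  assumes M: "M \<in> carrier_mat d d"
  shows "poly (char_poly (bipartite_mat d M)) x = gram_det d (x\<^sup>2) M"
proof -
  have bc: "bipartite_mat d M \<in> carrier_mat (d + d) (d + d)" using M by (simp add: bipartite_mat_def)
  have "x \<cdot>\<^sub>m 1\<^sub>m (d + d) - bipartite_mat d M = four_block_mat (x \<cdot>\<^sub>m 1\<^sub>m d) (- M) (- M\<^sup>T) (x \<cdot>\<^sub>m 1\<^sub>m d)"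
    using M by (intro eq_matI) (auto simp: bipartite_mat_def)
  then have "poly (char_poly (bipartite_mat d M)) x = det (four_block_mat (x \<cdot>\<^sub>m 1\<^sub>m d) (- M) (- M\<^sup>T) (x \<cdot>\<^sub>m 1\<^sub>m d))"
    by (simp add: poly_char_poly[OF bc])
  also have "\<dots> = det ((x \<cdot>\<^sub>m 1\<^sub>m d) * (x \<cdot>\<^sub>m 1\<^sub>m d) - - M * - M\<^sup>T)"
    using M by (intro det_four_block_mat) auto
  also have "(x \<cdot>\<^sub>m 1\<^sub>m d) * (x \<cdot>\<^sub>m 1\<^sub>m d) - - M * - M\<^sup>T = x\<^sup>2 \<cdot>\<^sub>m 1\<^sub>m d - M * M\<^sup>T"
    using M by (intro eq_matI) (auto simp: power2_eq_square)
  finally show ?thesis by (simp add: gram_det_def)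
qed

section \<open>Matrices with constant row and column sums\<close>

text \<open>The eigenvector condition for \<open>M\<close> and for its transpose, in terms of
  entries.\<close>

definition fixes_ones :: "nat \<Rightarrow> real mat \<Rightarrow> real \<Rightarrow> bool" where
  "fixes_ones d M c \<longleftrightarrow> M \<in> carrier_mat d d \<and> (\<forall>i<d. (\<Sum>j<d. M $$ (i, j)) = c) \<and> (\<forall>j<d. (\<Sum>i<d. M $$ (i, j)) = c)"

lemma fixes_onesI:
  assumes M: "M \<in> carrier_mat d d" and "M *\<^sub>v ones_vec d = c \<cdot>\<^sub>v ones_vec d" and "M\<^sup>T *\<^sub>v ones_vec d = c \<cdot>\<^sub>v ones_vec d"
  shows "fixes_ones d M c"
proof -
  have row: "(\<Sum>j<d. N $$ (i, j)) = c" if N: "N \<in> carrier_mat d d" "N *\<^sub>v ones_vec d = c \<cdot>\<^sub>v ones_vec d" and i: "i < d" for N i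
  proof -
    have "vec_index (N *\<^sub>v ones_vec d) i = (\<Sum>j<d. N $$ (i, j))"
      using N(1) i by (simp add: ones_vec_def scalar_prod_def atLeast0LessThan)
    then show ?thesis using N(2) i by (simp add: ones_vec_def)
  qed
  show ?thesis
    unfolding fixes_ones_def using M row[OF M assms(2)] row[of "M\<^sup>T", OF _ assms(3)] by simp
qed

lemma fixes_ones_mult:
  assumes M: "fixes_ones d M c" and N: "fixes_ones d N e"
  shows "fixes_ones d (M * N) (c * e)"
proof -
  have c: "M \<in> carrier_mat d d" "N \<in> carrier_mat d d" using assms by (auto simp: fixes_ones_def)
  have "(\<Sum>j<d. (M * N) $$ (i, j)) = c * e" if i: "i < d" for i
  proof -
    have "(\<Sum>j<d. (M * N) $$ (i, j)) = (\<Sum>j<d. \<Sum>k<d. M $$ (i, k) * N $$ (k, j))"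
      by (intro sum.cong refl index_mult_square[OF c i]) simp
    also have "\<dots> = (\<Sum>k<d. M $$ (i, k) * (\<Sum>j<d. N $$ (k, j)))"
      unfolding sum_distrib_left by (rule sum.swap)
    also have "\<dots> = (\<Sum>k<d. M $$ (i, k) * e)"
      using N by (intro sum.cong refl) (simp add: fixes_ones_def)
    also have "\<dots> = c * e" using M i by (simp add: fixes_ones_def flip: sum_distrib_right)
    finally show ?thesis .
  qed
  moreover have "(\<Sum>i<d. (M * N) $$ (i, j)) = c * e" if j: "j < d" for j
  proof -
    have "(\<Sum>i<d. (M * N) $$ (i, j)) = (\<Sum>i<d. \<Sum>k<d. M $$ (i, k) * N $$ (k, j))"
      by (intro sum.cong refl index_mult_square[OF c _ j]) simp
    also have "\<dots> = (\<Sum>k<d. (\<Sum>i<d. M $$ (i, k)) * N $$ (k, j))"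
      unfolding sum_distrib_right by (rule sum.swap)
    also have "\<dots> = (\<Sum>k<d. c * N $$ (k, j))"
      using M by (intro sum.cong refl) (simp add: fixes_ones_def)
    also have "\<dots> = c * e" using N j by (simp add: fixes_ones_def flip: sum_distrib_left)
    finally show ?thesis .
  qed
  ultimately show ?thesis unfolding fixes_ones_def using c by (simp add: mult_carrier_mat[of _ d d _ d])
qed

lemma fixes_ones_perm_mats:
  assumes "P \<in> perm_mats d"
  shows "fixes_ones d P 1"
proof -
  obtain \<sigma> where \<sigma>: "\<sigma> permutes {..<d}" "P = perm_mat d \<sigma>" using assms by (auto simp: perm_mats_eq)
  have s: "\<sigma> j < d" if "j < d" for j using permutes_in_image[OF \<sigma>(1), of j] that by simp
  have "(\<Sum>j<d. P $$ (i, j)) = 1" if i: "i < d" for i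
  proof -
    have "(\<Sum>j<d. P $$ (i, j)) = (\<Sum>j<d. if i = \<sigma> j then 1 else 0)"
      using i by (simp add: \<sigma>(2) perm_mat_def)
    also have "\<dots> = (\<Sum>j<d. if i = j then 1 else 0)"
      using sum.permute[OF \<sigma>(1), of "\<lambda>j. if i = j then 1 else 0 :: real"] by (simp add: comp_def)
    finally show ?thesis using i by simp
  qed
  moreover have "(\<Sum>i<d. P $$ (i, j)) = 1" if j: "j < d" for j
  proof -
    have "(\<Sum>i<d. P $$ (i, j)) = (\<Sum>i<d. if i = \<sigma> j then 1 else 0)"
      using j by (simp add: \<sigma>(2) perm_mat_def)
    then show ?thesis using s[OF j] by simp
  qed
  ultimately show ?thesis using perm_mats_carrier[OF assms] by (simp add: fixes_ones_def)
qed

text \<open>The first column of \<open>H\<close> is a common eigenvector of \<open>X\<close> and its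
  transpose, so in the basis given by \<open>H\<close> the first row and the first column of
  \<open>X\<close> vanish off the diagonal.\<close>

lemma fixes_ones_corner:
  assumes X: "fixes_ones (Suc n) X a" and H: "H \<in> orth_group (Suc n)"
    and col: "\<And>i. i < Suc n \<Longrightarrow> H $$ (i, 0) = 1 / sqrt (Suc n)"
  obtains C where "C \<in> carrier_mat n n" "X = H * corner_mat n a C * H\<^sup>T"
proof -
  let ?d = "Suc n"
  note c = orth_group_cancel[OF H]
  have Xc: "X \<in> carrier_mat ?d ?d" using X by (simp add: fixes_ones_def)
  define Z where "Z = H\<^sup>T * X * H"
  have Zc: "Z \<in> carrier_mat ?d ?d" unfolding Z_def using c Xc by (intro mult_carrier_mat) auto
  have entry: "Z $$ (i, j) = (\<Sum>r<?d. \<Sum>s<?d. X $$ (r, s) * (H $$ (r, i) * H $$ (s, j)))"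
    if "i < ?d" "j < ?d" for i j
    unfolding Z_def index_mult3[OF c(2) Xc c(1) that] using c(1) that by (intro sum.cong refl) auto
  have orth0: "(\<Sum>r<?d. H $$ (r, i) * (1 / sqrt ?d)) = (if i = 0 then 1 else 0)" if "i < ?d" for i
  proof -
    have "(\<Sum>r<?d. H $$ (r, i) * (1 / sqrt ?d)) = (\<Sum>r<?d. H $$ (r, i) * H $$ (r, 0))"
      by (intro sum.cong refl) (simp only: col lessThan_iff)
    then show ?thesis using orth_group_columns[OF H that, of 0] by simp
  qed
  have col0: "Z $$ (i, 0) = (if i = 0 then a else 0)" if i: "i < ?d" for i
  proof -
    have "Z $$ (i, 0) = (\<Sum>r<?d. \<Sum>s<?d. X $$ (r, s) * (H $$ (r, i) * (1 / sqrt ?d)))"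
      unfolding entry[OF i zero_less_Suc] by (intro sum.cong refl) (simp only: col lessThan_iff)
    also have "\<dots> = (\<Sum>r<?d. a * (H $$ (r, i) * (1 / sqrt ?d)))"
      unfolding sum_distrib_right[symmetric] using X by (intro sum.cong refl) (simp only: fixes_ones_def lessThan_iff)
    also have "\<dots> = a * (if i = 0 then 1 else 0)"
      unfolding sum_distrib_left[symmetric] orth0[OF i] ..
    finally show ?thesis by simp
  qed
  have row0: "Z $$ (0, j) = (if j = 0 then a else 0)" if j: "j < ?d" for j
  proof -
    have "Z $$ (0, j) = (\<Sum>r<?d. \<Sum>s<?d. X $$ (r, s) * (H $$ (s, j) * (1 / sqrt ?d)))"
      unfolding entry[OF zero_less_Suc j] by (intro sum.cong refl) (simp only: col lessThan_iff mult.commute)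
    also have "\<dots> = (\<Sum>s<?d. (\<Sum>r<?d. X $$ (r, s)) * (H $$ (s, j) * (1 / sqrt ?d)))"
      unfolding sum_distrib_right by (rule sum.swap)
    also have "\<dots> = (\<Sum>s<?d. a * (H $$ (s, j) * (1 / sqrt ?d)))"
      using X by (intro sum.cong refl) (simp only: fixes_ones_def lessThan_iff)
    also have "\<dots> = a * (if j = 0 then 1 else 0)"
      unfolding sum_distrib_left[symmetric] orth0[OF j] ..
    finally show ?thesis by simp
  qed
  let ?C = "mat n n (\<lambda>(i, j). Z $$ (Suc i, Suc j))"
  have "corner_mat n a ?C = Z"
  proof (rule eq_matI)
    fix i j assume "i < dim_row Z" "j < dim_col Z"
    then have ij: "i < ?d" "j < ?d" using Zc by auto
    show "corner_mat n a ?C $$ (i, j) = Z $$ (i, j)"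
      using ij col0[OF ij(1)] row0[OF ij(2)] by (subst index_corner_mat) auto
  qed (use Zc in \<open>auto simp: corner_mat_def\<close>)
  moreover have "H * Z * H\<^sup>T = X"
    unfolding Z_def using c Xc by (simp add: square_mat_simps[where d = ?d])
  ultimately show ?thesis by (intro that[of ?C]) auto
qed

lemma gram_det_conj_corner:
  assumes H: "H \<in> orth_group (Suc n)" and U: "U \<in> carrier_mat n n"
  shows "gram_det (Suc n) x (H * corner_mat n c U * H\<^sup>T) = (x - c\<^sup>2) * gram_det n x U"
proof -
  have HU: "H * corner_mat n c U \<in> carrier_mat (Suc n) (Suc n)"
    using orth_group_cancel(1)[OF H] U by (intro mult_carrier_mat) auto
  have "gram_det (Suc n) x (H * corner_mat n c U * H\<^sup>T) = gram_det (Suc n) x (corner_mat n c U)"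
    using gram_det_orth_right[OF orth_group_transpose[OF H] HU] gram_det_orth_left[OF H, of "corner_mat n c U"] U by simp
  then show ?thesis by (simp add: gram_det_corner_mat[OF U])
qed

text \<open>The all-ones direction contributes the linear factor, which can be cancelled; the
  cofactor \<open>p\<close> is thus realised by an actual matrix of size \<open>n\<close>, as the
  convolution demands.\<close>

lemma char_poly_corner_cancel:
  assumes H: "H \<in> orth_group (Suc n)" and C: "C \<in> carrier_mat n n" and X: "X = H * corner_mat n a C * H\<^sup>T"
    and p: "char_poly (X * X\<^sup>T) = [:- (a\<^sup>2), 1:] * p"
  shows "char_poly (C * C\<^sup>T) = p"
proof -
  have Xc: "X \<in> carrier_mat (Suc n) (Suc n)"
    unfolding X using orth_group_cancel(1,2)[OF H] C by (intro mult_carrier_mat) auto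
  have "poly (char_poly (X * X\<^sup>T)) x = (x - a\<^sup>2) * gram_det n x C" for x
    unfolding poly_char_poly_gram[OF Xc] by (simp only: X gram_det_conj_corner[OF H C])
  then have "poly ([:- (a\<^sup>2), 1:] * char_poly (C * C\<^sup>T)) x = poly (char_poly (X * X\<^sup>T)) x" for x
    by (simp add: poly_char_poly_gram[OF C] algebra_simps)
  then have "[:- (a\<^sup>2), 1:] * char_poly (C * C\<^sup>T) = [:- (a\<^sup>2), 1:] * p"
    unfolding p[symmetric] by (simp add: poly_eq_poly_eq_iff[symmetric] fun_eq_iff)
  then show ?thesis by (subst (asm) mult_cancel_left) simp
qed

text \<open>The double sum with signed permutations inserted around \<open>B\<close> is evaluated in
  two ways. For fixed signed permutations they disappear by invariance; for fixed \<open>P\<close>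
  and \<open>S\<close>, summation over them gives a value independent of \<open>P\<close> and
  \<open>S\<close>.\<close>

lemma perm_double_sum:
  assumes A: "fixes_ones (Suc n) A a" and B: "fixes_ones (Suc n) B b"
    and H: "H \<in> orth_group (Suc n)" and col: "\<And>i. i < Suc n \<Longrightarrow> H $$ (i, 0) = 1 / sqrt (Suc n)"
    and C: "C \<in> carrier_mat n n" and AC: "A = H * corner_mat n a C * H\<^sup>T"
    and D: "D \<in> carrier_mat n n" and BD: "B = H * corner_mat n b D * H\<^sup>T"
  shows "num_signed_perms n * (\<Sum>P\<in>perm_mats (Suc n). \<Sum>S\<in>perm_mats (Suc n). gram_det (Suc n) y (A + P * B * S\<^sup>T)) =
    (real (card (perm_mats (Suc n))))\<^sup>2 * ((y - (a + b)\<^sup>2) * signed_perm_sum n y C D)"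
proof -
  let ?d = "Suc n"
  let ?PM = "perm_mats ?d"
  let ?g = "gram_det ?d y"
  let ?E = "\<lambda>U. H * corner_mat n 1 U * H\<^sup>T"
  let ?U = "\<lambda>\<rho> T. ?E (row_signed_perm n \<rho> T)" and ?V = "\<lambda>\<rho> T. ?E (col_signed_perm n \<rho> T)"
  note h = orth_group_cancel[OF H]
  have Ac: "A \<in> carrier_mat ?d ?d" and Bc: "B \<in> carrier_mat ?d ?d" using A B by (auto simp: fixes_ones_def)
  have Ec: "?E U \<in> carrier_mat ?d ?d" if "U \<in> carrier_mat n n" for U
    using h(1,2) corner_mat_carrier[OF that] by (simp add: mult_carrier_mat[of _ ?d ?d _ ?d])
  note m = mult_carrier_mat[of _ ?d ?d _ ?d] perm_mats_carrier[of _ ?d]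
  have swap: "(\<Sum>P\<in>?PM. \<Sum>S\<in>?PM. ?g (A + P * (?U \<rho> T * B * (?V \<rho> T)\<^sup>T) * S\<^sup>T)) =
     (\<Sum>P\<in>?PM. \<Sum>S\<in>?PM. ?g (A + P * B * S\<^sup>T))" if \<rho>: "\<rho> \<in> block_perms n" for \<rho> T
  proof -
    have Uc: "?U \<rho> T \<in> carrier_mat ?d ?d" and Vc: "?V \<rho> T \<in> carrier_mat ?d ?d" by (simp_all add: Ec)
    obtain \<sigma> e where "\<sigma> permutes {..<n}" "\<And>i. e i \<in> {- 1, 1}" "row_signed_perm n \<rho> T = signed_perm_mat n \<sigma> e"
      using row_signed_perm_eq[OF \<rho>] by metis
    then have U: "perm_invariant ?d y (?U \<rho> T)"
      using perm_invariant_corner_signed_perm[OF H col, of \<sigma> e y] by simp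
    obtain \<sigma> e where "\<sigma> permutes {..<n}" "\<And>i. e i \<in> {- 1, 1}" "col_signed_perm n \<rho> T = signed_perm_mat n \<sigma> e"
      using col_signed_perm_eq[OF \<rho>] by metis
    then have V: "perm_invariant ?d y (?V \<rho> T)"
      using perm_invariant_corner_signed_perm[OF H col, of \<sigma> e y] by simp
    \<comment> \<open>Invariance concerns a factor standing next to the permutation on its left.
      Transposition exchanges the roles of \<open>P\<close> and \<open>S\<close> and brings the
      right multiplier into this position.\<close>
    have tr: "(\<Sum>P\<in>?PM. \<Sum>S\<in>?PM. ?g (A + P * (B * W\<^sup>T) * S\<^sup>T)) = (\<Sum>P\<in>?PM. perm_sum ?d y A\<^sup>T (W * (B\<^sup>T * P\<^sup>T)))"
      if W: "W \<in> carrier_mat ?d ?d" for W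
      unfolding perm_sum_def
    proof (intro sum.cong refl)
      fix P S assume PS: "P \<in> ?PM" "S \<in> ?PM"
      then have "A\<^sup>T + S * (W * (B\<^sup>T * P\<^sup>T)) = (A + P * (B * W\<^sup>T) * S\<^sup>T)\<^sup>T"
        using Ac Bc W m(2) by (simp add: square_mat_simps[where d = ?d])
      moreover have "A + P * (B * W\<^sup>T) * S\<^sup>T \<in> carrier_mat ?d ?d"
        using Ac Bc W m(2) PS by (simp add: m(1))
      ultimately show "?g (A + P * (B * W\<^sup>T) * S\<^sup>T) = ?g (A\<^sup>T + S * (W * (B\<^sup>T * P\<^sup>T)))"
        using gram_det_transpose by metis
    qed
    have "(\<Sum>P\<in>?PM. \<Sum>S\<in>?PM. ?g (A + P * (?U \<rho> T * B * (?V \<rho> T)\<^sup>T) * S\<^sup>T)) =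
      (\<Sum>S\<in>?PM. perm_sum ?d y A (?U \<rho> T * (B * (?V \<rho> T)\<^sup>T * S\<^sup>T)))"
      unfolding perm_sum_def using Ac Bc Uc Vc m(2)
      by (subst sum.swap) (intro sum.cong refl arg_cong[where f = ?g],
          simp add: square_mat_simps[where d = ?d])
    also have "\<dots> = (\<Sum>S\<in>?PM. perm_sum ?d y A (B * (?V \<rho> T)\<^sup>T * S\<^sup>T))"
    proof (rule sum.cong[OF refl])
      fix S assume "S \<in> ?PM"
      then have "B * (?V \<rho> T)\<^sup>T * S\<^sup>T \<in> carrier_mat ?d ?d" using Bc Vc m(2) by (simp add: m(1))
      then show "perm_sum ?d y A (?U \<rho> T * (B * (?V \<rho> T)\<^sup>T * S\<^sup>T)) = perm_sum ?d y A (B * (?V \<rho> T)\<^sup>T * S\<^sup>T)"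
        using U Ac unfolding perm_invariant_def by blast
    qed
    also have "\<dots> = (\<Sum>P\<in>?PM. \<Sum>S\<in>?PM. ?g (A + P * (B * (?V \<rho> T)\<^sup>T) * S\<^sup>T))"
      unfolding perm_sum_def using Bc Vc m(2)
      by (subst sum.swap) (intro sum.cong refl arg_cong[where f = ?g],
          simp add: square_mat_simps[where d = ?d])
    also have "\<dots> = (\<Sum>P\<in>?PM. perm_sum ?d y A\<^sup>T (?V \<rho> T * (B\<^sup>T * P\<^sup>T)))"
      by (rule tr[OF Vc])
    also have "\<dots> = (\<Sum>P\<in>?PM. perm_sum ?d y A\<^sup>T (1\<^sub>m ?d * (B\<^sup>T * P\<^sup>T)))"
    proof (rule sum.cong[OF refl])
      fix P assume "P \<in> ?PM"
      then have BP: "B\<^sup>T * P\<^sup>T \<in> carrier_mat ?d ?d" using Bc m(2) by (simp add: m(1))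
      moreover have "A\<^sup>T \<in> carrier_mat ?d ?d" using Ac by simp
      ultimately show "perm_sum ?d y A\<^sup>T (?V \<rho> T * (B\<^sup>T * P\<^sup>T)) = perm_sum ?d y A\<^sup>T (1\<^sub>m ?d * (B\<^sup>T * P\<^sup>T))"
        using V left_mult_one_mat[OF BP] unfolding perm_invariant_def by metis
    qed
    also have "\<dots> = (\<Sum>P\<in>?PM. \<Sum>S\<in>?PM. ?g (A + P * (B * (1\<^sub>m ?d)\<^sup>T) * S\<^sup>T))"
      by (rule tr[symmetric]) simp
    finally show ?thesis using Bc by simp
  qed
  have inner: "(\<Sum>\<rho>\<in>block_perms n. \<Sum>T\<in>Pow {..<n + n}. ?g (A + P * (?U \<rho> T * B * (?V \<rho> T)\<^sup>T) * S\<^sup>T)) =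
     (y - (a + b)\<^sup>2) * signed_perm_sum n y C D" if P: "P \<in> ?PM" and S: "S \<in> ?PM" for P S
  proof -
    note p = orth_group_cancel[OF perm_mats_orth[OF P]] and s = orth_group_cancel[OF perm_mats_orth[OF S]]
    \<comment> \<open>\<open>P\<close> and \<open>S\<close> are moved onto \<open>A\<close>. This
      preserves its row and column sums and the characteristic polynomial of
      \<open>A * A\<^sup>T\<close>, so it only replaces \<open>C\<close> by some \<open>C'\<close>
      with the same characteristic polynomial of its Gram matrix.\<close>
    let ?X = "P\<^sup>T * A * S"
    have "fixes_ones ?d ?X (1 * a * 1)"
      by (intro fixes_ones_mult fixes_ones_perm_mats perm_mats_transpose P S A)
    then have X: "fixes_ones ?d ?X a" by simp
    then have Xc: "?X \<in> carrier_mat ?d ?d" by (simp add: fixes_ones_def)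
    obtain C' where C': "C' \<in> carrier_mat n n" "?X = H * corner_mat n a C' * H\<^sup>T"
      using fixes_ones_corner[OF X H col] by blast
    have "char_poly (?X * ?X\<^sup>T) = char_poly (A * A\<^sup>T)"
      using char_poly_orth_conj[OF Ac orth_group_transpose[OF perm_mats_orth[OF P]] orth_group_transpose[OF perm_mats_orth[OF S]]]
      by simp
    also have "char_poly (A * A\<^sup>T) = [:- (a\<^sup>2), 1:] * char_poly (C * C\<^sup>T)"
    proof -
      have "poly (char_poly (A * A\<^sup>T)) x = (x - a\<^sup>2) * gram_det n x C" for x
        unfolding poly_char_poly_gram[OF Ac] by (simp only: AC gram_det_conj_corner[OF H C])
      then have "poly (char_poly (A * A\<^sup>T)) x = poly ([:- (a\<^sup>2), 1:] * char_poly (C * C\<^sup>T)) x" for x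
        by (simp add: poly_char_poly_gram[OF C] algebra_simps)
      then show ?thesis by (simp add: poly_eq_poly_eq_iff[symmetric] fun_eq_iff)
    qed
    finally have eq: "char_poly (C' * C'\<^sup>T) = char_poly (C * C\<^sup>T)"
      by (rule char_poly_corner_cancel[OF H C'])
    have "?g (A + P * (?U \<rho> T * B * (?V \<rho> T)\<^sup>T) * S\<^sup>T) = (y - (a + b)\<^sup>2) *
        gram_det n y (C' + row_signed_perm n \<rho> T * D * (col_signed_perm n \<rho> T)\<^sup>T)" for \<rho> T
    proof -
      let ?u = "row_signed_perm n \<rho> T" and ?v = "col_signed_perm n \<rho> T"
      let ?W = "?U \<rho> T * B * (?V \<rho> T)\<^sup>T"
      have Wc: "?W \<in> carrier_mat ?d ?d" using Bc by (simp add: m(1) Ec)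
      have uDv: "?u * D * ?v\<^sup>T \<in> carrier_mat n n" using D by (simp add: mult_carrier_mat[of _ n n _ n])
      have "A + P * ?W * S\<^sup>T = P * ((?X + ?W) * S\<^sup>T)"
        using p s Ac Wc by (simp add: square_mat_simps[where d = ?d])
      moreover have "gram_det ?d y (P * ((?X + ?W) * S\<^sup>T)) = gram_det ?d y (?X + ?W)"
        using gram_det_orth_left[OF perm_mats_orth[OF P], of "(?X + ?W) * S\<^sup>T" y]
          gram_det_orth_right[OF orth_group_transpose[OF perm_mats_orth[OF S]], of "?X + ?W" y] Xc Wc s(2)
        by (simp add: m(1))
      moreover have "?W = H * corner_mat n b (?u * D * ?v\<^sup>T) * H\<^sup>T"
      proof -
        have "corner_mat n b (?u * D * ?v\<^sup>T) = corner_mat n 1 ?u * corner_mat n b D * (corner_mat n 1 ?v)\<^sup>T"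
          using D by (simp add: corner_mat_transpose corner_mat_mult mult_carrier_mat[of _ n n _ n])
        then show ?thesis
          using h corner_mat_carrier[of ?u n 1] corner_mat_carrier[of ?v n 1] corner_mat_carrier[OF D, of b]
          by (simp add: BD square_mat_simps[where d = ?d])
      qed
      \<comment> \<open>The corner entries \<open>a\<close> and \<open>b\<close> add up, whatever
        the signed permutations are; this is the origin of the factor with
        \<open>(a + b)\<^sup>2\<close>.\<close>
      moreover have "H * corner_mat n a C' * H\<^sup>T + H * corner_mat n b (?u * D * ?v\<^sup>T) * H\<^sup>T =
        H * corner_mat n (a + b) (C' + ?u * D * ?v\<^sup>T) * H\<^sup>T"
        using h corner_mat_carrier[OF C'(1), of a] corner_mat_carrier[OF uDv, of b]
        by (simp add: square_mat_simps[where d = ?d] flip: corner_mat_add[OF C'(1) uDv])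
      ultimately show ?thesis
        using gram_det_conj_corner[OF H, of "C' + ?u * D * ?v\<^sup>T" y "a + b"] C' uDv by simp
    qed
    then have "(\<Sum>\<rho>\<in>block_perms n. \<Sum>T\<in>Pow {..<n + n}. ?g (A + P * (?U \<rho> T * B * (?V \<rho> T)\<^sup>T) * S\<^sup>T)) =
      (y - (a + b)\<^sup>2) * signed_perm_sum n y C' D"
      by (simp add: signed_perm_sum_gram_det[OF C'(1) D] sum_distrib_left)
    then show ?thesis using signed_perm_sum_cong[OF C'(1) C D D eq refl] by simp
  qed
  have "num_signed_perms n * (\<Sum>P\<in>?PM. \<Sum>S\<in>?PM. ?g (A + P * B * S\<^sup>T)) =
    (\<Sum>\<rho>\<in>block_perms n. \<Sum>T\<in>Pow {..<n + n}. \<Sum>P\<in>?PM. \<Sum>S\<in>?PM. ?g (A + P * B * S\<^sup>T))"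
    by (rule sum_signed_perms_const[symmetric])
  also have "\<dots> = (\<Sum>\<rho>\<in>block_perms n. \<Sum>T\<in>Pow {..<n + n}. \<Sum>P\<in>?PM. \<Sum>S\<in>?PM.
      ?g (A + P * (?U \<rho> T * B * (?V \<rho> T)\<^sup>T) * S\<^sup>T))"
    by (intro sum.cong refl swap[symmetric])
  also have "\<dots> = (\<Sum>\<rho>\<in>block_perms n. \<Sum>P\<in>?PM. \<Sum>S\<in>?PM. \<Sum>T\<in>Pow {..<n + n}.
      ?g (A + P * (?U \<rho> T * B * (?V \<rho> T)\<^sup>T) * S\<^sup>T))"
    by (intro sum.cong refl) (subst sum.swap, intro sum.cong refl sum.swap)
  also have "\<dots> = (\<Sum>P\<in>?PM. \<Sum>S\<in>?PM. \<Sum>\<rho>\<in>block_perms n. \<Sum>T\<in>Pow {..<n + n}.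
      ?g (A + P * (?U \<rho> T * B * (?V \<rho> T)\<^sup>T) * S\<^sup>T))"
    by (subst sum.swap) (intro sum.cong refl sum.swap)
  also have "\<dots> = (\<Sum>P\<in>?PM. \<Sum>S\<in>?PM. (y - (a + b)\<^sup>2) * signed_perm_sum n y C D)"
    by (intro sum.cong refl inner)
  also have "\<dots> = (real (card ?PM))\<^sup>2 * ((y - (a + b)\<^sup>2) * signed_perm_sum n y C D)"
    by (simp add: power2_eq_square)
  finally show ?thesis .
qed

theorem theorem4p10:
  fixes A B :: "real mat" and a b :: real and p q :: "real poly" and d :: nat
  assumes "d \<ge> 1"
    and "A \<in> carrier_mat d d" and "B \<in> carrier_mat d d"
    and "A *\<^sub>v ones_vec d = a \<cdot>\<^sub>v ones_vec d" and "A\<^sup>T *\<^sub>v ones_vec d = a \<cdot>\<^sub>v ones_vec d"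
    and "B *\<^sub>v ones_vec d = b \<cdot>\<^sub>v ones_vec d" and "B\<^sup>T *\<^sub>v ones_vec d = b \<cdot>\<^sub>v ones_vec d"
    and "char_poly (A * A\<^sup>T) = [:- (a\<^sup>2), 1:] * p"
    and "char_poly (B * B\<^sup>T) = [:- (b\<^sup>2), 1:] * q"
  shows "(\<forall>x::real.
      measure_pmf.expectation (pair_pmf (pmf_of_set (perm_mats d)) (pmf_of_set (perm_mats d)))
        (\<lambda>(P, S). poly (char_poly (bipartite_mat d A +
            direct_sum_mat d P S * bipartite_mat d B * (direct_sum_mat d P S)\<^sup>T)) x)
      = poly (sq_subst ([:- ((a + b)\<^sup>2), 1:] * asym_add_conv (d - 1) p q)) x)
    \<and> sq_subst ([:- ((a + b)\<^sup>2), 1:] * asym_add_conv (d - 1) p q)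
      = [:- ((a + b)\<^sup>2), 0, 1:] * sq_subst (asym_add_conv (d - 1) p q)"
proof (intro conjI allI)
  \<comment> \<open>Here \<open>n\<close> is \<open>d - 1\<close>. For \<open>d = 1\<close> the
    compressed matrices \<open>C\<close> and \<open>D\<close> have size 0, and the arguments apply
    unchanged.\<close>
  obtain n where d: "d = Suc n" using assms(1) by (cases d) auto
  have A: "fixes_ones (Suc n) A a" and B: "fixes_ones (Suc n) B b"
    using assms fixes_onesI by (auto simp: d)
  obtain H where H: "H \<in> orth_group (Suc n)" "\<And>i. i < Suc n \<Longrightarrow> H $$ (i, 0) = 1 / sqrt (Suc n)"
    using ex_orth_ones_column[of "Suc n"] by auto
  obtain C where C: "C \<in> carrier_mat n n" "A = H * corner_mat n a C * H\<^sup>T" using fixes_ones_corner[OF A H] by blast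
  obtain D where D: "D \<in> carrier_mat n n" "B = H * corner_mat n b D * H\<^sup>T" using fixes_ones_corner[OF B H] by blast
  have p: "p = char_poly (C * C\<^sup>T)" and q: "q = char_poly (D * D\<^sup>T)"
    using char_poly_corner_cancel[OF H(1) C assms(8)] char_poly_corner_cancel[OF H(1) D assms(9)] by simp_all
  let ?PM = "perm_mats d"
  fix x :: real
  have "measure_pmf.expectation (pair_pmf (pmf_of_set ?PM) (pmf_of_set ?PM))
        (\<lambda>(P, S). poly (char_poly (bipartite_mat d A +
            direct_sum_mat d P S * bipartite_mat d B * (direct_sum_mat d P S)\<^sup>T)) x) =
     (\<Sum>(P, S)\<in>?PM \<times> ?PM. poly (char_poly (bipartite_mat d A +
            direct_sum_mat d P S * bipartite_mat d B * (direct_sum_mat d P S)\<^sup>T)) x) / real (card (?PM \<times> ?PM))"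
    by (subst pair_pmf_of_set, simp_all add: perm_mats_nonempty, subst integral_pmf_of_set)
      (simp_all add: perm_mats_nonempty)
  also have "\<dots> = (\<Sum>P\<in>?PM. \<Sum>S\<in>?PM. gram_det d (x\<^sup>2) (A + P * B * S\<^sup>T)) / (real (card ?PM))\<^sup>2"
  proof -
    have "poly (char_poly (bipartite_mat d A + direct_sum_mat d P S * bipartite_mat d B * (direct_sum_mat d P S)\<^sup>T)) x =
      gram_det d (x\<^sup>2) (A + P * B * S\<^sup>T)" if "P \<in> ?PM" "S \<in> ?PM" for P S
    proof -
      have c: "P \<in> carrier_mat d d" "S \<in> carrier_mat d d" using that by (auto intro: perm_mats_carrier)
      then have "A + P * B * S\<^sup>T \<in> carrier_mat d d" using assms(2,3) by (simp add: mult_carrier_mat[of _ d d _ d])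
      then show ?thesis unfolding bipartite_mat_conj[OF assms(2,3) c] by (rule poly_char_poly_bipartite)
    qed
    then show ?thesis
      by (simp add: sum.cartesian_product[symmetric] card_cartesian_product power2_eq_square)
  qed
  also have "\<dots> = (x\<^sup>2 - (a + b)\<^sup>2) * (signed_perm_sum n (x\<^sup>2) C D / num_signed_perms n)"
  proof -
    have "real (card ?PM) \<noteq> 0" using perm_mats_nonempty by (simp add: card_eq_0_iff)
    then show ?thesis
      using perm_double_sum[OF A B H C D, of "x\<^sup>2"] num_signed_perms_pos[of n]
      by (simp add: d field_simps)
  qed
  also have "\<dots> = poly (sq_subst ([:- ((a + b)\<^sup>2), 1:] * asym_add_conv (d - 1) p q)) x"
    using poly_asym_add_conv[OF C(1) D(1) p q, of "x\<^sup>2"]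
    by (simp add: sq_subst_def poly_pcompose d power2_eq_square algebra_simps)
  finally show "measure_pmf.expectation (pair_pmf (pmf_of_set ?PM) (pmf_of_set ?PM))
        (\<lambda>(P, S). poly (char_poly (bipartite_mat d A +
            direct_sum_mat d P S * bipartite_mat d B * (direct_sum_mat d P S)\<^sup>T)) x)
      = poly (sq_subst ([:- ((a + b)\<^sup>2), 1:] * asym_add_conv (d - 1) p q)) x" .
next
  show "sq_subst ([:- ((a + b)\<^sup>2), 1:] * asym_add_conv (d - 1) p q)
      = [:- ((a + b)\<^sup>2), 0, 1:] * sq_subst (asym_add_conv (d - 1) p q)"
    unfolding sq_subst_def pcompose_mult by (simp add: pcompose_pCons)
qed

end
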